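(* Let $\mathcal{T}$ be a triangulated category and $\mathcal{X}$ a contravariantly finite rigid subcategory of $\mathcal{T}$. Then the class $\mathcal{R}$ of regular morphisms in the factor category $\mathcal{T}/\mathcal{X}^{\bot}$ admits a calculus of left and right fractions, and the Gabriel-Zisman localized category $(\mathcal{T}/\mathcal{X}^{\bot})[\mathcal{R}^{-1}]$ is equivalent to the abelian category $\mathrm{mod}\text{-}\mathcal{X}$ of coherent functors over $\mathcal{X}$.
   Context: $\mathcal{T}$ is a triangulated category with split idempotents and shift $[1]$. Subcategories are full, additive, and closed under isomorphisms and direct summands. $\mathcal{X}\subseteq\mathcal{T}$ is contravariantly finite if every $A\in\mathcal{T}$ admits a right $\mathcal{X}$-approximation, i.e. a map $X_A\to A$ with $X_A\in\mathcal{X}$ such that $\mathcal{T}(X,X_A)\to\mathcal{T}(X,A)$ is surjective for all $X\in\mathcal{X}$. $\mathcal{X}$ is rigid if $\mathcal{T}(X,X'[1])=0$ for all $X,X'\in\mathcal{X}$. $\mathcal{X}^{\bot}=\{A\in\mathcal{T}\mid \mathcal{T}(\mathcal{X},A)=0\}$. For a full subcategory $\mathcal{Z}$, the factor category $\mathcal{T}/\mathcal{Z}$ has the objects of $\mathcal{T}$ and morphisms those of $\mathcal{T}$ modulo the maps factoring through an object of $\mathcal{Z}$. A map is regular if it is both a monomorphism and an epimorphism. An additive functor $F:\mathcal{X}^{\mathrm{op}}\to\mathrm{Ab}$ is coherent if there is an exact sequence $\mathcal{X}(-,X^1)\to\mathcal{X}(-,X^0)\to F\to 0$ with $X^0,X^1\in\mathcal{X}$;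 $\mathrm{mod}\text{-}\mathcal{X}$ is the category of coherent functors (it is abelian when $\mathcal{X}$ is contravariantly finite in $\mathcal{T}$). *)

theory Defs
  imports "HOL-Algebra.Coset"
begin

section \<open>Categories\<close>

record ('o, 'm) cat =
  Obj :: "'o set"
  Arr :: "'m set"
  Dom :: "'m \<Rightarrow> 'o"
  Cod :: "'m \<Rightarrow> 'o"
  Ident :: "'o \<Rightarrow> 'm"
  Comp :: "'m \<Rightarrow> 'm \<Rightarrow> 'm"  (infixr "\<cdot>\<index>" 70)

text \<open>Composition is in applicative order: \<open>g \<cdot> f\<close> means first \<open>f\<close>, then \<open>g\<close>.\<close>

definition Hom :: "('o, 'm, 'z) cat_scheme \<Rightarrow> 'o \<Rightarrow> 'o \<Rightarrow> 'm set" where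
  "Hom C A B = {f \<in> Arr C. Dom C f = A \<and> Cod C f = B}"

locale category =
  fixes C :: "('o, 'm, 'z) cat_scheme" (structure)
  assumes Dom_closed: "f \<in> Arr C \<Longrightarrow> Dom C f \<in> Obj C"
    and Cod_closed: "f \<in> Arr C \<Longrightarrow> Cod C f \<in> Obj C"
    and Ident_closed: "A \<in> Obj C \<Longrightarrow> Ident C A \<in> Hom C A A"
    and Comp_closed: "\<lbrakk>f \<in> Hom C A B; g \<in> Hom C B D\<rbrakk> \<Longrightarrow> g \<cdot> f \<in> Hom C A D"
    and Comp_Ident_right: "f \<in> Hom C A B \<Longrightarrow> f \<cdot> Ident C A = f"
    and Comp_Ident_left: "f \<in> Hom C A B \<Longrightarrow> Ident C B \<cdot> f = f"
    and Comp_assoc: "\<lbrakk>f \<in> Hom C A B; g \<in> Hom C B D; h \<in> Hom C D E\<rbrakk>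
          \<Longrightarrow> h \<cdot> (g \<cdot> f) = (h \<cdot> g) \<cdot> f"

definition isomorphism :: "('o, 'm, 'z) cat_scheme \<Rightarrow> 'm \<Rightarrow> bool" where
  "isomorphism C f \<longleftrightarrow> f \<in> Arr C \<and>
     (\<exists>g \<in> Hom C (Cod C f) (Dom C f).
        g \<cdot>\<^bsub>C\<^esub> f = Ident C (Dom C f) \<and> f \<cdot>\<^bsub>C\<^esub> g = Ident C (Cod C f))"

definition monic :: "('o, 'm, 'z) cat_scheme \<Rightarrow> 'm \<Rightarrow> bool" where
  "monic C f \<longleftrightarrow> f \<in> Arr C \<and>
     (\<forall>A \<in> Obj C. \<forall>g \<in> Hom C A (Dom C f). \<forall>h \<in> Hom C A (Dom C f).
        f \<cdot>\<^bsub>C\<^esub> g = f \<cdot>\<^bsub>C\<^esub> h \<longrightarrow> g = h)"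

definition epic :: "('o, 'm, 'z) cat_scheme \<Rightarrow> 'm \<Rightarrow> bool" where
  "epic C f \<longleftrightarrow> f \<in> Arr C \<and>
     (\<forall>A \<in> Obj C. \<forall>g \<in> Hom C (Cod C f) A. \<forall>h \<in> Hom C (Cod C f) A.
        g \<cdot>\<^bsub>C\<^esub> f = h \<cdot>\<^bsub>C\<^esub> f \<longrightarrow> g = h)"

definition regular_arrows :: "('o, 'm, 'z) cat_scheme \<Rightarrow> 'm set" where
  "regular_arrows C = {f. monic C f \<and> epic C f}"

definition zero_object :: "('o, 'm, 'z) cat_scheme \<Rightarrow> 'o \<Rightarrow> bool" where
  "zero_object C Z \<longleftrightarrow> Z \<in> Obj C \<and>
     (\<forall>A \<in> Obj C. (\<exists>!f. f \<in> Hom C A Z) \<and> (\<exists>!f. f \<in> Hom C Z A))"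

definition split_idempotents :: "('o, 'm, 'z) cat_scheme \<Rightarrow> bool" where
  "split_idempotents C \<longleftrightarrow>
     (\<forall>A \<in> Obj C. \<forall>e \<in> Hom C A A. e \<cdot>\<^bsub>C\<^esub> e = e \<longrightarrow>
        (\<exists>B \<in> Obj C. \<exists>r \<in> Hom C A B. \<exists>s \<in> Hom C B A.
           r \<cdot>\<^bsub>C\<^esub> s = Ident C B \<and> s \<cdot>\<^bsub>C\<^esub> r = e))"


section \<open>Functors and equivalences\<close>

text \<open>A functor is given by its object map and its arrow map.\<close>

definition is_functor ::
  "('o, 'm, 'y) cat_scheme \<Rightarrow> ('p, 'n, 'z) cat_scheme \<Rightarrow> ('o \<Rightarrow> 'p) \<Rightarrow> ('m \<Rightarrow> 'n) \<Rightarrow> bool" where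
  "is_functor C D Fo Fa \<longleftrightarrow> category C \<and> category D \<and>
     (\<forall>A \<in> Obj C. Fo A \<in> Obj D) \<and>
     (\<forall>A \<in> Obj C. \<forall>B \<in> Obj C. \<forall>f \<in> Hom C A B. Fa f \<in> Hom D (Fo A) (Fo B)) \<and>
     (\<forall>A \<in> Obj C. Fa (Ident C A) = Ident D (Fo A)) \<and>
     (\<forall>f \<in> Arr C. \<forall>g \<in> Arr C. Dom C g = Cod C f \<longrightarrow> Fa (g \<cdot>\<^bsub>C\<^esub> f) = Fa g \<cdot>\<^bsub>D\<^esub> Fa f)"

definition naturally_isomorphic ::
  "('o, 'm, 'y) cat_scheme \<Rightarrow> ('p, 'n, 'z) cat_scheme \<Rightarrow>
     ('o \<Rightarrow> 'p) \<Rightarrow> ('m \<Rightarrow> 'n) \<Rightarrow> ('o \<Rightarrow> 'p) \<Rightarrow> ('m \<Rightarrow> 'n) \<Rightarrow> bool" where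
  "naturally_isomorphic C D Fo Fa Go Ga \<longleftrightarrow>
     (\<exists>\<eta>. (\<forall>A \<in> Obj C. \<eta> A \<in> Hom D (Fo A) (Go A) \<and> isomorphism D (\<eta> A)) \<and>
          (\<forall>f \<in> Arr C. \<eta> (Cod C f) \<cdot>\<^bsub>D\<^esub> Fa f = Ga f \<cdot>\<^bsub>D\<^esub> \<eta> (Dom C f)))"

definition is_equivalence ::
  "('o, 'm, 'y) cat_scheme \<Rightarrow> ('p, 'n, 'z) cat_scheme \<Rightarrow> ('o \<Rightarrow> 'p) \<Rightarrow> ('m \<Rightarrow> 'n) \<Rightarrow> bool" where
  "is_equivalence C D Fo Fa \<longleftrightarrow> is_functor C D Fo Fa \<and>
     (\<exists>Go Ga. is_functor D C Go Ga \<and>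
        naturally_isomorphic C C (Go \<circ> Fo) (Ga \<circ> Fa) id id \<and>
        naturally_isomorphic D D (Fo \<circ> Go) (Fa \<circ> Ga) id id)"

definition equivalent_categories ::
  "('o, 'm, 'y) cat_scheme \<Rightarrow> ('p, 'n, 'z) cat_scheme \<Rightarrow> bool" where
  "equivalent_categories C D \<longleftrightarrow> (\<exists>Fo Fa. is_equivalence C D Fo Fa)"


section \<open>Additive and abelian categories\<close>

record ('o, 'm) preadd_cat = "('o, 'm) cat" +
  Add :: "'m \<Rightarrow> 'm \<Rightarrow> 'm"
  Zero :: "'o \<Rightarrow> 'o \<Rightarrow> 'm"

text \<open>The additive groups of morphisms are written as (multiplicative) HOL-Algebra groups.\<close>

definition hom_group :: "('o, 'm, 'z) preadd_cat_scheme \<Rightarrow> 'o \<Rightarrow> 'o \<Rightarrow> 'm monoid" where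
  "hom_group C A B = \<lparr>carrier = Hom C A B, mult = Add C, one = Zero C A B\<rparr>"

definition Neg :: "('o, 'm, 'z) preadd_cat_scheme \<Rightarrow> 'm \<Rightarrow> 'm" where
  "Neg C f = inv\<^bsub>hom_group C (Dom C f) (Cod C f)\<^esub> f"

locale preadditive_category = category C
  for C :: "('o, 'm, 'z) preadd_cat_scheme" (structure) +
  assumes hom_comm_group: "\<lbrakk>A \<in> Obj C; B \<in> Obj C\<rbrakk> \<Longrightarrow> comm_group (hom_group C A B)"
    and Comp_Add_right: "\<lbrakk>f \<in> Hom C A B; f' \<in> Hom C A B; g \<in> Hom C B D\<rbrakk>
          \<Longrightarrow> g \<cdot> Add C f f' = Add C (g \<cdot> f) (g \<cdot> f')"
    and Comp_Add_left: "\<lbrakk>f \<in> Hom C A B; g \<in> Hom C B D; g' \<in> Hom C B D\<rbrakk>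
          \<Longrightarrow> Add C g g' \<cdot> f = Add C (g \<cdot> f) (g' \<cdot> f)"

definition direct_sum :: "('o, 'm, 'z) preadd_cat_scheme \<Rightarrow> 'o \<Rightarrow> 'o \<Rightarrow> 'o \<Rightarrow> bool" where
  "direct_sum C A B S \<longleftrightarrow> A \<in> Obj C \<and> B \<in> Obj C \<and> S \<in> Obj C \<and>
     (\<exists>i \<in> Hom C A S. \<exists>j \<in> Hom C B S. \<exists>p \<in> Hom C S A. \<exists>q \<in> Hom C S B.
        p \<cdot>\<^bsub>C\<^esub> i = Ident C A \<and> q \<cdot>\<^bsub>C\<^esub> j = Ident C B \<and>
        p \<cdot>\<^bsub>C\<^esub> j = Zero C B A \<and> q \<cdot>\<^bsub>C\<^esub> i = Zero C A B \<and>
        Add C (i \<cdot>\<^bsub>C\<^esub> p) (j \<cdot>\<^bsub>C\<^esub> q) = Ident C S)"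

locale additive_category = preadditive_category C
  for C :: "('o, 'm, 'z) preadd_cat_scheme" (structure) +
  assumes ex_zero_object: "\<exists>Z. zero_object C Z"
    and ex_direct_sum: "\<lbrakk>A \<in> Obj C; B \<in> Obj C\<rbrakk> \<Longrightarrow> \<exists>S. direct_sum C A B S"

definition is_kernel :: "('o, 'm, 'z) preadd_cat_scheme \<Rightarrow> 'm \<Rightarrow> 'm \<Rightarrow> bool" where
  "is_kernel C k f \<longleftrightarrow> f \<in> Arr C \<and> k \<in> Arr C \<and> Cod C k = Dom C f \<and>
     f \<cdot>\<^bsub>C\<^esub> k = Zero C (Dom C k) (Cod C f) \<and>
     (\<forall>A \<in> Obj C. \<forall>g \<in> Hom C A (Dom C f). f \<cdot>\<^bsub>C\<^esub> g = Zero C A (Cod C f) \<longrightarrow>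
        (\<exists>!h. h \<in> Hom C A (Dom C k) \<and> k \<cdot>\<^bsub>C\<^esub> h = g))"

definition is_cokernel :: "('o, 'm, 'z) preadd_cat_scheme \<Rightarrow> 'm \<Rightarrow> 'm \<Rightarrow> bool" where
  "is_cokernel C c f \<longleftrightarrow> f \<in> Arr C \<and> c \<in> Arr C \<and> Dom C c = Cod C f \<and>
     c \<cdot>\<^bsub>C\<^esub> f = Zero C (Dom C f) (Cod C c) \<and>
     (\<forall>A \<in> Obj C. \<forall>g \<in> Hom C (Cod C f) A. g \<cdot>\<^bsub>C\<^esub> f = Zero C (Dom C f) A \<longrightarrow>
        (\<exists>!h. h \<in> Hom C (Cod C c) A \<and> h \<cdot>\<^bsub>C\<^esub> c = g))"

locale abelian_category = additive_category C
  for C :: "('o, 'm, 'z) preadd_cat_scheme" (structure) +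
  assumes ex_kernel: "f \<in> Arr C \<Longrightarrow> \<exists>k. is_kernel C k f"
    and ex_cokernel: "f \<in> Arr C \<Longrightarrow> \<exists>c. is_cokernel C c f"
    and monic_is_kernel: "monic C f \<Longrightarrow> \<exists>g. is_kernel C f g"
    and epic_is_cokernel: "epic C f \<Longrightarrow> \<exists>g. is_cokernel C f g"


section \<open>Triangulated categories\<close>

record ('o, 'm) tri_cat = "('o, 'm) preadd_cat" +
  Sh :: "'o \<Rightarrow> 'o"
  ShA :: "'m \<Rightarrow> 'm"
  Tri :: "('m \<times> 'm \<times> 'm) set"

text \<open>Diagrams \<open>A \<rightarrow> B \<rightarrow> D \<rightarrow> A[1]\<close>, not necessarily distinguished.\<close>

definition triangle :: "('o, 'm, 'z) tri_cat_scheme \<Rightarrow> 'm \<Rightarrow> 'm \<Rightarrow> 'm \<Rightarrow> bool" where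
  "triangle T u v w \<longleftrightarrow> u \<in> Arr T \<and> v \<in> Arr T \<and> w \<in> Arr T \<and>
     Dom T v = Cod T u \<and> Dom T w = Cod T v \<and> Cod T w = Sh T (Dom T u)"

text \<open>
  Verdier's axioms. The shift is only required to be an additive auto-equivalence, which includes
  the convention that it is an automorphism.
\<close>

locale triangulated_category = additive_category T
  for T :: "('o, 'm, 'z) tri_cat_scheme" (structure) +
  assumes shift_equivalence: "is_equivalence T T (Sh T) (ShA T)"
    and shift_additive: "\<lbrakk>f \<in> Hom T A B; g \<in> Hom T A B\<rbrakk>
          \<Longrightarrow> ShA T (Add T f g) = Add T (ShA T f) (ShA T g)"
    and Tri_triangle: "(u, v, w) \<in> Tri T \<Longrightarrow> triangle T u v w"
    and TR1_iso: "\<lbrakk>(u, v, w) \<in> Tri T; triangle T u' v' w';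
          a \<in> Hom T (Dom T u) (Dom T u'); b \<in> Hom T (Cod T u) (Cod T u');
          c \<in> Hom T (Cod T v) (Cod T v');
          isomorphism T a; isomorphism T b; isomorphism T c;
          b \<cdot> u = u' \<cdot> a; c \<cdot> v = v' \<cdot> b; ShA T a \<cdot> w = w' \<cdot> c\<rbrakk>
          \<Longrightarrow> (u', v', w') \<in> Tri T"
    and TR1_Ident: "\<lbrakk>A \<in> Obj T; zero_object T Z\<rbrakk>
          \<Longrightarrow> (Ident T A, Zero T A Z, Zero T Z (Sh T A)) \<in> Tri T"
    and TR1_cone: "u \<in> Arr T \<Longrightarrow> \<exists>v w. (u, v, w) \<in> Tri T"
    and TR2: "triangle T u v w \<Longrightarrow> (u, v, w) \<in> Tri T \<longleftrightarrow> (v, w, Neg T (ShA T u)) \<in> Tri T"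
    and TR3: "\<lbrakk>(u, v, w) \<in> Tri T; (u', v', w') \<in> Tri T;
          a \<in> Hom T (Dom T u) (Dom T u'); b \<in> Hom T (Cod T u) (Cod T u');
          b \<cdot> u = u' \<cdot> a\<rbrakk>
          \<Longrightarrow> \<exists>c \<in> Hom T (Cod T v) (Cod T v'). c \<cdot> v = v' \<cdot> b \<and> ShA T a \<cdot> w = w' \<cdot> c"
    and TR4: "\<lbrakk>(u, i, i') \<in> Tri T; (v, j, j') \<in> Tri T; (v \<cdot> u, k, k') \<in> Tri T;
          Dom T v = Cod T u\<rbrakk>
          \<Longrightarrow> \<exists>f \<in> Hom T (Cod T i) (Cod T k). \<exists>g \<in> Hom T (Cod T k) (Cod T j).
                (f, g, ShA T i \<cdot> j') \<in> Tri T \<and>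
                f \<cdot> i = k \<cdot> v \<and> k' \<cdot> f = i' \<and> g \<cdot> k = j \<and> j' \<cdot> g = ShA T u \<cdot> k'"


section \<open>Subcategories\<close>

text \<open>
  Full subcategories are given by their sets of objects. The ones considered are additive and
  closed under isomorphisms and direct summands.
\<close>

definition additive_subcategory :: "('o, 'm, 'z) preadd_cat_scheme \<Rightarrow> 'o set \<Rightarrow> bool" where
  "additive_subcategory C X \<longleftrightarrow> X \<subseteq> Obj C \<and>
     (\<exists>Z \<in> X. zero_object C Z) \<and>
     (\<forall>A \<in> X. \<forall>B \<in> X. \<forall>S. direct_sum C A B S \<longrightarrow> S \<in> X) \<and>
     (\<forall>A \<in> X. \<forall>f. isomorphism C f \<and> Dom C f = A \<longrightarrow> Cod C f \<in> X) \<and>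
     (\<forall>S \<in> X. \<forall>A B. direct_sum C A B S \<longrightarrow> A \<in> X)"

definition right_approximation ::
  "('o, 'm, 'z) cat_scheme \<Rightarrow> 'o set \<Rightarrow> 'o \<Rightarrow> 'm \<Rightarrow> bool" where
  "right_approximation C X A f \<longleftrightarrow> f \<in> Arr C \<and> Dom C f \<in> X \<and> Cod C f = A \<and>
     (\<forall>X' \<in> X. (\<lambda>g. f \<cdot>\<^bsub>C\<^esub> g) ` Hom C X' (Dom C f) = Hom C X' A)"

definition contravariantly_finite :: "('o, 'm, 'z) cat_scheme \<Rightarrow> 'o set \<Rightarrow> bool" where
  "contravariantly_finite C X \<longleftrightarrow> (\<forall>A \<in> Obj C. \<exists>f. right_approximation C X A f)"

definition rigid :: "('o, 'm, 'z) tri_cat_scheme \<Rightarrow> 'o set \<Rightarrow> bool" where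
  "rigid T X \<longleftrightarrow> (\<forall>A \<in> X. \<forall>B \<in> X. Hom T A (Sh T B) = {Zero T A (Sh T B)})"

definition right_perp :: "('o, 'm, 'z) preadd_cat_scheme \<Rightarrow> 'o set \<Rightarrow> 'o set" where
  "right_perp C X = {A \<in> Obj C. \<forall>B \<in> X. Hom C B A = {Zero C B A}}"


section \<open>Factor categories\<close>

definition factoring :: "('o, 'm, 'z) cat_scheme \<Rightarrow> 'o set \<Rightarrow> 'o \<Rightarrow> 'o \<Rightarrow> 'm set" where
  "factoring C Z A B = {f. \<exists>D \<in> Z. \<exists>g \<in> Hom C A D. \<exists>h \<in> Hom C D B. f = h \<cdot>\<^bsub>C\<^esub> g}"

text \<open>
  An arrow \<open>A \<rightarrow> B\<close> of the factor category is a coset in \<open>C(A,B)\<close> of the subgroup of the maps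
  factoring through an object of \<open>Z\<close>, together with \<open>A\<close> and \<open>B\<close>.
\<close>

definition factor_category ::
  "('o, 'm, 'z) preadd_cat_scheme \<Rightarrow> 'o set \<Rightarrow> ('o, 'o \<times> 'o \<times> 'm set) cat" where
  "factor_category C Z =
     \<lparr>Obj = Obj C,
      Arr = {(A, B, c). A \<in> Obj C \<and> B \<in> Obj C \<and>
               c \<in> carrier (hom_group C A B Mod factoring C Z A B)},
      Dom = (\<lambda>(A, B, c). A),
      Cod = (\<lambda>(A, B, c). B),
      Ident = (\<lambda>A. (A, A, factoring C Z A A #>\<^bsub>hom_group C A A\<^esub> Ident C A)),
      Comp = (\<lambda>(B', D, d) (A, B, c).
                (A, D, \<Union>g \<in> d. \<Union>f \<in> c. factoring C Z A D #>\<^bsub>hom_group C A D\<^esub> (g \<cdot>\<^bsub>C\<^esub> f)))\<rparr>"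


section \<open>Calculi of fractions and localization\<close>

definition left_calculus_of_fractions :: "('o, 'm, 'z) cat_scheme \<Rightarrow> 'm set \<Rightarrow> bool" where
  "left_calculus_of_fractions C R \<longleftrightarrow> R \<subseteq> Arr C \<and>
     (\<forall>A \<in> Obj C. Ident C A \<in> R) \<and>
     (\<forall>s \<in> R. \<forall>t \<in> R. Dom C t = Cod C s \<longrightarrow> t \<cdot>\<^bsub>C\<^esub> s \<in> R) \<and>
     (\<forall>s \<in> R. \<forall>u \<in> Arr C. Dom C u = Dom C s \<longrightarrow>
        (\<exists>t \<in> R. \<exists>v \<in> Arr C. Dom C t = Cod C u \<and> Dom C v = Cod C s \<and> Cod C t = Cod C v \<and>
           v \<cdot>\<^bsub>C\<^esub> s = t \<cdot>\<^bsub>C\<^esub> u)) \<and>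
     (\<forall>A \<in> Obj C. \<forall>B \<in> Obj C. \<forall>f \<in> Hom C A B. \<forall>g \<in> Hom C A B. \<forall>s \<in> R.
        Cod C s = A \<and> f \<cdot>\<^bsub>C\<^esub> s = g \<cdot>\<^bsub>C\<^esub> s \<longrightarrow>
          (\<exists>t \<in> R. Dom C t = B \<and> t \<cdot>\<^bsub>C\<^esub> f = t \<cdot>\<^bsub>C\<^esub> g))"

definition right_calculus_of_fractions :: "('o, 'm, 'z) cat_scheme \<Rightarrow> 'm set \<Rightarrow> bool" where
  "right_calculus_of_fractions C R \<longleftrightarrow> R \<subseteq> Arr C \<and>
     (\<forall>A \<in> Obj C. Ident C A \<in> R) \<and>
     (\<forall>s \<in> R. \<forall>t \<in> R. Dom C t = Cod C s \<longrightarrow> t \<cdot>\<^bsub>C\<^esub> s \<in> R) \<and>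
     (\<forall>s \<in> R. \<forall>u \<in> Arr C. Cod C u = Cod C s \<longrightarrow>
        (\<exists>t \<in> R. \<exists>v \<in> Arr C. Cod C t = Dom C u \<and> Cod C v = Dom C s \<and> Dom C t = Dom C v \<and>
           s \<cdot>\<^bsub>C\<^esub> v = u \<cdot>\<^bsub>C\<^esub> t)) \<and>
     (\<forall>A \<in> Obj C. \<forall>B \<in> Obj C. \<forall>f \<in> Hom C A B. \<forall>g \<in> Hom C A B. \<forall>s \<in> R.
        Dom C s = B \<and> s \<cdot>\<^bsub>C\<^esub> f = s \<cdot>\<^bsub>C\<^esub> g \<longrightarrow>
          (\<exists>t \<in> R. Cod C t = A \<and> f \<cdot>\<^bsub>C\<^esub> t = g \<cdot>\<^bsub>C\<^esub> t))"

text \<open>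
  Gabriel and Zisman's construction of \<open>C[R\<^sup>-\<^sup>1]\<close>: the category of paths in the graph of the arrows
  \<open>Fwd f\<close> of \<open>C\<close> and formal inverses \<open>Bwd s\<close> of the arrows \<open>s\<close> in \<open>R\<close>, modulo the relations of \<open>C\<close>
  and those making \<open>Bwd s\<close> inverse to \<open>Fwd s\<close>. Paths are lists read in diagrammatic order.
\<close>

datatype 'm letter = Fwd 'm | Bwd 'm

primrec letter_src :: "('o, 'm, 'z) cat_scheme \<Rightarrow> 'm letter \<Rightarrow> 'o" where
  "letter_src C (Fwd f) = Dom C f"
| "letter_src C (Bwd s) = Cod C s"

primrec letter_tgt :: "('o, 'm, 'z) cat_scheme \<Rightarrow> 'm letter \<Rightarrow> 'o" where
  "letter_tgt C (Fwd f) = Cod C f"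
| "letter_tgt C (Bwd s) = Dom C s"

primrec is_path ::
  "('o, 'm, 'z) cat_scheme \<Rightarrow> 'm set \<Rightarrow> 'o \<Rightarrow> 'm letter list \<Rightarrow> 'o \<Rightarrow> bool" where
  "is_path C R A [] B \<longleftrightarrow> A \<in> Obj C \<and> A = B"
| "is_path C R A (x # xs) B \<longleftrightarrow>
     x \<in> Fwd ` Arr C \<union> Bwd ` R \<and> letter_src C x = A \<and> is_path C R (letter_tgt C x) xs B"

inductive path_relation ::
  "('o, 'm, 'z) cat_scheme \<Rightarrow> 'm set \<Rightarrow> 'm letter list \<Rightarrow> 'm letter list \<Rightarrow> bool"
  for C :: "('o, 'm, 'z) cat_scheme" and R :: "'m set" where
  rel_Comp: "\<lbrakk>f \<in> Arr C; g \<in> Arr C; Dom C g = Cod C f\<rbrakk>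
      \<Longrightarrow> path_relation C R [Fwd f, Fwd g] [Fwd (g \<cdot>\<^bsub>C\<^esub> f)]"
| rel_Ident: "A \<in> Obj C \<Longrightarrow> path_relation C R [Fwd (Ident C A)] []"
| rel_Fwd_Bwd: "s \<in> R \<Longrightarrow> path_relation C R [Fwd s, Bwd s] []"
| rel_Bwd_Fwd: "s \<in> R \<Longrightarrow> path_relation C R [Bwd s, Fwd s] []"

inductive path_equiv ::
  "('o, 'm, 'z) cat_scheme \<Rightarrow> 'm set \<Rightarrow> 'o \<Rightarrow> 'o \<Rightarrow> 'm letter list \<Rightarrow> 'm letter list \<Rightarrow> bool"
  for C :: "('o, 'm, 'z) cat_scheme" and R :: "'m set" and A B :: 'o where
  path_step: "\<lbrakk>path_relation C R l r; is_path C R A (xs @ l @ ys) B; is_path C R A (xs @ r @ ys) B\<rbrakk>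
      \<Longrightarrow> path_equiv C R A B (xs @ l @ ys) (xs @ r @ ys)"
| path_refl: "is_path C R A xs B \<Longrightarrow> path_equiv C R A B xs xs"
| path_sym: "path_equiv C R A B xs ys \<Longrightarrow> path_equiv C R A B ys xs"
| path_trans: "\<lbrakk>path_equiv C R A B xs ys; path_equiv C R A B ys zs\<rbrakk> \<Longrightarrow> path_equiv C R A B xs zs"

definition localization ::
  "('o, 'm, 'z) cat_scheme \<Rightarrow> 'm set \<Rightarrow> ('o, 'o \<times> 'o \<times> 'm letter list set) cat" where
  "localization C R =
     \<lparr>Obj = Obj C,
      Arr = {(A, B, p). \<exists>xs. is_path C R A xs B \<and> p = {ys. path_equiv C R A B xs ys}},
      Dom = (\<lambda>(A, B, p). A),
      Cod = (\<lambda>(A, B, p). B),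
      Ident = (\<lambda>A. (A, A, {ys. path_equiv C R A A [] ys})),
      Comp = (\<lambda>(B', D, q) (A, B, p).
                (A, D, \<Union>xs \<in> p. \<Union>ys \<in> q. {zs. path_equiv C R A D (xs @ ys) zs}))\<rparr>"


section \<open>Coherent functors\<close>

text \<open>
  Functors \<open>X\<^sup>o\<^sup>p \<rightarrow> Ab\<close> on the full subcategory on \<open>X\<close>. The abelian groups are HOL-Algebra groups
  with elements in the type \<open>'g\<close>. The values of \<open>On_obj\<close> and \<open>On_arr\<close> outside \<open>X\<close> are irrelevant.
\<close>

record ('o, 'm, 'g) ab_functor =
  On_obj :: "'o \<Rightarrow> 'g monoid"
  On_arr :: "'m \<Rightarrow> 'g \<Rightarrow> 'g"

definition additive_functor ::
  "('o, 'm, 'z) preadd_cat_scheme \<Rightarrow> 'o set \<Rightarrow> ('o, 'm, 'g) ab_functor \<Rightarrow> bool" where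
  "additive_functor C X F \<longleftrightarrow>
     (\<forall>A \<in> X. comm_group (On_obj F A)) \<and>
     (\<forall>A \<in> X. \<forall>B \<in> X. \<forall>f \<in> Hom C A B. On_arr F f \<in> hom (On_obj F B) (On_obj F A)) \<and>
     (\<forall>A \<in> X. \<forall>x \<in> carrier (On_obj F A). On_arr F (Ident C A) x = x) \<and>
     (\<forall>A \<in> X. \<forall>B \<in> X. \<forall>D \<in> X. \<forall>f \<in> Hom C A B. \<forall>g \<in> Hom C B D. \<forall>x \<in> carrier (On_obj F D).
        On_arr F (g \<cdot>\<^bsub>C\<^esub> f) x = On_arr F f (On_arr F g x)) \<and>
     (\<forall>A \<in> X. \<forall>B \<in> X. \<forall>f \<in> Hom C A B. \<forall>g \<in> Hom C A B. \<forall>x \<in> carrier (On_obj F B).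
        On_arr F (Add C f g) x = On_arr F f x \<otimes>\<^bsub>On_obj F A\<^esub> On_arr F g x)"

definition natural_transformation ::
  "('o, 'm, 'z) cat_scheme \<Rightarrow> 'o set \<Rightarrow> ('o, 'm, 'g) ab_functor \<Rightarrow> ('o, 'm, 'h) ab_functor
     \<Rightarrow> ('o \<Rightarrow> 'g \<Rightarrow> 'h) \<Rightarrow> bool" where
  "natural_transformation C X F G \<eta> \<longleftrightarrow>
     (\<forall>A \<in> X. \<eta> A \<in> hom (On_obj F A) (On_obj G A)) \<and>
     (\<forall>A \<in> X. \<forall>B \<in> X. \<forall>f \<in> Hom C A B. \<forall>x \<in> carrier (On_obj F B).
        \<eta> A (On_arr F f x) = On_arr G f (\<eta> B x))"

definition representable :: "('o, 'm, 'z) preadd_cat_scheme \<Rightarrow> 'o \<Rightarrow> ('o, 'm, 'm) ab_functor" where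
  "representable C B = \<lparr>On_obj = (\<lambda>A. hom_group C A B), On_arr = (\<lambda>f g. g \<cdot>\<^bsub>C\<^esub> f)\<rparr>"

definition coherent ::
  "('o, 'm, 'z) preadd_cat_scheme \<Rightarrow> 'o set \<Rightarrow> ('o, 'm, 'g) ab_functor \<Rightarrow> bool" where
  "coherent C X F \<longleftrightarrow> additive_functor C X F \<and>
     (\<exists>X1 \<in> X. \<exists>X0 \<in> X. \<exists>\<alpha> \<pi>.
        natural_transformation C X (representable C X1) (representable C X0) \<alpha> \<and>
        natural_transformation C X (representable C X0) F \<pi> \<and>
        (\<forall>A \<in> X. \<alpha> A ` Hom C A X1 = kernel (hom_group C A X0) (On_obj F A) (\<pi> A)) \<and>
        (\<forall>A \<in> X. \<pi> A ` Hom C A X0 = carrier (On_obj F A)))"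

text \<open>
  Families of maps cut down to their proper domains, so that equality of arrows in the category
  of coherent functors is equality of natural transformations.
\<close>

definition restrict_family ::
  "'o set \<Rightarrow> ('o, 'm, 'g) ab_functor \<Rightarrow> ('o \<Rightarrow> 'g \<Rightarrow> 'g) \<Rightarrow> 'o \<Rightarrow> 'g \<Rightarrow> 'g" where
  "restrict_family X F \<eta> = (\<lambda>A \<in> X. \<lambda>x \<in> carrier (On_obj F A). \<eta> A x)"

type_synonym ('o, 'm, 'g) ab_transformation =
  "('o, 'm, 'g) ab_functor \<times> ('o, 'm, 'g) ab_functor \<times> ('o \<Rightarrow> 'g \<Rightarrow> 'g)"

definition mod_category ::
  "('o, 'm, 'z) preadd_cat_scheme \<Rightarrow> 'o set
     \<Rightarrow> (('o, 'm, 'g) ab_functor, ('o, 'm, 'g) ab_transformation) preadd_cat" where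
  "mod_category C X =
     \<lparr>Obj = {F. coherent C X F},
      Arr = {(F, G, \<eta>). coherent C X F \<and> coherent C X G \<and>
               natural_transformation C X F G \<eta> \<and> \<eta> = restrict_family X F \<eta>},
      Dom = (\<lambda>(F, G, \<eta>). F),
      Cod = (\<lambda>(F, G, \<eta>). G),
      Ident = (\<lambda>F. (F, F, restrict_family X F (\<lambda>A x. x))),
      Comp = (\<lambda>(G', H, \<theta>) (F, G, \<eta>). (F, H, restrict_family X F (\<lambda>A x. \<theta> A (\<eta> A x)))),
      Add = (\<lambda>(F, G, \<eta>) (F', G', \<theta>).
               (F, G, restrict_family X F (\<lambda>A x. \<eta> A x \<otimes>\<^bsub>On_obj G A\<^esub> \<theta> A x))),
      Zero = (\<lambda>F G. (F, G, restrict_family X F (\<lambda>A x. \<one>\<^bsub>On_obj G A\<^esub>)))\<rparr>"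

text \<open>
  Smallness condition for functors to abelian groups with elements in \<open>'g\<close>: every \<open>C(A,B)\<close> is in
  bijection with a set of elements of \<open>'g\<close>. It always holds for \<open>'g = 'm\<close>.
\<close>

definition locally_small :: "('o, 'm, 'z) cat_scheme \<Rightarrow> 'g itself \<Rightarrow> bool" where
  "locally_small C (_ :: 'g itself) \<longleftrightarrow>
     (\<forall>A \<in> Obj C. \<forall>B \<in> Obj C. \<exists>\<iota> :: 'm \<Rightarrow> 'g. inj_on \<iota> (Hom C A B))"

end

theory Submission
  imports Defs
begin

text \<open>
  Write \<open>H A\<close> for the restriction of \<open>T(-,A)\<close> to \<open>X\<close>. Completing a map \<open>P \<rightarrow> B\<close> with \<open>P \<in> X\<close> to a
  triangle gives a weak cokernel \<open>B \<rightarrow> E\<close> on which \<open>H\<close> is right exact, because \<open>X\<close> is rigid; shifted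
  cones give weak kernels. Everything else is derived from these two facts and the approximations.
  A map vanishes under \<open>H\<close> iff it factors through \<open>X\<^sup>\<bottom>\<close>, so \<open>H\<close> is faithful on the factor category,
  and a map is regular there iff \<open>H\<close> sends it to an isomorphism. The cone \<open>C\<close> of a map in \<open>X\<close> has
  \<open>T(C,B) \<rightarrow> Hom(H C, H B)\<close> surjective, every coherent functor is isomorphic to some \<open>H C\<close>, and every
  object \<open>A\<close> receives a regular map \<open>q : C \<rightarrow> A\<close> from such a cone. Hence every arrow of the localization
  has the form \<open>f q\<^sup>-\<^sup>1\<close>, and \<open>H\<close> induces an equivalence.
\<close>

section \<open>Categories, equivalences and localization\<close>

text \<open>The obstacle is fullness: T(A,B) -> Hom(H A, H B) need not be onto for arbitrary A. It
  is bijective for A in X by the Yoneda lemma, and right exactness carries surjectivity over to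
  cones of maps in X: a transformation out of such a cone comes from a single map out of an object
  of X that the presentation kills. At a general A, fullness is restored by one formal inverse
  depending only on A, so two paths out of A can be compared over the same denominator. Rigidity
  enters at one point: for Y in X and E the cone of P -> B, a map Y -> E becomes zero in P[1] and so
  lifts to B. This is why weak cokernels are taken only of maps out of X, and why a map out of
  another object is first composed with an approximation. A second obstacle is one of types.
  Coherent functors here take values in \<open>'g\<close>, whereas H A consists of arrows of type
  \<open>'m\<close>. Hence H A occurs only through copies of it in \<open>'g\<close>, each given
  with a natural bijection, and transformations are compared through these bijections.\<close>

lemma Hom_iff: "f \<in> Hom C A B \<longleftrightarrow> f \<in> Arr C \<and> Dom C f = A \<and> Cod C f = B"
  by (auto simp: Hom_def)

lemma Hom_DomD: "f \<in> Hom C A B \<Longrightarrow> Dom C f = A"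
  and Hom_CodD: "f \<in> Hom C A B \<Longrightarrow> Cod C f = B"
  by (simp_all add: Hom_iff)

context category
begin

lemma Hom_objs: "f \<in> Hom C A B \<Longrightarrow> A \<in> Obj C" "f \<in> Hom C A B \<Longrightarrow> B \<in> Obj C"
  using Dom_closed Cod_closed by (auto simp: Hom_iff)

lemma monic_iff:
  assumes "f \<in> Hom C B D"
  shows "monic C f \<longleftrightarrow> (\<forall>A. \<forall>g\<in>Hom C A B. \<forall>h\<in>Hom C A B. f \<cdot> g = f \<cdot> h \<longrightarrow> g = h)"
  unfolding monic_def Hom_DomD[OF assms] using assms Hom_objs(1) by (auto simp: Hom_def)

lemma epic_iff:
  assumes "f \<in> Hom C D B"
  shows "epic C f \<longleftrightarrow> (\<forall>A. \<forall>g\<in>Hom C B A. \<forall>h\<in>Hom C B A. g \<cdot> f = h \<cdot> f \<longrightarrow> g = h)"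
  unfolding epic_def Hom_CodD[OF assms] using assms Hom_objs(2) by (auto simp: Hom_def)

lemma monicD: 
  assumes "monic C f" "f \<in> Hom C B D" "g \<in> Hom C A B" "h \<in> Hom C A B" "f \<cdot> g = f \<cdot> h"
  shows "g = h"
  using assms(1)[unfolded monic_iff[OF assms(2)], rule_format, OF assms(3-5)] .

lemma epicD: 
  assumes "epic C f" "f \<in> Hom C D B" "g \<in> Hom C B A" "h \<in> Hom C B A" "g \<cdot> f = h \<cdot> f"
  shows "g = h"
  using assms(1)[unfolded epic_iff[OF assms(2)], rule_format, OF assms(3-5)] .

lemma isomorphismI:
  "\<lbrakk>f \<in> Hom C A B; g \<in> Hom C B A; g \<cdot> f = Ident C A; f \<cdot> g = Ident C B\<rbrakk> \<Longrightarrow> isomorphism C f"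
  by (auto simp: isomorphism_def Hom_iff)

lemma isomorphismE:
  assumes "isomorphism C f" "f \<in> Hom C A B"
  obtains g where "g \<in> Hom C B A" "g \<cdot> f = Ident C A" "f \<cdot> g = Ident C B"
  using assms by (auto simp: isomorphism_def Hom_iff)

end

text \<open>Inverses are made a function by choice, because a formal inverse in a path receives its
  value by recursion, where an existential statement cannot be used.\<close>

definition inverse_arrow :: "('o, 'm, 'z) cat_scheme \<Rightarrow> 'm \<Rightarrow> 'm" where
  "inverse_arrow C f = (SOME g. g \<in> Hom C (Cod C f) (Dom C f) \<and>
     g \<cdot>\<^bsub>C\<^esub> f = Ident C (Dom C f) \<and> f \<cdot>\<^bsub>C\<^esub> g = Ident C (Cod C f))"

lemma inverse_arrow:
  assumes "isomorphism C f" "f \<in> Hom C A B"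
  shows "inverse_arrow C f \<in> Hom C B A" "inverse_arrow C f \<cdot>\<^bsub>C\<^esub> f = Ident C A"
    "f \<cdot>\<^bsub>C\<^esub> inverse_arrow C f = Ident C B"
proof -
  have "\<exists>g. g \<in> Hom C (Cod C f) (Dom C f) \<and>
     g \<cdot>\<^bsub>C\<^esub> f = Ident C (Dom C f) \<and> f \<cdot>\<^bsub>C\<^esub> g = Ident C (Cod C f)"
    using assms by (auto simp: isomorphism_def)
  from someI_ex[OF this] show "inverse_arrow C f \<in> Hom C B A" 
    "inverse_arrow C f \<cdot>\<^bsub>C\<^esub> f = Ident C A" "f \<cdot>\<^bsub>C\<^esub> inverse_arrow C f = Ident C B"
    using assms(2) by (auto simp: inverse_arrow_def Hom_iff)
qed

section \<open>Functors, and equivalences as full, faithful and essentially surjective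
  functors\<close>

lemma is_functorD:
  assumes "is_functor C D Fo Fa"
  shows "category C" "category D"
    and "A \<in> Obj C \<Longrightarrow> Fo A \<in> Obj D"
    and "f \<in> Hom C A B \<Longrightarrow> Fa f \<in> Hom D (Fo A) (Fo B)"
    and "A \<in> Obj C \<Longrightarrow> Fa (Ident C A) = Ident D (Fo A)"
    and "\<lbrakk>f \<in> Hom C A B; g \<in> Hom C B E\<rbrakk> \<Longrightarrow> Fa (g \<cdot>\<^bsub>C\<^esub> f) = Fa g \<cdot>\<^bsub>D\<^esub> Fa f"
proof -
  show C: "category C" "category D" using assms by (auto simp: is_functor_def)
  show "A \<in> Obj C \<Longrightarrow> Fo A \<in> Obj D" "A \<in> Obj C \<Longrightarrow> Fa (Ident C A) = Ident D (Fo A)"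
    using assms by (auto simp: is_functor_def)
  show "f \<in> Hom C A B \<Longrightarrow> Fa f \<in> Hom D (Fo A) (Fo B)"
    using assms category.Hom_objs[OF C(1)] unfolding is_functor_def by blast
  show "\<lbrakk>f \<in> Hom C A B; g \<in> Hom C B E\<rbrakk> \<Longrightarrow> Fa (g \<cdot>\<^bsub>C\<^esub> f) = Fa g \<cdot>\<^bsub>D\<^esub> Fa f"
    using assms by (auto simp: is_functor_def Hom_iff)
qed

lemma is_functorI:
  assumes "category C" "category D"
    and "\<And>A. A \<in> Obj C \<Longrightarrow> Fo A \<in> Obj D"
    and "\<And>f A B. f \<in> Hom C A B \<Longrightarrow> Fa f \<in> Hom D (Fo A) (Fo B)"
    and "\<And>A. A \<in> Obj C \<Longrightarrow> Fa (Ident C A) = Ident D (Fo A)"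
    and "\<And>f g A B E. \<lbrakk>f \<in> Hom C A B; g \<in> Hom C B E\<rbrakk> \<Longrightarrow> Fa (g \<cdot>\<^bsub>C\<^esub> f) = Fa g \<cdot>\<^bsub>D\<^esub> Fa f"
  shows "is_functor C D Fo Fa"
  using assms by (auto simp: is_functor_def Hom_iff)

definition full_functor ::
  "('o, 'm, 'y) cat_scheme \<Rightarrow> ('p, 'n, 'z) cat_scheme \<Rightarrow> ('o \<Rightarrow> 'p) \<Rightarrow> ('m \<Rightarrow> 'n) \<Rightarrow> bool" where
  "full_functor C D Fo Fa \<longleftrightarrow>
     (\<forall>A\<in>Obj C. \<forall>B\<in>Obj C. \<forall>g \<in> Hom D (Fo A) (Fo B). \<exists>f \<in> Hom C A B. Fa f = g)"

definition faithful_functor :: "('o, 'm, 'y) cat_scheme \<Rightarrow> ('m \<Rightarrow> 'n) \<Rightarrow> bool" where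
  "faithful_functor C Fa \<longleftrightarrow> (\<forall>A B. inj_on Fa (Hom C A B))"

definition essentially_surjective ::
  "('o, 'm, 'y) cat_scheme \<Rightarrow> ('p, 'n, 'z) cat_scheme \<Rightarrow> ('o \<Rightarrow> 'p) \<Rightarrow> bool" where
  "essentially_surjective C D Fo \<longleftrightarrow>
     (\<forall>Y\<in>Obj D. \<exists>A\<in>Obj C. \<exists>e\<in>Hom D (Fo A) Y. isomorphism D e)"

text \<open>Essential surjectivity gives for each \<open>Y\<close> a chosen object
  \<open>Go Y\<close> with an isomorphism \<open>e Y\<close>, and fullness gives \<open>Ga g\<close>
  as a preimage of \<open>g\<close> conjugated by these. The choices need not be coherent: equations
  in \<open>C\<close> are checked after applying the faithful \<open>Fa\<close>, where they become
  computations with \<open>e\<close>. Then \<open>e\<close> is the natural isomorphism on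
  \<open>D\<close>, and preimages of its components form the one on \<open>C\<close>.\<close>

lemma equivalence_if_full_faithful_essentially_surjective:
  assumes F: "is_functor C D Fo Fa"
    and full: "full_functor C D Fo Fa"
    and faithful: "faithful_functor C Fa"
    and ess: "essentially_surjective C D Fo"
  shows "is_equivalence C D Fo Fa"
proof -
  interpret C: category C by (rule is_functorD(1)[OF F])
  interpret D: category D by (rule is_functorD(2)[OF F])
  note Fo = is_functorD(3)[OF F] and Fa = is_functorD(4)[OF F]
    and FI = is_functorD(5)[OF F] and FC = is_functorD(6)[OF F]
  have inj: "f = f'" if "f \<in> Hom C A B" "f' \<in> Hom C A B" "Fa f = Fa f'" for f f' A B
    using faithful that by (auto simp: faithful_functor_def inj_on_def)
  have "\<forall>Y. \<exists>A e. Y \<in> Obj D \<longrightarrow> A \<in> Obj C \<and> e \<in> Hom D (Fo A) Y \<and> isomorphism D e"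
    using ess unfolding essentially_surjective_def by blast
  then obtain Go e where Ge:
    "Y \<in> Obj D \<Longrightarrow> Go Y \<in> Obj C" "Y \<in> Obj D \<Longrightarrow> e Y \<in> Hom D (Fo (Go Y)) Y"
    "Y \<in> Obj D \<Longrightarrow> isomorphism D (e Y)" for Y by metis
  define e' where "e' Y = inverse_arrow D (e Y)" for Y
  have e': "e' Y \<in> Hom D Y (Fo (Go Y))" "e' Y \<cdot>\<^bsub>D\<^esub> e Y = Ident D (Fo (Go Y))"
    "e Y \<cdot>\<^bsub>D\<^esub> e' Y = Ident D Y" if "Y \<in> Obj D" for Y
    using inverse_arrow[OF Ge(3)[OF that] Ge(2)[OF that]] by (auto simp: e'_def)
  define Ga where "Ga g = (SOME f. f \<in> Hom C (Go (Dom D g)) (Go (Cod D g)) \<and>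
      Fa f = e' (Cod D g) \<cdot>\<^bsub>D\<^esub> (g \<cdot>\<^bsub>D\<^esub> e (Dom D g)))" for g
  have Ga: "Ga g \<in> Hom C (Go X) (Go Y)" "Fa (Ga g) = e' Y \<cdot>\<^bsub>D\<^esub> (g \<cdot>\<^bsub>D\<^esub> e X)"
    if g: "g \<in> Hom D X Y" for g X Y
  proof -
    note XY = D.Hom_objs[OF g]
    have "e' Y \<cdot>\<^bsub>D\<^esub> (g \<cdot>\<^bsub>D\<^esub> e X) \<in> Hom D (Fo (Go X)) (Fo (Go Y))"
      using D.Comp_closed[OF D.Comp_closed[OF Ge(2)[OF XY(1)] g] e'(1)[OF XY(2)]] .
    then have "\<exists>f. f \<in> Hom C (Go X) (Go Y) \<and> Fa f = e' Y \<cdot>\<^bsub>D\<^esub> (g \<cdot>\<^bsub>D\<^esub> e X)"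
      using full Ge(1)[OF XY(1)] Ge(1)[OF XY(2)] unfolding full_functor_def by blast
    moreover have "Dom D g = X" "Cod D g = Y" using g by (auto simp: Hom_iff)
    ultimately show "Ga g \<in> Hom C (Go X) (Go Y)" "Fa (Ga g) = e' Y \<cdot>\<^bsub>D\<^esub> (g \<cdot>\<^bsub>D\<^esub> e X)"
      unfolding Ga_def by (metis (mono_tags, lifting) someI_ex)+
  qed
  have eGa: "e Y \<cdot>\<^bsub>D\<^esub> Fa (Ga g) = g \<cdot>\<^bsub>D\<^esub> e X" if g: "g \<in> Hom D X Y" for g X Y
  proof -
    note XY = D.Hom_objs[OF g]
    note ge = D.Comp_closed[OF Ge(2)[OF XY(1)] g]
    show ?thesis
      using D.Comp_assoc[OF ge e'(1)[OF XY(2)] Ge(2)[OF XY(2)]] Ga(2)[OF g] e'(3)[OF XY(2)]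
        D.Comp_Ident_left[OF ge] by simp
  qed
  \<comment> \<open>Cancelling \<open>e Y\<close> on the left reduces functoriality of
    \<open>Ga\<close> to the naturality equation \<open>eGa\<close>, without expanding the chosen
    inverses.\<close>
  have e_mono: "h = h'" if "h \<in> Hom D Z (Fo (Go Y))" "h' \<in> Hom D Z (Fo (Go Y))"
    "e Y \<cdot>\<^bsub>D\<^esub> h = e Y \<cdot>\<^bsub>D\<^esub> h'" "Y \<in> Obj D" for h h' Y Z
    using D.Comp_assoc[OF that(1) Ge(2)[OF that(4)] e'(1)[OF that(4)]] 
      D.Comp_assoc[OF that(2) Ge(2)[OF that(4)] e'(1)[OF that(4)]] that e'(2)[OF that(4)] 
      D.Comp_Ident_left by metis
  have G: "is_functor D C Go Ga"
  proof (rule is_functorI)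
    fix Y assume Y: "Y \<in> Obj D"
    note I = D.Ident_closed[OF Y]
    show "Ga (Ident D Y) = Ident C (Go Y)"
    proof (rule inj[OF Ga(1)[OF I] C.Ident_closed[OF Ge(1)[OF Y]]])
      show "Fa (Ga (Ident D Y)) = Fa (Ident C (Go Y))"
        using Ga(2)[OF I] e'(2)[OF Y] D.Comp_Ident_left[OF Ge(2)[OF Y]] FI[OF Ge(1)[OF Y]] by simp
    qed
  next
    fix g h X Y Z assume g: "g \<in> Hom D X Y" and h: "h \<in> Hom D Y Z"
    note hg = D.Comp_closed[OF g h]
    note o = D.Hom_objs[OF g] D.Hom_objs[OF h]
    show "Ga (h \<cdot>\<^bsub>D\<^esub> g) = Ga h \<cdot>\<^bsub>C\<^esub> Ga g"
    proof (rule inj[OF Ga(1)[OF hg] C.Comp_closed[OF Ga(1)[OF g] Ga(1)[OF h]]])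
      note FGg = Fa[OF Ga(1)[OF g]] and FGh = Fa[OF Ga(1)[OF h]]
      have "e Z \<cdot>\<^bsub>D\<^esub> Fa (Ga (h \<cdot>\<^bsub>D\<^esub> g)) = h \<cdot>\<^bsub>D\<^esub> (g \<cdot>\<^bsub>D\<^esub> e X)"
        using eGa[OF hg] D.Comp_assoc[OF Ge(2)[OF o(1)] g h] by simp
      also have "\<dots> = (h \<cdot>\<^bsub>D\<^esub> e Y) \<cdot>\<^bsub>D\<^esub> Fa (Ga g)"
        using eGa[OF g] D.Comp_assoc[OF FGg Ge(2)[OF o(2)] h] by simp
      also have "\<dots> = e Z \<cdot>\<^bsub>D\<^esub> (Fa (Ga h) \<cdot>\<^bsub>D\<^esub> Fa (Ga g))"
        using eGa[OF h] D.Comp_assoc[OF FGg FGh Ge(2)[OF o(4)]] by simp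
      finally have *: "e Z \<cdot>\<^bsub>D\<^esub> Fa (Ga (h \<cdot>\<^bsub>D\<^esub> g)) = e Z \<cdot>\<^bsub>D\<^esub> Fa (Ga h \<cdot>\<^bsub>C\<^esub> Ga g)"
        using FC[OF Ga(1)[OF g] Ga(1)[OF h]] by simp
      show "Fa (Ga (h \<cdot>\<^bsub>D\<^esub> g)) = Fa (Ga h \<cdot>\<^bsub>C\<^esub> Ga g)"
        using e_mono[OF Fa[OF Ga(1)[OF hg]] Fa[OF C.Comp_closed[OF Ga(1)[OF g] Ga(1)[OF h]]] * o(4)] .
    qed
  qed (use Ga Ge C.category_axioms D.category_axioms in auto)
  have "naturally_isomorphic D D (Fo \<circ> Go) (Fa \<circ> Ga) id id"
    unfolding naturally_isomorphic_def
  proof (rule exI[of _ e], intro conjI ballI)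
    fix g assume "g \<in> Arr D"
    then have "g \<in> Hom D (Dom D g) (Cod D g)" by (simp add: Hom_iff)
    then show "e (Cod D g) \<cdot>\<^bsub>D\<^esub> (Fa \<circ> Ga) g = id g \<cdot>\<^bsub>D\<^esub> e (Dom D g)"
      using eGa by simp
  qed (use Ge in auto)
  moreover have "naturally_isomorphic C C (Go \<circ> Fo) (Ga \<circ> Fa) id id"
  proof -
    have "\<exists>f. f \<in> Hom C (Go (Fo A)) A \<and> Fa f = e (Fo A)" if "A \<in> Obj C" for A
      using full that Ge(1,2)[OF Fo[OF that]] unfolding full_functor_def by blast
    then obtain \<eta> where \<eta>: "A \<in> Obj C \<Longrightarrow> \<eta> A \<in> Hom C (Go (Fo A)) A" 
      "A \<in> Obj C \<Longrightarrow> Fa (\<eta> A) = e (Fo A)" for A by metis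
    have iso: "isomorphism C (\<eta> A)" if A: "A \<in> Obj C" for A
    proof -
      note FA = Fo[OF A]
      note GFA = Ge(1)[OF FA]
      obtain \<theta> where \<theta>: "\<theta> \<in> Hom C A (Go (Fo A))" "Fa \<theta> = e' (Fo A)"
        using full A GFA e'(1)[OF FA] unfolding full_functor_def by blast
      have 1: "\<theta> \<cdot>\<^bsub>C\<^esub> \<eta> A = Ident C (Go (Fo A))"
        using inj[OF C.Comp_closed[OF \<eta>(1)[OF A] \<theta>(1)] C.Ident_closed[OF GFA]]
          FC[OF \<eta>(1)[OF A] \<theta>(1)] FI[OF GFA] \<eta>(2)[OF A] \<theta>(2) e'(2)[OF FA] by simp
      have 2: "\<eta> A \<cdot>\<^bsub>C\<^esub> \<theta> = Ident C A"
        using inj[OF C.Comp_closed[OF \<theta>(1) \<eta>(1)[OF A]] C.Ident_closed[OF A]]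
          FC[OF \<theta>(1) \<eta>(1)[OF A]] FI[OF A] \<eta>(2)[OF A] \<theta>(2) e'(3)[OF FA] by simp
      show ?thesis using C.isomorphismI[OF \<eta>(1)[OF A] \<theta>(1) 1 2] .
    qed
    show ?thesis
      unfolding naturally_isomorphic_def
    proof (rule exI[of _ \<eta>], intro conjI ballI)
      fix f assume "f \<in> Arr C"
      then have f: "f \<in> Hom C (Dom C f) (Cod C f)" by (simp add: Hom_iff)
      note o = C.Hom_objs[OF f]
      note GF = Ga(1)[OF Fa[OF f]]
      have "\<eta> (Cod C f) \<cdot>\<^bsub>C\<^esub> Ga (Fa f) = f \<cdot>\<^bsub>C\<^esub> \<eta> (Dom C f)"
      proof (rule inj[OF C.Comp_closed[OF GF \<eta>(1)[OF o(2)]] C.Comp_closed[OF \<eta>(1)[OF o(1)] f]])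
        show "Fa (\<eta> (Cod C f) \<cdot>\<^bsub>C\<^esub> Ga (Fa f)) = Fa (f \<cdot>\<^bsub>C\<^esub> \<eta> (Dom C f))"
          using FC[OF GF \<eta>(1)[OF o(2)]] FC[OF \<eta>(1)[OF o(1)] f] \<eta>(2)[OF o(1)] \<eta>(2)[OF o(2)]
            eGa[OF Fa[OF f]] by simp
      qed
      then show "\<eta> (Cod C f) \<cdot>\<^bsub>C\<^esub> (Ga \<circ> Fa) f = id f \<cdot>\<^bsub>C\<^esub> \<eta> (Dom C f)" by simp
    qed (use \<eta> iso in auto)
  qed
  ultimately show ?thesis using F G unfolding is_equivalence_def by blast
qed

text \<open>Naturality recovers \<open>f\<close> from \<open>Ha f\<close> by conjugation with the
  isomorphism to the identity. It serves for both composites of an equivalence.\<close>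

lemma naturally_isomorphic_id_faithful:
  assumes N: "naturally_isomorphic C C Ho Ha id id" and C: "category C"
  shows "faithful_functor C Ha"
  unfolding faithful_functor_def inj_on_def
proof (intro allI ballI impI)
  interpret category C by (rule C)
  fix A B f g assume fg: "f \<in> Hom C A B" "g \<in> Hom C A B" "Ha f = Ha g"
  obtain \<eta> where \<eta>: "\<And>A. A \<in> Obj C \<Longrightarrow> \<eta> A \<in> Hom C (Ho A) A \<and> isomorphism C (\<eta> A)"
    "\<And>f. f \<in> Arr C \<Longrightarrow> \<eta> (Cod C f) \<cdot>\<^bsub>C\<^esub> Ha f = f \<cdot>\<^bsub>C\<^esub> \<eta> (Dom C f)"
    using N unfolding naturally_isomorphic_def by auto
  have A: "A \<in> Obj C" using Hom_objs fg by blast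
  have eq: "f \<cdot>\<^bsub>C\<^esub> \<eta> A = g \<cdot>\<^bsub>C\<^esub> \<eta> A" using \<eta>(2)[of f] \<eta>(2)[of g] fg by (auto simp: Hom_iff)
  obtain i where i: "i \<in> Hom C A (Ho A)" "\<eta> A \<cdot>\<^bsub>C\<^esub> i = Ident C A"
    using isomorphismE \<eta>(1)[OF A] by blast
  have "f = (f \<cdot>\<^bsub>C\<^esub> \<eta> A) \<cdot>\<^bsub>C\<^esub> i" "g = (g \<cdot>\<^bsub>C\<^esub> \<eta> A) \<cdot>\<^bsub>C\<^esub> i"
    using Comp_assoc[OF i(1) conjunct1[OF \<eta>(1)[OF A]]] i(2) Comp_Ident_right fg by metis+
  then show "f = g" using eq by simp
qed

text \<open>A functor is faithful as soon as a composite with another functor after it is.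
  Faithfulness, essential surjectivity and fullness are wanted for the shift, which is only an
  auto-equivalence: they allow equations, objects and maps to be desuspended.\<close>

lemma equivalence_faithful:
  assumes "is_equivalence C D Fo Fa"
  shows "faithful_functor C Fa"
proof -
  obtain Go Ga where G: "is_functor D C Go Ga" 
    "naturally_isomorphic C C (Go \<circ> Fo) (Ga \<circ> Fa) id id"
    using assms unfolding is_equivalence_def by blast
  show ?thesis using naturally_isomorphic_id_faithful[OF G(2)] is_functorD(2)[OF G(1)]
    unfolding faithful_functor_def inj_on_def by (metis comp_apply)
qed

lemma equivalence_essentially_surjective:
  assumes "is_equivalence C D Fo Fa"
  shows "essentially_surjective C D Fo"
  using assms is_functorD(3)
  unfolding is_equivalence_def essentially_surjective_def naturally_isomorphic_def 
  by (metis comp_apply id_apply)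

text \<open>A preimage of \<open>g\<close> is \<open>Ga g\<close> conjugated by the unit; that it maps to \<open>g\<close> is seen after 
  applying the faithful functor \<open>Ga\<close>.\<close>

lemma equivalence_full:
  assumes E: "is_equivalence C D Fo Fa"
  shows "full_functor C D Fo Fa"
  unfolding full_functor_def
proof (intro ballI)
  obtain Go Ga where F: "is_functor C D Fo Fa" and G: "is_functor D C Go Ga" 
    and n: "naturally_isomorphic C C (Go \<circ> Fo) (Ga \<circ> Fa) id id"
    "naturally_isomorphic D D (Fo \<circ> Go) (Fa \<circ> Ga) id id"
    using E unfolding is_equivalence_def by blast
  interpret C: category C by (rule is_functorD(1)[OF F])
  interpret D: category D by (rule is_functorD(2)[OF F])
  have faithG: "faithful_functor D Ga"
    using naturally_isomorphic_id_faithful[OF n(2)] is_functorD(2)[OF F]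
    unfolding faithful_functor_def inj_on_def by (metis comp_apply)
  fix A B g assume A: "A \<in> Obj C" and B: "B \<in> Obj C" and g: "g \<in> Hom D (Fo A) (Fo B)"
  obtain \<eta> where \<eta>: "\<And>A. A \<in> Obj C \<Longrightarrow> \<eta> A \<in> Hom C (Go (Fo A)) A \<and> isomorphism C (\<eta> A)"
    "\<And>f. f \<in> Arr C \<Longrightarrow> \<eta> (Cod C f) \<cdot>\<^bsub>C\<^esub> Ga (Fa f) = f \<cdot>\<^bsub>C\<^esub> \<eta> (Dom C f)"
    using n(1) unfolding naturally_isomorphic_def by auto
  obtain i where i: "i \<in> Hom C A (Go (Fo A))" "i \<cdot>\<^bsub>C\<^esub> \<eta> A = Ident C (Go (Fo A))"
    using C.isomorphismE \<eta>(1)[OF A] by blast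
  obtain j where j: "j \<in> Hom C B (Go (Fo B))" "j \<cdot>\<^bsub>C\<^esub> \<eta> B = Ident C (Go (Fo B))"
    using C.isomorphismE \<eta>(1)[OF B] by blast
  note eA = conjunct1[OF \<eta>(1)[OF A]] and eB = conjunct1[OF \<eta>(1)[OF B]]
  note Gg = is_functorD(4)[OF G g]
  note eBG = C.Comp_closed[OF Gg eB]
  define f where "f = (\<eta> B \<cdot>\<^bsub>C\<^esub> Ga g) \<cdot>\<^bsub>C\<^esub> i"
  have f: "f \<in> Hom C A B" unfolding f_def by (rule C.Comp_closed[OF i(1) eBG])
  note GFf = is_functorD(4)[OF G is_functorD(4)[OF F f]]
  have "\<eta> B \<cdot>\<^bsub>C\<^esub> Ga (Fa f) = f \<cdot>\<^bsub>C\<^esub> \<eta> A" using \<eta>(2)[of f] f by (auto simp: Hom_iff)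
  also have "\<dots> = \<eta> B \<cdot>\<^bsub>C\<^esub> Ga g"
    unfolding f_def using C.Comp_assoc[OF eA i(1) eBG] i(2) C.Comp_Ident_right[OF eBG] by simp
  finally have "(j \<cdot>\<^bsub>C\<^esub> \<eta> B) \<cdot>\<^bsub>C\<^esub> Ga (Fa f) = (j \<cdot>\<^bsub>C\<^esub> \<eta> B) \<cdot>\<^bsub>C\<^esub> Ga g"
    using C.Comp_assoc[OF GFf eB j(1)] C.Comp_assoc[OF Gg eB j(1)] by simp
  then have "Ga (Fa f) = Ga g" using j(2) C.Comp_Ident_left[OF Gg] C.Comp_Ident_left[OF GFf] by simp
  then have "Fa f = g" using faithG g is_functorD(4)[OF F f] unfolding faithful_functor_def inj_on_def by blast
  then show "\<exists>f\<in>Hom C A B. Fa f = g" using f by blast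
qed

section \<open>The Gabriel-Zisman localization as a category of classes of paths\<close>

locale localized_category = category C for C :: "('o, 'm, 'z) cat_scheme" (structure) +
  fixes R :: "'m set"
  assumes R_Arr: "R \<subseteq> Arr C"
begin

lemma is_path_objs: "is_path C R A xs B \<Longrightarrow> A \<in> Obj C \<and> B \<in> Obj C"
proof (induction xs arbitrary: A)
  case (Cons x xs)
  have "letter_src C x \<in> Obj C" using Cons(2) R_Arr Dom_closed Cod_closed by auto
  moreover have "B \<in> Obj C" using Cons by auto
  ultimately show ?case using Cons(2) by simp
qed simp

lemma is_path_append:
  "is_path C R A xs B \<Longrightarrow> is_path C R A (xs @ ys) D \<longleftrightarrow> is_path C R B ys D"
  by (induction xs arbitrary: A) auto

lemma is_path_appendE:
  assumes "is_path C R A (xs @ ys) D"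
  obtains B where "is_path C R A xs B" "is_path C R B ys D"
  using assms
proof (induction xs arbitrary: A thesis)
  case Nil
  then show ?case using is_path_objs by fastforce
qed auto

lemma is_path_Fwd: "f \<in> Hom C A B \<Longrightarrow> is_path C R A [Fwd f] B"
  using Hom_objs(2)[of f A B] by (auto simp: Hom_iff)

lemma is_path_Bwd: "\<lbrakk>s \<in> R; s \<in> Hom C A B\<rbrakk> \<Longrightarrow> is_path C R B [Bwd s] A"
  using Hom_objs(1)[of s A B] by (auto simp: Hom_iff)

lemma path_equiv_is_path:
  "path_equiv C R A B xs ys \<Longrightarrow> is_path C R A xs B \<and> is_path C R A ys B"
  by (induction rule: path_equiv.induct) auto

lemma path_equiv_append_right:
  assumes "path_equiv C R A B xs ys" "is_path C R B zs D"
  shows "path_equiv C R A D (xs @ zs) (ys @ zs)"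
  using assms
proof (induction rule: path_equiv.induct)
  case (path_step l r xs ys)
  have "path_equiv C R A D (xs @ l @ (ys @ zs)) (xs @ r @ (ys @ zs))"
    using path_step is_path_append[of A "xs @ l @ ys" B zs D] is_path_append[of A "xs @ r @ ys" B zs D]
    by (intro path_equiv.path_step) auto
  then show ?case by simp
next
  case (path_refl xs)
  then show ?case by (intro path_equiv.path_refl) (auto simp: is_path_append)
qed (auto intro: path_sym path_trans)

lemma path_equiv_append_left:
  assumes "path_equiv C R B D xs ys" "is_path C R A zs B"
  shows "path_equiv C R A D (zs @ xs) (zs @ ys)"
  using assms
proof (induction rule: path_equiv.induct)
  case (path_step l r xs ys)
  have "path_equiv C R A D ((zs @ xs) @ l @ ys) ((zs @ xs) @ r @ ys)"
    using path_step is_path_append[of A zs B _ D]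
    by (intro path_equiv.path_step) auto
  then show ?case by simp
next
  case (path_refl xs)
  then show ?case by (intro path_equiv.path_refl) (auto simp: is_path_append)
qed (auto intro: path_sym path_trans)

text \<open>Equivalence of paths is a congruence for concatenation; this makes the union over all
  representatives in the composition of \<open>localization\<close> a single class.\<close>

lemma path_equiv_append:
  assumes "path_equiv C R A B xs xs'" "path_equiv C R B D ys ys'"
  shows "path_equiv C R A D (xs @ ys) (xs' @ ys')"
proof (rule path_trans)
  show "path_equiv C R A D (xs @ ys) (xs' @ ys)"
    using path_equiv_append_right[OF assms(1)] path_equiv_is_path[OF assms(2)] by blast
  show "path_equiv C R A D (xs' @ ys) (xs' @ ys')"
    using path_equiv_append_left[OF assms(2)] path_equiv_is_path[OF assms(1)] by blast
qed

lemma path_equiv_relation: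
  assumes "path_relation C R l r" "is_path C R A l B" "is_path C R A r B"
  shows "path_equiv C R A B l r"
  using path_step[of C R l r A "[]" "[]" B] assms by simp

lemma path_equiv_Fwd_Fwd:
  assumes "f \<in> Hom C A B" "g \<in> Hom C B D"
  shows "path_equiv C R A D [Fwd f, Fwd g] [Fwd (g \<cdot> f)]"
proof (rule path_equiv_relation)
  show "path_relation C R [Fwd f, Fwd g] [Fwd (g \<cdot> f)]"
    using assms by (intro rel_Comp) (auto simp: Hom_iff)
  show "is_path C R A [Fwd f, Fwd g] D"
    using is_path_append[OF is_path_Fwd[OF assms(1)], of "[Fwd g]" D] is_path_Fwd[OF assms(2)]
    by (simp del: is_path.simps)
  show "is_path C R A [Fwd (g \<cdot> f)] D" using is_path_Fwd[OF Comp_closed[OF assms]] .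
qed

lemma path_equiv_Fwd_Bwd:
  assumes "s \<in> R" "s \<in> Hom C A B"
  shows "path_equiv C R A A [Fwd s, Bwd s] []"
  using is_path_append[OF is_path_Fwd[OF assms(2)], of "[Bwd s]" A] is_path_Bwd[OF assms]
    Hom_objs[OF assms(2)] assms
  by (intro path_equiv_relation rel_Fwd_Bwd) auto

lemma path_equiv_Bwd_Fwd:
  assumes "s \<in> R" "s \<in> Hom C A B"
  shows "path_equiv C R B B [Bwd s, Fwd s] []"
  using is_path_append[OF is_path_Bwd[OF assms], of "[Fwd s]" B] is_path_Fwd[OF assms(2)]
    Hom_objs[OF assms(2)] assms
  by (intro path_equiv_relation rel_Bwd_Fwd) auto

text \<open>The end points are stored with the class because the empty path does not tell at which
  object it sits.\<close>

definition path_class :: "'o \<Rightarrow> 'o \<Rightarrow> 'm letter list \<Rightarrow> 'o \<times> 'o \<times> 'm letter list set" where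
  "path_class A B xs = (A, B, {ys. path_equiv C R A B xs ys})"

lemma path_class_eq_iff:
  "is_path C R A xs B \<Longrightarrow> path_class A B xs = path_class A B ys \<longleftrightarrow> path_equiv C R A B xs ys"
  unfolding path_class_def by (auto intro: path_refl path_sym path_trans)

abbreviation L :: "('o, 'o \<times> 'o \<times> 'm letter list set) cat" where
  "L \<equiv> localization C R"

lemma Hom_localization:
  "p \<in> Hom (L) A B \<longleftrightarrow> (\<exists>xs. is_path C R A xs B \<and> p = path_class A B xs)"
  by (auto simp: Hom_def localization_def path_class_def)

lemma Comp_path_class:
  assumes "is_path C R A xs B" "is_path C R B ys D"
  shows "path_class B D ys \<cdot>\<^bsub>L\<^esub> path_class A B xs = path_class A D (xs @ ys)"
proof -
  have "(\<Union>xs' \<in> {zs. path_equiv C R A B xs zs}. \<Union>ys' \<in> {zs. path_equiv C R B D ys zs}.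
      {zs. path_equiv C R A D (xs' @ ys') zs}) = {zs. path_equiv C R A D (xs @ ys) zs}"
    (is "?L = ?R")
  proof
    show "?L \<subseteq> ?R" using path_equiv_append by (blast intro: path_trans)
    show "?R \<subseteq> ?L" using path_refl[OF assms(1)] path_refl[OF assms(2)] by blast
  qed
  then show ?thesis by (simp add: localization_def path_class_def)
qed

lemma Ident_localization: "Ident (L) A = path_class A A []"
  by (simp add: localization_def path_class_def)

lemma Obj_localization: "Obj (L) = Obj C"
  by (simp add: localization_def)

lemma category_localization: "category (L)"
proof
  fix p assume "p \<in> Arr (L)"
  then have "p \<in> Hom (L) (Dom (L) p) (Cod (L) p)"
    by (simp add: Hom_iff)
  then show "Dom (L) p \<in> Obj (L)" 
    "Cod (L) p \<in> Obj (L)"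
    unfolding Hom_localization Obj_localization using is_path_objs by blast+
next
  fix A assume "A \<in> Obj (L)"
  then have "is_path C R A [] A" by (simp add: Obj_localization)
  then show "Ident (L) A \<in> Hom (L) A A"
    unfolding Hom_localization Ident_localization by blast
next
  fix p q A B D assume "p \<in> Hom (L) A B" "q \<in> Hom (L) B D"
  then show "q \<cdot>\<^bsub>L\<^esub> p \<in> Hom (L) A D"
    unfolding Hom_localization by (metis Comp_path_class is_path_append)
next
  fix p A B assume "p \<in> Hom (L) A B"
  then show "p \<cdot>\<^bsub>L\<^esub> Ident (L) A = p"
    "Ident (L) B \<cdot>\<^bsub>L\<^esub> p = p"
    unfolding Hom_localization Ident_localization using is_path_objs
    using Comp_path_class[of A "[]" A] Comp_path_class[of A _ B "[]" B] by auto
next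
  fix p q r A B D E assume "p \<in> Hom (L) A B" "q \<in> Hom (L) B D"
    "r \<in> Hom (L) D E"
  then obtain xs ys zs where *: "is_path C R A xs B" "p = path_class A B xs"
    "is_path C R B ys D" "q = path_class B D ys" "is_path C R D zs E" "r = path_class D E zs"
    unfolding Hom_localization by blast
  moreover have "is_path C R A (xs @ ys) D" "is_path C R B (ys @ zs) E"
    using * is_path_append by blast+
  ultimately show "r \<cdot>\<^bsub>L\<^esub> (q \<cdot>\<^bsub>L\<^esub> p) = 
     (r \<cdot>\<^bsub>L\<^esub> q) \<cdot>\<^bsub>L\<^esub> p"
    by (simp add: Comp_path_class)
qed

end

section \<open>Functors that invert \<open>R\<close>, and their extension to the
  localization\<close>

primrec letter_value :: "('p, 'n, 'z) cat_scheme \<Rightarrow> ('m \<Rightarrow> 'n) \<Rightarrow> 'm letter \<Rightarrow> 'n" where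
  "letter_value D Fa (Fwd f) = Fa f"
| "letter_value D Fa (Bwd s) = inverse_arrow D (Fa s)"

locale inverting_functor = localized_category C R
  for C :: "('o, 'm, 'y) cat_scheme" and R :: "'m set" +
  fixes D :: "('p, 'n, 'z) cat_scheme" and Fo :: "'o \<Rightarrow> 'p" and Fa :: "'m \<Rightarrow> 'n"
  assumes F: "is_functor C D Fo Fa"
    and inverts: "s \<in> R \<Longrightarrow> isomorphism D (Fa s)"
begin

interpretation D: category D by (rule is_functorD(2)[OF F])

lemmas Fo = is_functorD(3)[OF F] and Fa = is_functorD(4)[OF F]
    and FI = is_functorD(5)[OF F] and FC = is_functorD(6)[OF F]

text \<open>Paths are read in diagrammatic order but arrows compose in applicative order, so the
  head of the list is the innermost factor. The starting object is an argument because the empty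
  path has to evaluate to an identity.\<close>

primrec path_value :: "'o \<Rightarrow> 'm letter list \<Rightarrow> 'n" where
  "path_value A [] = Ident D (Fo A)"
| "path_value A (x # xs) = path_value (letter_tgt C x) xs \<cdot>\<^bsub>D\<^esub> letter_value D Fa x"

lemma letter_value_Hom:
  assumes "x \<in> Fwd ` Arr C \<union> Bwd ` R"
  shows "letter_value D Fa x \<in> Hom D (Fo (letter_src C x)) (Fo (letter_tgt C x))"
proof (cases x)
  case (Fwd f)
  then show ?thesis using assms Fa[of f "Dom C f" "Cod C f"] by (auto simp: Hom_iff)
next
  case (Bwd s)
  then have "s \<in> R" using assms by auto
  then show ?thesis using inverse_arrow(1)[OF inverts, of s] R_Arr Fa[of s "Dom C s" "Cod C s"] Bwd
    by (auto simp: Hom_iff subset_iff)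
qed

lemma path_value_Hom: "is_path C R A xs B \<Longrightarrow> path_value A xs \<in> Hom D (Fo A) (Fo B)"
proof (induction xs arbitrary: A)
  case Nil
  then show ?case using D.Ident_closed Fo by auto
next
  case (Cons x xs)
  then have x: "x \<in> Fwd ` Arr C \<union> Bwd ` R" "letter_src C x = A" 
    and xs: "is_path C R (letter_tgt C x) xs B" by auto
  show ?case using D.Comp_closed[OF letter_value_Hom[OF x(1)] Cons(1)[OF xs]] x(2) by simp
qed

lemma path_value_append:
  "is_path C R A xs B \<Longrightarrow> is_path C R B ys E
    \<Longrightarrow> path_value A (xs @ ys) = path_value B ys \<cdot>\<^bsub>D\<^esub> path_value A xs"
proof (induction xs arbitrary: A)
  case Nil
  then show ?case using D.Comp_Ident_right[OF path_value_Hom[OF Nil(2)]] by simp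
next
  case (Cons x xs)
  note 1 = letter_value_Hom[of x] 
  have x: "x \<in> Fwd ` Arr C \<union> Bwd ` R" and xs: "is_path C R (letter_tgt C x) xs B"
    using Cons(2) by auto
  show ?case using Cons(1)[OF xs Cons(3)] 
      D.Comp_assoc[OF 1[OF x] path_value_Hom[OF xs] path_value_Hom[OF Cons(3)]] by simp
qed

lemma path_value_Fwd: "f \<in> Hom C A B \<Longrightarrow> path_value A [Fwd f] = Fa f"
  using D.Comp_Ident_left[OF Fa, of f A B] by (auto simp: Hom_iff)

text \<open>Of the four generating relations, two hold in \<open>D\<close> by functoriality and two
  because \<open>Bwd s\<close> is evaluated to the inverse of \<open>Fa s\<close>.\<close>

lemma path_value_relation:
  assumes "path_relation C R l r" "is_path C R A l B" "is_path C R A r B"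
  shows "path_value A l = path_value A r"
  using assms
proof cases
  case (rel_Comp f g)
  then have f: "f \<in> Hom C A (Cod C f)" and g: "g \<in> Hom C (Cod C f) B"
    using assms by (auto simp: Hom_iff)
  have "path_value A l = path_value (Cod C f) [Fwd g] \<cdot>\<^bsub>D\<^esub> Fa f" using rel_Comp by simp
  then show ?thesis using path_value_Fwd[OF g] path_value_Fwd[OF Comp_closed[OF f g]] 
      FC[OF f g] rel_Comp by (simp del: path_value.simps)
next
  case (rel_Ident A')
  then have "A' = A" "A \<in> Obj C" using assms Ident_closed[of A'] by (auto simp: Hom_iff)
  then show ?thesis using path_value_Fwd[OF Ident_closed[of A]] FI rel_Ident by simp
next
  case (rel_Fwd_Bwd s)
  then have s: "s \<in> Hom C A (Cod C s)" using assms R_Arr by (auto simp: Hom_iff)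
  note i = inverse_arrow[OF inverts[OF rel_Fwd_Bwd(3)] Fa[OF s]]
  show ?thesis using i(2) D.Comp_Ident_left[OF i(1)] s rel_Fwd_Bwd by (simp add: Hom_iff)
next
  case (rel_Bwd_Fwd s)
  then have s: "s \<in> Hom C (Dom C s) A" using assms R_Arr by (auto simp: Hom_iff)
  note i = inverse_arrow[OF inverts[OF rel_Bwd_Fwd(3)] Fa[OF s]]
  show ?thesis using i(3) D.Comp_Ident_left[OF Fa[OF s]] s rel_Bwd_Fwd by (simp add: Hom_iff)
qed

lemma path_value_equiv:
  "path_equiv C R A B xs ys \<Longrightarrow> path_value A xs = path_value A ys"
proof (induction rule: path_equiv.induct)
  case (path_step l r xs ys)
  obtain E where E: "is_path C R A xs E" "is_path C R E (l @ ys) B"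
    using is_path_appendE[OF path_step(2)] .
  obtain G where G: "is_path C R E l G" "is_path C R G ys B" using is_path_appendE[OF E(2)] .
  have r: "is_path C R E (r @ ys) B" using path_step(3) is_path_append[OF E(1)] by blast
  obtain G' where G': "is_path C R E r G'" "is_path C R G' ys B" using is_path_appendE[OF r] .
  \<comment> \<open>Cut out of their surroundings, the two sides of a relation are only known to end
    somewhere. The common tail \<open>ys\<close> can be evaluated consistently once these end points
    are identified.\<close>
  have "G' = G"
    using path_step(1)
  proof cases
    case (rel_Comp f g)
    then have "g \<cdot>\<^bsub>C\<^esub> f \<in> Hom C (Dom C f) (Cod C g)"
      by (intro Comp_closed[of f "Dom C f" "Cod C f" g]) (auto simp: Hom_iff)
    then show ?thesis using rel_Comp G(1) G'(1) by (auto simp: Hom_iff)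
  next
    case (rel_Ident A')
    then show ?thesis using G(1) G'(1) Ident_closed[of A'] by (auto simp: Hom_iff)
  qed (use G(1) G'(1) in auto)
  then show ?case using path_value_append[OF E(1) E(2)] path_value_append[OF E(1) r]
      path_value_append[OF G] path_value_append[OF G'] path_value_relation[OF path_step(1) G(1)] G'(1)
    by simp
qed auto

text \<open>The representative is arbitrary; by \<open>path_value_equiv\<close> the value does not
  depend on it.\<close>

definition localized :: "'o \<times> 'o \<times> 'm letter list set \<Rightarrow> 'n" where
  "localized = (\<lambda>(A, B, p). path_value A (SOME xs. xs \<in> p))"

lemma localized_path_class:
  assumes "is_path C R A xs B"
  shows "localized (path_class A B xs) = path_value A xs"
proof -
  have "path_equiv C R A B xs (SOME ys. path_equiv C R A B xs ys)"
    using path_refl[OF assms] by (rule someI)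
  then show ?thesis unfolding localized_def path_class_def by (simp add: path_value_equiv)
qed

lemma localized_functor: "is_functor L D Fo localized"
proof (rule is_functorI)
  fix p A B assume "p \<in> Hom L A B"
  then show "localized p \<in> Hom D (Fo A) (Fo B)"
    unfolding Hom_localization by (auto simp: localized_path_class path_value_Hom)
next
  fix A assume "A \<in> Obj L"
  then show "localized (Ident L A) = Ident D (Fo A)"
    by (simp add: Ident_localization Obj_localization localized_path_class)
next
  fix p q A B E assume "p \<in> Hom L A B" "q \<in> Hom L B E"
  then obtain xs ys where *: "is_path C R A xs B" "p = path_class A B xs"
    "is_path C R B ys E" "q = path_class B E ys" unfolding Hom_localization by blast
  then show "localized (q \<cdot>\<^bsub>L\<^esub> p) = localized q \<cdot>\<^bsub>D\<^esub> localized p"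
    using path_value_append is_path_append[OF *(1)] by (simp add: Comp_path_class localized_path_class)
qed (use category_localization D.category_axioms Fo Obj_localization in auto)

text \<open>
  Every path out of \<open>A\<close> is equivalent to one of the form \<open>f q\<^sup>-\<^sup>1\<close> with a fixed \<open>q\<close> ending in \<open>A\<close>: 
  an inverse letter \<open>Bwd s\<close> is absorbed by lifting \<open>f\<close> along \<open>s\<close>.
\<close>

theorem localization_equivalence:
  assumes faithful: "faithful_functor C Fa"
    and resolution: "\<And>A. A \<in> Obj C \<Longrightarrow> \<exists>P q. q \<in> R \<and> q \<in> Hom C P A \<and>
      (\<forall>B. \<forall>g \<in> Hom D (Fo P) (Fo B). B \<in> Obj C \<longrightarrow> (\<exists>f \<in> Hom C P B. Fa f = g))"
    and ess: "essentially_surjective C D Fo"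
  shows "is_equivalence L D Fo localized"
proof -
  have fractions: "\<exists>f \<in> Hom C P B. path_equiv C R A B xs [Bwd q, Fwd f]"
    if q: "q \<in> R" "q \<in> Hom C P A" 
      and full: "\<And>B g. g \<in> Hom D (Fo P) (Fo B) \<Longrightarrow> B \<in> Obj C \<Longrightarrow> \<exists>f \<in> Hom C P B. Fa f = g"
      and xs: "is_path C R A xs B" for A P q B xs
    using xs
  proof (induction xs arbitrary: B rule: rev_induct)
    case Nil
    then have "A = B" by simp
    then show ?case using path_sym[OF path_equiv_Bwd_Fwd[OF q]] q by blast
  next
    case (snoc x xs)
    obtain E where E: "is_path C R A xs E" "is_path C R E [x] B" using is_path_appendE[OF snoc(2)] .
    obtain f where f: "f \<in> Hom C P E" "path_equiv C R A E xs [Bwd q, Fwd f]" 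
      using snoc(1)[OF E(1)] by blast
    have 1: "path_equiv C R A B (xs @ [x]) [Bwd q, Fwd f, x]"
      using path_equiv_append_right[OF f(2) E(2)] by simp
    note Bq = is_path_Bwd[OF q]
    show ?case
    proof (cases x)
      case (Fwd g)
      then have g: "g \<in> Hom C E B" using E(2) by (auto simp: Hom_iff)
      have "path_equiv C R A B [Bwd q, Fwd f, x] [Bwd q, Fwd (g \<cdot>\<^bsub>C\<^esub> f)]"
        using path_equiv_append_left[OF path_equiv_Fwd_Fwd[OF f(1) g] Bq] Fwd by simp
      then show ?thesis using path_trans[OF 1] Comp_closed[OF f(1) g] by blast
    next
      case (Bwd s)
      then have s: "s \<in> R" "s \<in> Hom C B E" using E(2) R_Arr by (auto simp: Hom_iff)
      note i = inverse_arrow[OF inverts[OF s(1)] Fa[OF s(2)]]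
      have "inverse_arrow D (Fa s) \<cdot>\<^bsub>D\<^esub> Fa f \<in> Hom D (Fo P) (Fo B)"
        using D.Comp_closed[OF Fa[OF f(1)] i(1)] .
      then obtain f' where f': "f' \<in> Hom C P B" "Fa f' = inverse_arrow D (Fa s) \<cdot>\<^bsub>D\<^esub> Fa f"
        using full Hom_objs[OF s(2)] by blast
      \<comment> \<open>The lift exists in \<open>D\<close>, where \<open>s\<close> becomes
        invertible; faithfulness turns it into the equation \<open>s \<cdot> f' = f\<close> in
        \<open>C\<close> itself. In the path, \<open>f\<close> may then be replaced by
        \<open>f'\<close> followed by \<open>s\<close>, and this \<open>s\<close> cancels against
        the letter \<open>Bwd s\<close>.\<close>
      have "Fa (s \<cdot>\<^bsub>C\<^esub> f') = Fa f"
        using FC[OF f'(1) s(2)] f'(2) D.Comp_assoc[OF Fa[OF f(1)] i(1) Fa[OF s(2)]] i(3)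
          D.Comp_Ident_left[OF Fa[OF f(1)]] by simp
      then have sf: "s \<cdot>\<^bsub>C\<^esub> f' = f"
        using faithful Comp_closed[OF f'(1) s(2)] f(1) unfolding faithful_functor_def inj_on_def by blast
      have 2: "path_equiv C R A B ([Bwd q] @ [Fwd f', Fwd s] @ [Bwd s]) ([Bwd q] @ [Fwd f] @ [Bwd s])"
        using path_equiv_append_left[OF path_equiv_append_right[OF path_equiv_Fwd_Fwd[OF f'(1) s(2)]
              is_path_Bwd[OF s]] Bq] sf by simp
      have "is_path C R A ([Bwd q] @ [Fwd f']) B"
        by (rule iffD2[OF is_path_append[OF Bq] is_path_Fwd[OF f'(1)]])
      then have 3: "path_equiv C R A B (([Bwd q] @ [Fwd f']) @ [Fwd s, Bwd s]) (([Bwd q] @ [Fwd f']) @ [])"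
        by (rule path_equiv_append_left[OF path_equiv_Fwd_Bwd[OF s]])
      have "path_equiv C R A B [Bwd q, Fwd f, Bwd s] [Bwd q, Fwd f']"
        using path_trans[OF path_sym[OF 2], of "[Bwd q, Fwd f']"] 3 by simp
      then show ?thesis using f'(1) path_trans[OF 1] Bwd by auto
    qed
  qed
  show ?thesis
  proof (rule equivalence_if_full_faithful_essentially_surjective[OF localized_functor])
    show "full_functor L D Fo localized"
      unfolding full_functor_def Obj_localization
    proof (intro ballI)
      fix A B g assume AB: "A \<in> Obj C" "B \<in> Obj C" and g: "g \<in> Hom D (Fo A) (Fo B)"
      obtain P q where q: "q \<in> R" "q \<in> Hom C P A" and full: 
        "\<forall>B. \<forall>g \<in> Hom D (Fo P) (Fo B). B \<in> Obj C \<longrightarrow> (\<exists>f \<in> Hom C P B. Fa f = g)"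
        using resolution[OF AB(1)] by blast
      note Fq = Fa[OF q(2)]
      note i = inverse_arrow[OF inverts[OF q(1)] Fq]
      \<comment> \<open>An arrow \<open>g\<close> out of \<open>Fo A\<close> need not be the image
        of an arrow out of \<open>A\<close>, but its composite with \<open>Fa q\<close> starts at
        \<open>Fo P\<close> and is the image of some \<open>f\<close>. Going back along
        \<open>q\<close> and then along \<open>f\<close> has the value \<open>g\<close>.\<close>
      obtain f where f: "f \<in> Hom C P B" "Fa f = g \<cdot>\<^bsub>D\<^esub> Fa q"
        using full D.Comp_closed[OF Fq g] AB(2) by blast
      have path: "is_path C R A ([Bwd q] @ [Fwd f]) B"
        by (rule iffD2[OF is_path_append[OF is_path_Bwd[OF q]] is_path_Fwd[OF f(1)]])
      have "path_value A ([Bwd q] @ [Fwd f]) = path_value P [Fwd f] \<cdot>\<^bsub>D\<^esub> path_value A [Bwd q]"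
        by (rule path_value_append[OF is_path_Bwd[OF q] is_path_Fwd[OF f(1)]])
      also have "path_value A [Bwd q] = inverse_arrow D (Fa q)"
        using D.Comp_Ident_left[OF i(1)] q by (simp add: Hom_iff)
      also have "path_value P [Fwd f] = g \<cdot>\<^bsub>D\<^esub> Fa q" using path_value_Fwd[OF f(1)] f(2) by simp
      also have "(g \<cdot>\<^bsub>D\<^esub> Fa q) \<cdot>\<^bsub>D\<^esub> inverse_arrow D (Fa q) = g"
        using D.Comp_assoc[OF i(1) Fq g] i(3) D.Comp_Ident_right[OF g] by simp
      finally have "localized (path_class A B ([Bwd q] @ [Fwd f])) = g"
        using localized_path_class[OF path] by simp
      moreover have "path_class A B ([Bwd q] @ [Fwd f]) \<in> Hom L A B"
        unfolding Hom_localization using path by blast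
      ultimately show "\<exists>p \<in> Hom L A B. localized p = g" by blast
    qed
    show "faithful_functor L localized"
      unfolding faithful_functor_def inj_on_def
    proof (intro allI ballI impI)
      fix A B p p' assume p: "p \<in> Hom L A B" "p' \<in> Hom L A B"
        "localized p = localized p'"
      obtain xs ys where xs: "is_path C R A xs B" "p = path_class A B xs" 
        and ys: "is_path C R A ys B" "p' = path_class A B ys"
        using p unfolding Hom_localization by blast
      have A: "A \<in> Obj C" using is_path_objs xs by blast
      obtain P q where q: "q \<in> R" "q \<in> Hom C P A" and full: 
        "\<forall>B. \<forall>g \<in> Hom D (Fo P) (Fo B). B \<in> Obj C \<longrightarrow> (\<exists>f \<in> Hom C P B. Fa f = g)"
        using resolution[OF A] by blast
      \<comment> \<open>The same \<open>q\<close> serves both paths, so only the numerators have to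
        be compared and no common denominator is constructed.\<close>
      obtain f where f: "f \<in> Hom C P B" "path_equiv C R A B xs [Bwd q, Fwd f]"
        using fractions[OF q _ xs(1)] full by blast
      obtain g where g: "g \<in> Hom C P B" "path_equiv C R A B ys [Bwd q, Fwd g]"
        using fractions[OF q _ ys(1)] full by blast
      have *: "path_value A [Bwd q, Fwd h] = Fa h \<cdot>\<^bsub>D\<^esub> inverse_arrow D (Fa q)" 
        if h: "h \<in> Hom C P B" for h
        using path_value_Fwd[OF h] q by (simp add: Hom_iff)
      note i = inverse_arrow[OF inverts[OF q(1)] Fa[OF q(2)]]
      have "Fa f \<cdot>\<^bsub>D\<^esub> inverse_arrow D (Fa q) = Fa g \<cdot>\<^bsub>D\<^esub> inverse_arrow D (Fa q)"
        using p(3) *[OF f(1)] *[OF g(1)] path_value_equiv[OF f(2)] path_value_equiv[OF g(2)]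
          localized_path_class xs ys by simp
      then have "Fa f = Fa g"
        using D.Comp_assoc[OF Fa[OF q(2)] i(1) Fa[OF f(1)]] D.Comp_assoc[OF Fa[OF q(2)] i(1) Fa[OF g(1)]]
          i(2) D.Comp_Ident_right[OF Fa[OF f(1)]] D.Comp_Ident_right[OF Fa[OF g(1)]] by simp
      then have "f = g" using faithful f(1) g(1) unfolding faithful_functor_def inj_on_def by blast
      then have "path_equiv C R A B xs ys" using f(2) g(2) path_trans path_sym by metis
      then show "p = p'" using xs ys path_class_eq_iff by simp
    qed
    show "essentially_surjective L D Fo"
      using ess by (simp add: essentially_surjective_def Obj_localization)
  qed
qed

end

section \<open>Weak kernels and cokernels from triangles\<close>

context preadditive_category
begin

lemma Add_closed: "\<lbrakk>f \<in> Hom C A B; g \<in> Hom C A B\<rbrakk> \<Longrightarrow> Add C f g \<in> Hom C A B"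
  using comm_group.axioms(1)[OF hom_comm_group, of A B] Hom_objs[of f A B]
    monoid.m_closed[of "hom_group C A B" f g] 
  by (auto simp: hom_group_def comm_monoid_def)

lemma Zero_closed: "\<lbrakk>A \<in> Obj C; B \<in> Obj C\<rbrakk> \<Longrightarrow> Zero C A B \<in> Hom C A B"
  using comm_group.axioms(1)[OF hom_comm_group, of A B] 
    monoid.one_closed[of "hom_group C A B"] 
  by (auto simp: hom_group_def comm_monoid_def)

lemma hom_group_group: "\<lbrakk>A \<in> Obj C; B \<in> Obj C\<rbrakk> \<Longrightarrow> group (hom_group C A B)"
  using hom_comm_group comm_group.axioms(2) by blast

lemma Add_Zero_right: "f \<in> Hom C A B \<Longrightarrow> Add C f (Zero C A B) = f"
  using monoid.r_one[OF group.is_monoid[OF hom_group_group[of A B]], of f] Hom_objs[of f A B] 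
  by (auto simp: hom_group_def)

lemma Add_Zero_left: "f \<in> Hom C A B \<Longrightarrow> Add C (Zero C A B) f = f"
  using monoid.l_one[OF group.is_monoid[OF hom_group_group[of A B]], of f] Hom_objs[of f A B] 
  by (auto simp: hom_group_def)

lemma Add_commute: "\<lbrakk>f \<in> Hom C A B; g \<in> Hom C A B\<rbrakk> \<Longrightarrow> Add C f g = Add C g f"
  using comm_monoid.m_comm[OF comm_group.axioms(1)[OF hom_comm_group[of A B]], of f g] 
    Hom_objs[of f A B] by (auto simp: hom_group_def)

lemma Add_assoc: "\<lbrakk>f \<in> Hom C A B; g \<in> Hom C A B; h \<in> Hom C A B\<rbrakk> 
    \<Longrightarrow> Add C (Add C f g) h = Add C f (Add C g h)"
  using monoid.m_assoc[OF group.is_monoid[OF hom_group_group[of A B]], of f g h] Hom_objs[of f A B] 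
  by (auto simp: hom_group_def)

lemma Add_left_cancel: 
  "\<lbrakk>f \<in> Hom C A B; g \<in> Hom C A B; h \<in> Hom C A B; Add C f g = Add C f h\<rbrakk> \<Longrightarrow> g = h"
  using group.right_cancel[OF hom_group_group[of A B], of f g h] Hom_objs[of f A B] 
    Add_commute[of g A B f] Add_commute[of h A B f] by (auto simp: hom_group_def)

lemma Neg_eq: "f \<in> Hom C A B \<Longrightarrow> Neg C f = inv\<^bsub>hom_group C A B\<^esub> f"
  by (auto simp: Neg_def Hom_iff)

lemma Neg_closed: "f \<in> Hom C A B \<Longrightarrow> Neg C f \<in> Hom C A B"
  using group.inv_closed[OF hom_group_group[of A B], of f] Hom_objs[of f A B] 
  by (auto simp: Neg_eq) (auto simp: hom_group_def)

lemma Add_Neg: "f \<in> Hom C A B \<Longrightarrow> Add C f (Neg C f) = Zero C A B"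
  using group.r_inv[OF hom_group_group[of A B], of f] Hom_objs[of f A B] 
  by (auto simp: Neg_eq) (auto simp: hom_group_def)

text \<open>In a group only the neutral element is idempotent. Additive operations send a zero map
  to an idempotent, which is how they are shown to preserve zeros.\<close>

lemma Add_idem_Zero: "\<lbrakk>f \<in> Hom C A B; Add C f f = f\<rbrakk> \<Longrightarrow> f = Zero C A B"
  using Add_left_cancel[of f A B f "Zero C A B"] Add_Zero_right[of f A B] Zero_closed Hom_objs[of f A B] 
  by auto

lemma Comp_Zero_right: "\<lbrakk>g \<in> Hom C B D; A \<in> Obj C\<rbrakk> \<Longrightarrow> g \<cdot> Zero C A B = Zero C A D"
proof (rule Add_idem_Zero)
  assume g: "g \<in> Hom C B D" and A: "A \<in> Obj C"
  have z: "Zero C A B \<in> Hom C A B" using Zero_closed A Hom_objs[OF g] by blast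
  show "g \<cdot> Zero C A B \<in> Hom C A D" using Comp_closed[OF z g] .
  show "Add C (g \<cdot> Zero C A B) (g \<cdot> Zero C A B) = g \<cdot> Zero C A B"
    using Comp_Add_right[OF z z g] Add_Zero_right[OF z] by simp
qed

lemma Comp_Zero_left: "\<lbrakk>f \<in> Hom C A B; D \<in> Obj C\<rbrakk> \<Longrightarrow> Zero C B D \<cdot> f = Zero C A D"
proof (rule Add_idem_Zero)
  assume f: "f \<in> Hom C A B" and D: "D \<in> Obj C"
  have z: "Zero C B D \<in> Hom C B D" using Zero_closed D Hom_objs[OF f] by blast
  show "Zero C B D \<cdot> f \<in> Hom C A D" using Comp_closed[OF f z] .
  show "Add C (Zero C B D \<cdot> f) (Zero C B D \<cdot> f) = Zero C B D \<cdot> f"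
    using Comp_Add_left[OF f z z] Add_Zero_right[OF z] by simp
qed

lemma Neg_unique: "\<lbrakk>f \<in> Hom C A B; g \<in> Hom C A B; Add C f g = Zero C A B\<rbrakk> \<Longrightarrow> g = Neg C f"
  using Add_left_cancel[of f A B g "Neg C f"] Add_Neg[of f A B] Neg_closed[of f A B] by simp

lemma Comp_Neg_left:
  assumes f: "f \<in> Hom C A B" and g: "g \<in> Hom C B D"
  shows "Neg C g \<cdot> f = Neg C (g \<cdot> f)"
proof (rule Neg_unique[OF Comp_closed[OF f g] Comp_closed[OF f Neg_closed[OF g]]])
  show "Add C (g \<cdot> f) (Neg C g \<cdot> f) = Zero C A D"
    using Comp_Add_left[OF f g Neg_closed[OF g]] Add_Neg[OF g] Comp_Zero_left[OF f] Hom_objs[OF g] by simp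
qed

lemma Comp_Neg_right:
  assumes f: "f \<in> Hom C A B" and g: "g \<in> Hom C B D"
  shows "g \<cdot> Neg C f = Neg C (g \<cdot> f)"
proof (rule Neg_unique[OF Comp_closed[OF f g] Comp_closed[OF Neg_closed[OF f] g]])
  show "Add C (g \<cdot> f) (g \<cdot> Neg C f) = Zero C A D"
    using Comp_Add_right[OF f Neg_closed[OF f] g] Add_Neg[OF f] Comp_Zero_right[OF g] Hom_objs[OF f] by simp
qed

lemma Neg_Neg: 
  assumes f: "f \<in> Hom C A B"
  shows "Neg C (Neg C f) = f"
  using Neg_unique[OF Neg_closed[OF f] f] Add_Neg[OF f] Add_commute[OF f Neg_closed[OF f]] by metis

lemma Add_Neg_eq_Zero: 
  assumes "f \<in> Hom C A B" "g \<in> Hom C A B" "Add C f (Neg C g) = Zero C A B"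
  shows "f = g"
  using Neg_unique[OF assms(1) Neg_closed[OF assms(2)] assms(3)] Neg_Neg[OF assms(1)] 
    Neg_Neg[OF assms(2)] by simp

lemma Add_Neg_cancel: 
  assumes "f \<in> Hom C A B" "g \<in> Hom C A B"
  shows "Add C (Add C f (Neg C g)) g = f"
  using Add_assoc[OF assms(1) Neg_closed[OF assms(2)] assms(2)] 
    Add_commute[OF Neg_closed[OF assms(2)] assms(2)] Add_Neg[OF assms(2)]
    Add_Zero_right[OF assms(1)] by simp

lemma Neg_Zero: "\<lbrakk>A \<in> Obj C; B \<in> Obj C\<rbrakk> \<Longrightarrow> Neg C (Zero C A B) = Zero C A B"
  using Neg_unique[of "Zero C A B" A B "Zero C A B"] Zero_closed[of A B] 
    Add_Zero_right[of "Zero C A B" A B] by metis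

lemma zero_objectD:
  assumes "zero_object C Z"
  shows "f \<in> Hom C A Z \<Longrightarrow> f = Zero C A Z" "f \<in> Hom C Z A \<Longrightarrow> f = Zero C Z A"
proof -
  have Z: "Z \<in> Obj C" using assms unfolding zero_object_def by blast
  show "f = Zero C A Z" if f: "f \<in> Hom C A Z"
  proof -
    have A: "A \<in> Obj C" using Hom_objs(1)[OF f] .
    then have "\<exists>!f. f \<in> Hom C A Z" using assms unfolding zero_object_def by simp
    then show ?thesis using f Zero_closed[OF A Z] by metis
  qed
  show "f = Zero C Z A" if f: "f \<in> Hom C Z A"
  proof -
    have A: "A \<in> Obj C" using Hom_objs(2)[OF f] .
    then have "\<exists>!f. f \<in> Hom C Z A" using assms unfolding zero_object_def by simp
    then show ?thesis using f Zero_closed[OF Z A] by metis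
  qed
qed

text \<open>Every arrow into or out of \<open>Z\<close> is its own composite with the identity,
  hence zero. A construction preserving identities and zero maps therefore preserves zero
  objects.\<close>

lemma zero_object_if_Ident_Zero:
  assumes Z: "Z \<in> Obj C" and I: "Ident C Z = Zero C Z Z"
  shows "zero_object C Z"
  unfolding zero_object_def
proof (intro conjI ballI ex1I)
  fix A f assume A: "A \<in> Obj C"
  show "Zero C A Z \<in> Hom C A Z" "Zero C Z A \<in> Hom C Z A" using A Z Zero_closed by auto
  show "f = Zero C A Z" if "f \<in> Hom C A Z"
    using Comp_Ident_left[OF that] Comp_Zero_left[OF that Z] unfolding I by simp
  show "f = Zero C Z A" if "f \<in> Hom C Z A"
    using Comp_Ident_right[OF that] Comp_Zero_right[OF that Z] unfolding I by simp
qed (rule Z)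

end

text \<open>The interface between triangles and the later argument. Weak kernels are tested on maps
  from \<open>X\<close> only, weak cokernels against all targets. The last two clauses of
  \<open>weak_cokernel\<close> say that \<open>H P -> H B -> H E -> 0\<close> is exact; they are
  asked for \<open>P\<close> in \<open>X\<close>, where rigidity provides them.\<close>

locale weak_cokernel_category = additive_category C
  for C :: "('o, 'm, 'z) preadd_cat_scheme" (structure) +
  fixes X :: "'o set"
  assumes X_Obj: "X \<subseteq> Obj C"
    and approximation: "A \<in> Obj C \<Longrightarrow> \<exists>P\<in>X. \<exists>p \<in> Hom C P A. 
          \<forall>Y\<in>X. \<forall>y \<in> Hom C Y A. \<exists>x \<in> Hom C Y P. y = p \<cdot> x"
    and weak_kernel: "f \<in> Hom C A B \<Longrightarrow> \<exists>L. \<exists>l \<in> Hom C L A. f \<cdot> l = Zero C L B \<and>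
          (\<forall>Y\<in>X. \<forall>y \<in> Hom C Y A. f \<cdot> y = Zero C Y B \<longrightarrow> (\<exists>x \<in> Hom C Y L. y = l \<cdot> x))"
    and weak_cokernel: "\<lbrakk>f \<in> Hom C P B; P \<in> X\<rbrakk> \<Longrightarrow> \<exists>E. \<exists>c \<in> Hom C B E. c \<cdot> f = Zero C P E \<and>
          (\<forall>D. \<forall>g \<in> Hom C B D. g \<cdot> f = Zero C P D \<longrightarrow> (\<exists>h \<in> Hom C E D. g = h \<cdot> c)) \<and>
          (\<forall>Y\<in>X. \<forall>y \<in> Hom C Y E. \<exists>x \<in> Hom C Y B. y = c \<cdot> x) \<and>
          (\<forall>Y\<in>X. \<forall>x \<in> Hom C Y B. c \<cdot> x = Zero C Y E \<longrightarrow> (\<exists>z \<in> Hom C Y P. x = f \<cdot> z))"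

section \<open>Exactness of morphism groups along distinguished triangles\<close>

context triangulated_category
begin

lemma Sh_functor: "is_functor T T (Sh T) (ShA T)"
  using shift_equivalence unfolding is_equivalence_def by blast

lemmas Sh_Obj = is_functorD(3)[OF Sh_functor]
  and ShA_Hom = is_functorD(4)[OF Sh_functor]
  and ShA_Ident = is_functorD(5)[OF Sh_functor]
  and ShA_Comp = is_functorD(6)[OF Sh_functor]

lemma ShA_inj: "\<lbrakk>f \<in> Hom T A B; g \<in> Hom T A B; ShA T f = ShA T g\<rbrakk> \<Longrightarrow> f = g"
  using equivalence_faithful[OF shift_equivalence] unfolding faithful_functor_def inj_on_def by blast

lemma ShA_surj: "\<lbrakk>A \<in> Obj T; B \<in> Obj T; g \<in> Hom T (Sh T A) (Sh T B)\<rbrakk> \<Longrightarrow> \<exists>f \<in> Hom T A B. ShA T f = g"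
  using equivalence_full[OF shift_equivalence] unfolding full_functor_def by blast

lemma ShA_Zero:
  assumes "A \<in> Obj T" "B \<in> Obj T"
  shows "ShA T (Zero T A B) = Zero T (Sh T A) (Sh T B)"
proof (rule Add_idem_Zero)
  have z: "Zero T A B \<in> Hom T A B" using assms Zero_closed by blast
  then show "ShA T (Zero T A B) \<in> Hom T (Sh T A) (Sh T B)" using ShA_Hom by blast
  show "Add T (ShA T (Zero T A B)) (ShA T (Zero T A B)) = ShA T (Zero T A B)"
    using shift_additive[OF z z] Add_Zero_right[OF z] by simp
qed

lemma Sh_zero_object:
  assumes "zero_object T Z"
  shows "zero_object T (Sh T Z)"
proof (rule zero_object_if_Ident_Zero)
  have Z: "Z \<in> Obj T" using assms unfolding zero_object_def by blast
  then show "Sh T Z \<in> Obj T" using Sh_Obj by blast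
  show "Ident T (Sh T Z) = Zero T (Sh T Z) (Sh T Z)"
    using zero_objectD(1)[OF assms Ident_closed[OF Z]] ShA_Ident[OF Z] ShA_Zero[OF Z Z] by metis
qed

lemma Tri_Hom:
  assumes "(u, v, w) \<in> Tri T" "u \<in> Hom T A B"
  obtains E where "v \<in> Hom T B E" "w \<in> Hom T E (Sh T A)"
proof (rule that)
  show "v \<in> Hom T B (Cod T v)" "w \<in> Hom T (Cod T v) (Sh T A)"
    using Tri_triangle[OF assms(1)] assms(2) unfolding triangle_def Hom_iff by simp_all
qed

lemma triangleI: "\<lbrakk>u \<in> Hom T A B; v \<in> Hom T B E; w \<in> Hom T E (Sh T A)\<rbrakk> \<Longrightarrow> triangle T u v w"
  unfolding triangle_def Hom_iff by simp

lemma rotate: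
  assumes "(u, v, w) \<in> Tri T"
  shows "(v, w, Neg T (ShA T u)) \<in> Tri T"
  using TR2[OF Tri_triangle[OF assms]] assms by simp

text \<open>The identity of \<open>A\<close> and \<open>u\<close> extend to a morphism from the
  trivial triangle \<open>A = A -> 0\<close> to the given one. Its third component starts at a zero
  object, and the commuting square forces \<open>v \<cdot> u\<close> to vanish.\<close>

lemma Tri_comp_Zero:
  assumes t: "(u, v, w) \<in> Tri T" and u: "u \<in> Hom T A B" and v: "v \<in> Hom T B E"
  shows "v \<cdot> u = Zero T A E"
proof -
  obtain Z where Z: "zero_object T Z" using ex_zero_object by blast
  note A = Hom_objs(1)[OF u]
  have ZO: "Z \<in> Obj T" using Z unfolding zero_object_def by (rule conjunct1)
  note I = TR1_Ident[OF A Z]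
  note IA = Ident_closed[OF A] and zAZ = Zero_closed[OF A ZO]
  note dc = Hom_DomD[OF IA] Hom_CodD[OF IA] Hom_CodD[OF zAZ] Hom_DomD[OF u] Hom_CodD[OF u] Hom_CodD[OF v]
  obtain c where "c \<in> Hom T Z E" "c \<cdot> Zero T A Z = v \<cdot> u"
    using TR3[OF I t, of "Ident T A" u, unfolded dc, OF IA u refl] by blast
  then show ?thesis using Comp_Zero_right[OF _ A, of c Z E] by simp
qed

text \<open>The trivial triangle on \<open>Y\<close>, rotated to
  \<open>Y -> 0 -> Y[1] -> Y[1]\<close>, is mapped by \<open>y\<close> and 0 to the rotation that
  starts with \<open>v\<close>. The third component \<open>Y[1] -> A[1]\<close> is the shift of the
  required \<open>x\<close> because the shift is full; the signs of the two rotations cancel, and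
  faithfulness removes the shift.\<close>

lemma Tri_weak_kernel:
  assumes t: "(u, v, w) \<in> Tri T" and u: "u \<in> Hom T A B" and v: "v \<in> Hom T B E"
    and y: "y \<in> Hom T Y B" and vy: "v \<cdot> y = Zero T Y E"
  shows "\<exists>x \<in> Hom T Y A. y = u \<cdot> x"
proof -
  obtain Z where Z: "zero_object T Z" using ex_zero_object by blast
  have ZO: "Z \<in> Obj T" using Z unfolding zero_object_def by (rule conjunct1)
  note Y = Hom_objs(1)[OF y] and A = Hom_objs(1)[OF u] and E = Hom_objs(2)[OF v]
  have w: "w \<in> Hom T E (Sh T A)" using Tri_triangle[OF t] Hom_DomD[OF u] Hom_CodD[OF v] unfolding triangle_def Hom_iff by metis
  note I = rotate[OF TR1_Ident[OF Y Z]]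
  note zYZ = Zero_closed[OF Y ZO] and zZE = Zero_closed[OF ZO E] and zZY = Zero_closed[OF ZO Sh_Obj[OF Y]]
  note dc = Hom_DomD[OF zYZ] Hom_CodD[OF zYZ] Hom_CodD[OF zZY] Hom_DomD[OF v] Hom_CodD[OF v] Hom_CodD[OF w]
  have "Zero T Z E \<cdot> Zero T Y Z = v \<cdot> y"
    using Comp_Zero_right[OF zZE Y] vy by simp
  then obtain g where g: "g \<in> Hom T (Sh T Y) (Sh T A)" 
    "ShA T y \<cdot> Neg T (ShA T (Ident T Y)) = Neg T (ShA T u) \<cdot> g"
    using TR3[OF I rotate[OF t], of y "Zero T Z E", unfolded dc, OF y zZE] by blast
  obtain x where x: "x \<in> Hom T Y A" "ShA T x = g" using ShA_surj[OF Y A g(1)] by blast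
  note uh = ShA_Hom[OF u] and yh = ShA_Hom[OF y]
  have "Neg T (ShA T y) = ShA T y \<cdot> Neg T (ShA T (Ident T Y))"
    using ShA_Ident[OF Y] Comp_Neg_right[OF Ident_closed[OF Sh_Obj[OF Y]] yh] Comp_Ident_right[OF yh] by simp
  also have "\<dots> = Neg T (ShA T (u \<cdot> x))"
    using g(2) Comp_Neg_left[OF g(1) uh] ShA_Comp[OF x(1) u] x(2) by simp
  finally have "ShA T y = ShA T (u \<cdot> x)"
    using Neg_Neg[OF yh] Neg_Neg[OF ShA_Hom[OF Comp_closed[OF x(1) u]]] by metis
  then show ?thesis using ShA_inj[OF y Comp_closed[OF x(1) u]] x(1) by blast
qed

text \<open>The maps 0 and \<open>g\<close> extend to a morphism into the triangle
  \<open>0 -> D = D -> 0[1]\<close>, whose third component is the required map.\<close>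

lemma Tri_weak_cokernel:
  assumes t: "(u, v, w) \<in> Tri T" and u: "u \<in> Hom T A B" and v: "v \<in> Hom T B E"
    and g: "g \<in> Hom T B D" and gu: "g \<cdot> u = Zero T A D"
  shows "\<exists>h \<in> Hom T E D. g = h \<cdot> v"
proof -
  obtain Z where Z: "zero_object T Z" using ex_zero_object by blast
  have ZO: "Z \<in> Obj T" using Z unfolding zero_object_def by (rule conjunct1)
  note D = Hom_objs(2)[OF g] and A = Hom_objs(1)[OF u]
  note SZ = Sh_zero_object[OF Z]
  note zZD = Zero_closed[OF ZO D] and zDZ = Zero_closed[OF D Sh_Obj[OF ZO]] and zAZ = Zero_closed[OF A ZO]
  note I = Ident_closed[OF D]
  \<comment> \<open>The axiom yields the triangle on the identity of \<open>D\<close> followed by a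
    map to a zero object. With \<open>Sh T Z\<close> as that zero object, its third map is the
    negative shift of \<open>0 -> D\<close>, so \<open>TR2\<close> can be read backwards.\<close>
  have "Neg T (ShA T (Zero T Z D)) = Zero T (Sh T Z) (Sh T D)"
    using ShA_Zero[OF ZO D] Neg_Zero[OF Sh_Obj[OF ZO] Sh_Obj[OF D]] by simp
  then have "(Ident T D, Zero T D (Sh T Z), Neg T (ShA T (Zero T Z D))) \<in> Tri T"
    using TR1_Ident[OF D SZ] by simp
  then have t': "(Zero T Z D, Ident T D, Zero T D (Sh T Z)) \<in> Tri T"
    using TR2[OF triangleI[OF zZD I zDZ]] by simp
  note dc = Hom_DomD[OF u] Hom_CodD[OF u] Hom_CodD[OF v] Hom_DomD[OF zZD] Hom_CodD[OF zZD] Hom_CodD[OF I]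
  have "g \<cdot> u = Zero T Z D \<cdot> Zero T A Z" using gu Comp_Zero_right[OF zZD A] by simp
  then obtain c where c: "c \<in> Hom T E D" "c \<cdot> v = Ident T D \<cdot> g"
    using TR3[OF t t', of "Zero T A Z" g, unfolded dc, OF zAZ g] by blast
  then show ?thesis using Comp_Ident_left[OF g] by auto
qed

text \<open>The weak kernel is a desuspension of a cone, which exists because the shift is essentially 
  surjective.\<close>

lemma ex_weak_kernel:
  assumes f: "f \<in> Hom T A B"
  shows "\<exists>L. \<exists>l \<in> Hom T L A. f \<cdot> l = Zero T L B \<and>
          (\<forall>Y. \<forall>y \<in> Hom T Y A. f \<cdot> y = Zero T Y B \<longrightarrow> (\<exists>x \<in> Hom T Y L. y = l \<cdot> x))"
proof -
  note A = Hom_objs(1)[OF f] and B = Hom_objs(2)[OF f]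
  obtain v w where t: "(f, v, w) \<in> Tri T" using TR1_cone f unfolding Hom_iff by blast
  obtain E where v: "v \<in> Hom T B E" and w: "w \<in> Hom T E (Sh T A)" using Tri_Hom[OF t f] .
  obtain L e where L: "L \<in> Obj T" and e: "e \<in> Hom T (Sh T L) E" "isomorphism T e"
    using equivalence_essentially_surjective[OF shift_equivalence] Hom_objs(2)[OF v]
    unfolding essentially_surjective_def by blast
  obtain e' where e': "e' \<in> Hom T E (Sh T L)" "e \<cdot> e' = Ident T E"
    using isomorphismE[OF e(2,1)] by blast
  obtain l where l: "l \<in> Hom T L A" "ShA T l = w \<cdot> e"
    using ShA_surj[OF L A Comp_closed[OF e(1) w]] by blast
  note t2 = rotate[OF rotate[OF t]] and Sf = ShA_Hom[OF f]
  note nSf = Neg_closed[OF Sf]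
  have z: "Neg T (ShA T f) \<cdot> w = Zero T E (Sh T B)"
    using Tri_comp_Zero[OF rotate[OF rotate[OF t]], of E "Sh T A" "Sh T B"]
      Tri_comp_Zero[OF t2 w nSf] by simp
  have z': "ShA T f \<cdot> w = Zero T E (Sh T B)"
    using Comp_Neg_left[OF w nSf] z Neg_Neg[OF Sf] Neg_Zero[OF Hom_objs(2)[OF v] Sh_Obj[OF B]] by simp
  have "ShA T (f \<cdot> l) = ShA T (Zero T L B)"
    using ShA_Comp[OF l(1) f] l(2) Comp_assoc[OF e(1) w Sf] z' Comp_Zero_left[OF e(1) Sh_Obj[OF B]] 
      ShA_Zero[OF L B] by simp
  then have "f \<cdot> l = Zero T L B"
    using ShA_inj[OF Comp_closed[OF l(1) f] Zero_closed[OF L B]] by blast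
  moreover have "\<exists>x \<in> Hom T Y L. y = l \<cdot> x" if y: "y \<in> Hom T Y A" "f \<cdot> y = Zero T Y B" for Y y
  proof -
    note Y = Hom_objs(1)[OF y(1)] and Sy = ShA_Hom[OF y(1)]
    have "Neg T (ShA T f) \<cdot> ShA T y = Zero T (Sh T Y) (Sh T B)"
      using Comp_Neg_left[OF Sy Sf] ShA_Comp[OF y(1) f] y(2) ShA_Zero[OF Y B] 
        Neg_Zero[OF Sh_Obj[OF Y] Sh_Obj[OF B]] by simp
    \<comment> \<open>In the triangle rotated twice, \<open>w\<close> is followed by the negative
      shift of \<open>f\<close>. Hence the shift of \<open>y\<close> lifts along \<open>w\<close>;
      composing with \<open>e'\<close> moves the lift into the image of the shift.\<close>
    then obtain a where a: "a \<in> Hom T (Sh T Y) E" "ShA T y = w \<cdot> a"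
      using Tri_weak_kernel[OF t2 w nSf Sy] by blast
    obtain x where x: "x \<in> Hom T Y L" "ShA T x = e' \<cdot> a"
      using ShA_surj[OF Y L Comp_closed[OF a(1) e'(1)]] by blast
    have "ShA T (l \<cdot> x) = (w \<cdot> e) \<cdot> (e' \<cdot> a)" using ShA_Comp[OF x(1) l(1)] l(2) x(2) by simp
    also have "\<dots> = w \<cdot> ((e \<cdot> e') \<cdot> a)"
      using Comp_assoc[OF Comp_closed[OF a(1) e'(1)] e(1) w] Comp_assoc[OF a(1) e'(1) e(1)] by simp
    also have "\<dots> = ShA T y" using e'(2) Comp_Ident_left[OF a(1)] a(2) by simp
    finally have "y = l \<cdot> x" using ShA_inj[OF y(1) Comp_closed[OF x(1) l(1)]] by simp
    then show ?thesis using x(1) by blast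
  qed
  ultimately show ?thesis using l(1) by blast
qed

text \<open>The weak cokernel of \<open>P -> B\<close> is its cone. Two clauses express exactness of
  the triangle at \<open>B\<close>. The surjectivity clause is exactness at the cone
  \<open>E\<close>: a map from \<open>Y\<close> in \<open>X\<close> to \<open>E\<close> has zero
  composite with \<open>E -> P[1]\<close> by rigidity, and so comes from \<open>B\<close>.\<close>

lemma weak_cokernel_category_of_rigid:
  assumes X: "X \<subseteq> Obj T" and cf: "contravariantly_finite T X" and rigid: "rigid T X"
  shows "weak_cokernel_category T X"
proof
  show "X \<subseteq> Obj T" by (rule X)
next
  fix A assume "A \<in> Obj T"
  then obtain p where p: "right_approximation T X A p"
    using cf unfolding contravariantly_finite_def by blast
  then have "\<forall>Y\<in>X. \<forall>y \<in> Hom T Y A. \<exists>x \<in> Hom T Y (Dom T p). y = p \<cdot> x"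
    unfolding right_approximation_def by (metis imageE)
  moreover have "Dom T p \<in> X" "p \<in> Hom T (Dom T p) A"
    using p unfolding right_approximation_def Hom_iff by simp_all
  ultimately show "\<exists>P\<in>X. \<exists>p \<in> Hom T P A. \<forall>Y\<in>X. \<forall>y \<in> Hom T Y A. \<exists>x \<in> Hom T Y P. y = p \<cdot> x"
    by (intro bexI[of _ "Dom T p"] bexI[of _ p])
next
  fix f A B assume f: "f \<in> Hom T A B"
  show "\<exists>L. \<exists>l\<in>Hom T L A. f \<cdot> l = Zero T L B \<and>
      (\<forall>Y\<in>X. \<forall>y\<in>Hom T Y A. f \<cdot> y = Zero T Y B \<longrightarrow> (\<exists>x\<in>Hom T Y L. y = l \<cdot> x))"
    using ex_weak_kernel[OF f] by blast
next
  fix f P B assume f: "f \<in> Hom T P B" and P: "P \<in> X"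
  obtain v w where t: "(f, v, w) \<in> Tri T" using TR1_cone f unfolding Hom_iff by blast
  obtain E where v: "v \<in> Hom T B E" and w: "w \<in> Hom T E (Sh T P)" using Tri_Hom[OF t f] .
  show "\<exists>E. \<exists>c \<in> Hom T B E. c \<cdot> f = Zero T P E \<and>
          (\<forall>D. \<forall>g \<in> Hom T B D. g \<cdot> f = Zero T P D \<longrightarrow> (\<exists>h \<in> Hom T E D. g = h \<cdot> c)) \<and>
          (\<forall>Y\<in>X. \<forall>y \<in> Hom T Y E. \<exists>x \<in> Hom T Y B. y = c \<cdot> x) \<and>
          (\<forall>Y\<in>X. \<forall>x \<in> Hom T Y B. c \<cdot> x = Zero T Y E \<longrightarrow> (\<exists>z \<in> Hom T Y P. x = f \<cdot> z))"
  proof (rule exI[of _ E], rule bexI[OF _ v], intro conjI allI ballI impI)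
    show "v \<cdot> f = Zero T P E" by (rule Tri_comp_Zero[OF t f v])
    show "\<exists>h\<in>Hom T E D. g = h \<cdot> v" if "g \<in> Hom T B D" "g \<cdot> f = Zero T P D" for g D
      by (rule Tri_weak_cokernel[OF t f v that])
    show "\<exists>z\<in>Hom T Y P. x = f \<cdot> z" if "x \<in> Hom T Y B" "v \<cdot> x = Zero T Y E" for x Y
      by (rule Tri_weak_kernel[OF t f v that])
    show "\<exists>x\<in>Hom T Y B. y = v \<cdot> x" if Y: "Y \<in> X" and y: "y \<in> Hom T Y E" for Y y
    proof (rule Tri_weak_kernel[OF rotate[OF t] v w y])
      show "w \<cdot> y = Zero T Y (Sh T P)"
        using Comp_closed[OF y w] rigid Y P unfolding rigid_def by blast
    qed
  qed
qed

end

section \<open>Natural transformations and the category of coherent functors\<close>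

lemma additive_functorD:
  assumes "additive_functor C X F"
  shows "A \<in> X \<Longrightarrow> comm_group (On_obj F A)"
    and "A \<in> X \<Longrightarrow> group (On_obj F A)"
    and "\<lbrakk>A \<in> X; B \<in> X; f \<in> Hom C A B\<rbrakk> \<Longrightarrow> On_arr F f \<in> hom (On_obj F B) (On_obj F A)"
    and "\<lbrakk>A \<in> X; B \<in> X; f \<in> Hom C A B; x \<in> carrier (On_obj F B)\<rbrakk> \<Longrightarrow> On_arr F f x \<in> carrier (On_obj F A)"
    and "\<lbrakk>A \<in> X; x \<in> carrier (On_obj F A)\<rbrakk> \<Longrightarrow> On_arr F (Ident C A) x = x"
proof -
  show 1: "A \<in> X \<Longrightarrow> comm_group (On_obj F A)"
    using assms unfolding additive_functor_def by blast
  show "A \<in> X \<Longrightarrow> group (On_obj F A)" using comm_group.axioms(2)[OF 1] .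
  show 2: "On_arr F f \<in> hom (On_obj F B) (On_obj F A)" if "A \<in> X" "B \<in> X" "f \<in> Hom C A B"
    using assms that unfolding additive_functor_def by blast
  show "\<lbrakk>A \<in> X; B \<in> X; f \<in> Hom C A B; x \<in> carrier (On_obj F B)\<rbrakk> \<Longrightarrow> On_arr F f x \<in> carrier (On_obj F A)"
    using hom_in_carrier[OF 2] .
  show "\<lbrakk>A \<in> X; x \<in> carrier (On_obj F A)\<rbrakk> \<Longrightarrow> On_arr F (Ident C A) x = x"
    using assms unfolding additive_functor_def by blast
qed

lemma natural_transformationD:
  assumes "natural_transformation C X F G \<eta>"
  shows "A \<in> X \<Longrightarrow> \<eta> A \<in> hom (On_obj F A) (On_obj G A)"
    and "\<lbrakk>A \<in> X; x \<in> carrier (On_obj F A)\<rbrakk> \<Longrightarrow> \<eta> A x \<in> carrier (On_obj G A)"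
    and "\<lbrakk>A \<in> X; x \<in> carrier (On_obj F A); y \<in> carrier (On_obj F A)\<rbrakk>
      \<Longrightarrow> \<eta> A (x \<otimes>\<^bsub>On_obj F A\<^esub> y) = \<eta> A x \<otimes>\<^bsub>On_obj G A\<^esub> \<eta> A y"
    and "\<lbrakk>A \<in> X; B \<in> X; f \<in> Hom C A B; x \<in> carrier (On_obj F B)\<rbrakk>
      \<Longrightarrow> \<eta> A (On_arr F f x) = On_arr G f (\<eta> B x)"
proof -
  show 1: "A \<in> X \<Longrightarrow> \<eta> A \<in> hom (On_obj F A) (On_obj G A)"
    using assms unfolding natural_transformation_def by blast
  show "\<lbrakk>A \<in> X; x \<in> carrier (On_obj F A)\<rbrakk> \<Longrightarrow> \<eta> A x \<in> carrier (On_obj G A)"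
    using 1 by (blast dest: hom_in_carrier)
  show "\<lbrakk>A \<in> X; x \<in> carrier (On_obj F A); y \<in> carrier (On_obj F A)\<rbrakk>
      \<Longrightarrow> \<eta> A (x \<otimes>\<^bsub>On_obj F A\<^esub> y) = \<eta> A x \<otimes>\<^bsub>On_obj G A\<^esub> \<eta> A y"
    using 1 by (simp add: hom_mult)
  show "\<lbrakk>A \<in> X; B \<in> X; f \<in> Hom C A B; x \<in> carrier (On_obj F B)\<rbrakk>
      \<Longrightarrow> \<eta> A (On_arr F f x) = On_arr G f (\<eta> B x)"
    using assms unfolding natural_transformation_def by blast
qed

lemma natural_transformation_one:
  assumes "natural_transformation C X F G \<eta>" "additive_functor C X F" "additive_functor C X G" "A \<in> X"
  shows "\<eta> A \<one>\<^bsub>On_obj F A\<^esub> = \<one>\<^bsub>On_obj G A\<^esub>"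
  using hom_one[OF natural_transformationD(1)[OF assms(1,4)] additive_functorD(2)[OF assms(2,4)]
     additive_functorD(2)[OF assms(3,4)]] .

lemma natural_transformationI:
  assumes "\<And>A x. \<lbrakk>A \<in> X; x \<in> carrier (On_obj F A)\<rbrakk> \<Longrightarrow> \<eta> A x \<in> carrier (On_obj G A)"
    and "\<And>A x y. \<lbrakk>A \<in> X; x \<in> carrier (On_obj F A); y \<in> carrier (On_obj F A)\<rbrakk>
      \<Longrightarrow> \<eta> A (x \<otimes>\<^bsub>On_obj F A\<^esub> y) = \<eta> A x \<otimes>\<^bsub>On_obj G A\<^esub> \<eta> A y"
    and "\<And>A B f x. \<lbrakk>A \<in> X; B \<in> X; f \<in> Hom C A B; x \<in> carrier (On_obj F B)\<rbrakk>
      \<Longrightarrow> \<eta> A (On_arr F f x) = On_arr G f (\<eta> B x)"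
  shows "natural_transformation C X F G \<eta>"
  using assms unfolding natural_transformation_def hom_def by auto

lemma natural_transformation_comp:
  assumes "natural_transformation C X F G \<eta>" "natural_transformation C X G H \<theta>"
  shows "natural_transformation C X F H (\<lambda>A x. \<theta> A (\<eta> A x))"
  by (rule natural_transformationI) 
    (simp_all add: natural_transformationD[OF assms(1)] natural_transformationD[OF assms(2)])

lemma natural_transformation_ident:
  "natural_transformation C X F F (\<lambda>A x. x)"
  by (rule natural_transformationI) simp_all

text \<open>The axioms only involve values on the carriers over \<open>X\<close>, and additivity of
  \<open>F\<close> keeps these carriers closed under the operations that occur. This allows a family
  to be exchanged for its restriction.\<close>

lemma natural_transformation_cong:
  assumes F: "additive_functor C X F" 
    and n: "natural_transformation C X F G \<eta>"
    and eq: "\<And>A x. \<lbrakk>A \<in> X; x \<in> carrier (On_obj F A)\<rbrakk> \<Longrightarrow> \<theta> A x = \<eta> A x"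
  shows "natural_transformation C X F G \<theta>"
proof (rule natural_transformationI)
  fix A x y assume A: "A \<in> X" and x: "x \<in> carrier (On_obj F A)" and y: "y \<in> carrier (On_obj F A)"
  then have "x \<otimes>\<^bsub>On_obj F A\<^esub> y \<in> carrier (On_obj F A)"
    using comm_groupE(1)[OF additive_functorD(1)[OF F A]] by blast
  then show "\<theta> A (x \<otimes>\<^bsub>On_obj F A\<^esub> y) = \<theta> A x \<otimes>\<^bsub>On_obj G A\<^esub> \<theta> A y"
    using A x y by (simp add: eq natural_transformationD[OF n])
qed (simp_all add: eq natural_transformationD[OF n] additive_functorD(4)[OF F])

text \<open>Additivity and naturality of \<eta> may be tested after the injective \<kappa>, where
  they become those of \<theta>. Lifts chosen point by point are thus automatically natural.\<close>

lemma natural_transformation_lift: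
  assumes F: "additive_functor C X F" and G: "additive_functor C X G"
    and n: "natural_transformation C X G H \<kappa>" "natural_transformation C X F H \<theta>"
    and inj: "\<And>A. A \<in> X \<Longrightarrow> inj_on (\<kappa> A) (carrier (On_obj G A))"
    and \<eta>: "\<And>A x. \<lbrakk>A \<in> X; x \<in> carrier (On_obj F A)\<rbrakk> \<Longrightarrow> \<eta> A x \<in> carrier (On_obj G A) \<and> \<kappa> A (\<eta> A x) = \<theta> A x"
  shows "natural_transformation C X F G \<eta>"
proof (rule natural_transformationI)
  fix A x y assume A: "A \<in> X" and x: "x \<in> carrier (On_obj F A)" and y: "y \<in> carrier (On_obj F A)"
  have xy: "x \<otimes>\<^bsub>On_obj F A\<^esub> y \<in> carrier (On_obj F A)"
    using comm_groupE(1)[OF additive_functorD(1)[OF F A] x y] .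
  have e: "\<eta> A x \<in> carrier (On_obj G A)" "\<eta> A y \<in> carrier (On_obj G A)" using \<eta> A x y by auto
  have "\<kappa> A (\<eta> A (x \<otimes>\<^bsub>On_obj F A\<^esub> y)) = \<kappa> A (\<eta> A x \<otimes>\<^bsub>On_obj G A\<^esub> \<eta> A y)"
    using \<eta>[OF A xy] \<eta>[OF A x] \<eta>[OF A y] natural_transformationD(3)[OF n(2) A x y]
      natural_transformationD(3)[OF n(1) A e] by simp
  then show "\<eta> A (x \<otimes>\<^bsub>On_obj F A\<^esub> y) = \<eta> A x \<otimes>\<^bsub>On_obj G A\<^esub> \<eta> A y"
    using inj[OF A] \<eta>[OF A xy] comm_groupE(1)[OF additive_functorD(1)[OF G A] e]
    by (auto dest: inj_onD)
next
  fix A B f x assume AB: "A \<in> X" "B \<in> X" and f: "f \<in> Hom C A B" and x: "x \<in> carrier (On_obj F B)"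
  note fx = additive_functorD(4)[OF F AB f x]
  have e: "\<eta> B x \<in> carrier (On_obj G B)" using \<eta> AB x by auto
  have "\<kappa> A (\<eta> A (On_arr F f x)) = \<kappa> A (On_arr G f (\<eta> B x))"
    using \<eta>[OF AB(1) fx] \<eta>[OF AB(2) x] natural_transformationD(4)[OF n(2) AB f x]
      natural_transformationD(4)[OF n(1) AB f e] by simp
  then show "\<eta> A (On_arr F f x) = On_arr G f (\<eta> B x)"
    using inj[OF AB(1)] \<eta>[OF AB(1) fx] additive_functorD(4)[OF G AB f e] by (auto dest: inj_onD)
qed (use \<eta> in blast)

text \<open>Dual to the lifting principle: the conditions on \<eta> may be tested on elements
  \<gamma> A x, since these exhaust \<open>G\<close>.\<close>

lemma natural_transformation_descend:
  assumes F: "additive_functor C X F" 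
    and n: "natural_transformation C X F G \<gamma>" "natural_transformation C X F H \<theta>"
    and surj: "\<And>A. A \<in> X \<Longrightarrow> \<gamma> A ` carrier (On_obj F A) = carrier (On_obj G A)"
    and \<eta>: "\<And>A x. \<lbrakk>A \<in> X; x \<in> carrier (On_obj F A)\<rbrakk> \<Longrightarrow> \<eta> A (\<gamma> A x) = \<theta> A x"
  shows "natural_transformation C X G H \<eta>"
proof (rule natural_transformationI)
  fix A x assume A: "A \<in> X" and x: "x \<in> carrier (On_obj G A)"
  then obtain x' where "x' \<in> carrier (On_obj F A)" "x = \<gamma> A x'" using surj[OF A] by blast
  then show "\<eta> A x \<in> carrier (On_obj H A)" using \<eta> A natural_transformationD(2)[OF n(2) A] by simp
next
  fix A x y assume A: "A \<in> X" and x: "x \<in> carrier (On_obj G A)" and y: "y \<in> carrier (On_obj G A)"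
  obtain x' where x': "x' \<in> carrier (On_obj F A)" "x = \<gamma> A x'" using surj[OF A] x by blast
  obtain y' where y': "y' \<in> carrier (On_obj F A)" "y = \<gamma> A y'" using surj[OF A] y by blast
  show "\<eta> A (x \<otimes>\<^bsub>On_obj G A\<^esub> y) = \<eta> A x \<otimes>\<^bsub>On_obj H A\<^esub> \<eta> A y"
    using \<eta>[OF A x'(1)] \<eta>[OF A y'(1)] \<eta>[OF A comm_groupE(1)[OF additive_functorD(1)[OF F A] x'(1) y'(1)]]
      natural_transformationD(3)[OF n(1) A x'(1) y'(1)] natural_transformationD(3)[OF n(2) A x'(1) y'(1)]
      x'(2) y'(2) by simp
next
  fix A B f x assume AB: "A \<in> X" "B \<in> X" and f: "f \<in> Hom C A B" and x: "x \<in> carrier (On_obj G B)"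
  obtain x' where x': "x' \<in> carrier (On_obj F B)" "x = \<gamma> B x'" using surj[OF AB(2)] x by blast
  show "\<eta> A (On_arr G f x) = On_arr H f (\<eta> B x)"
    using \<eta>[OF AB(2) x'(1)] \<eta>[OF AB(1) additive_functorD(4)[OF F AB f x'(1)]]
      natural_transformationD(4)[OF n(1) AB f x'(1)] natural_transformationD(4)[OF n(2) AB f x'(1)] 
      x'(2) by simp
qed

text \<open>Commutativity of the target groups makes the pointwise product of homomorphisms a
  homomorphism.\<close>

lemma natural_transformation_mult:
  assumes F: "additive_functor C X F" and G: "additive_functor C X G"
    and n: "natural_transformation C X F G \<eta>" "natural_transformation C X F G \<theta>"
  shows "natural_transformation C X F G (\<lambda>A x. \<eta> A x \<otimes>\<^bsub>On_obj G A\<^esub> \<theta> A x)"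
proof (rule natural_transformationI)
  fix A x y assume A: "A \<in> X" and x: "x \<in> carrier (On_obj F A)" and y: "y \<in> carrier (On_obj F A)"
  interpret G: comm_group "On_obj G A" by (rule additive_functorD(1)[OF G A])
  show "\<eta> A (x \<otimes>\<^bsub>On_obj F A\<^esub> y) \<otimes>\<^bsub>On_obj G A\<^esub> \<theta> A (x \<otimes>\<^bsub>On_obj F A\<^esub> y) =
     (\<eta> A x \<otimes>\<^bsub>On_obj G A\<^esub> \<theta> A x) \<otimes>\<^bsub>On_obj G A\<^esub> (\<eta> A y \<otimes>\<^bsub>On_obj G A\<^esub> \<theta> A y)"
    using A x y by (simp add: natural_transformationD[OF n(1)] natural_transformationD[OF n(2)] G.m_ac)
next
  fix A B f x assume AB: "A \<in> X" "B \<in> X" and f: "f \<in> Hom C A B" and x: "x \<in> carrier (On_obj F B)"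
  show "\<eta> A (On_arr F f x) \<otimes>\<^bsub>On_obj G A\<^esub> \<theta> A (On_arr F f x) = 
      On_arr G f (\<eta> B x \<otimes>\<^bsub>On_obj G B\<^esub> \<theta> B x)"
    using AB f x hom_mult[OF additive_functorD(3)[OF G AB f], of "\<eta> B x" "\<theta> B x"] 
    by (simp add: natural_transformationD[OF n(1)] natural_transformationD[OF n(2)])
next
  fix A x assume A: "A \<in> X" and x: "x \<in> carrier (On_obj F A)"
  show "\<eta> A x \<otimes>\<^bsub>On_obj G A\<^esub> \<theta> A x \<in> carrier (On_obj G A)"
    using comm_groupE(1)[OF additive_functorD(1)[OF G A]] A x
    by (simp add: natural_transformationD[OF n(1)] natural_transformationD[OF n(2)])
qed

lemma natural_transformation_trivial:
  assumes F: "additive_functor C X F" and G: "additive_functor C X G"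
  shows "natural_transformation C X F G (\<lambda>A x. \<one>\<^bsub>On_obj G A\<^esub>)"
proof (rule natural_transformationI)
  fix A B f x assume AB: "A \<in> X" "B \<in> X" and f: "f \<in> Hom C A B" 
  show "\<one>\<^bsub>On_obj G A\<^esub> = On_arr G f \<one>\<^bsub>On_obj G B\<^esub>"
    using hom_one[OF additive_functorD(3)[OF G AB f]] additive_functorD(2)[OF G] AB by simp
qed (simp_all add: comm_groupE[OF additive_functorD(1)[OF G]])

lemma natural_transformation_inv:
  assumes F: "additive_functor C X F" and G: "additive_functor C X G"
    and n: "natural_transformation C X F G \<eta>"
  shows "natural_transformation C X F G (\<lambda>A x. inv\<^bsub>On_obj G A\<^esub> (\<eta> A x))"
proof (rule natural_transformationI)
  fix A x assume A: "A \<in> X" and x: "x \<in> carrier (On_obj F A)"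
  interpret G: comm_group "On_obj G A" by (rule additive_functorD(1)[OF G A])
  show "inv\<^bsub>On_obj G A\<^esub> (\<eta> A x) \<in> carrier (On_obj G A)"
    using A x by (simp add: natural_transformationD[OF n])
next
  fix A x y assume A: "A \<in> X" and x: "x \<in> carrier (On_obj F A)" and y: "y \<in> carrier (On_obj F A)"
  interpret G: comm_group "On_obj G A" by (rule additive_functorD(1)[OF G A])
  show "inv\<^bsub>On_obj G A\<^esub> (\<eta> A (x \<otimes>\<^bsub>On_obj F A\<^esub> y)) = 
      inv\<^bsub>On_obj G A\<^esub> (\<eta> A x) \<otimes>\<^bsub>On_obj G A\<^esub> inv\<^bsub>On_obj G A\<^esub> (\<eta> A y)"
    using A x y by (simp add: natural_transformationD[OF n] G.inv_mult)
next
  fix A B f x assume AB: "A \<in> X" "B \<in> X" and f: "f \<in> Hom C A B" and x: "x \<in> carrier (On_obj F B)"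
  interpret h: group_hom "On_obj G B" "On_obj G A" "On_arr G f"
    using additive_functorD(2)[OF G] additive_functorD(3)[OF G AB f] AB
    by (simp add: group_hom_def group_hom_axioms_def)
  show "inv\<^bsub>On_obj G A\<^esub> (\<eta> A (On_arr F f x)) = On_arr G f (inv\<^bsub>On_obj G B\<^esub> (\<eta> B x))"
    using AB f x by (simp add: natural_transformationD[OF n])
qed

text \<open>Normal form for the arrows of \<open>mod_category\<close>. Any family may be inserted,
  since cutting it down turns equality of arrows into agreement on the carriers over
  \<open>X\<close>.\<close>

definition trans_arrow ::
  "'o set \<Rightarrow> ('o, 'm, 'g) ab_functor \<Rightarrow> ('o, 'm, 'g) ab_functor \<Rightarrow> ('o \<Rightarrow> 'g \<Rightarrow> 'g)
     \<Rightarrow> ('o, 'm, 'g) ab_transformation" where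
  "trans_arrow X F G \<eta> = (F, G, restrict_family X F \<eta>)"

lemma trans_arrow_eq_iff:
  "trans_arrow X F G \<eta> = trans_arrow X F G \<theta> \<longleftrightarrow> (\<forall>A\<in>X. \<forall>x\<in>carrier (On_obj F A). \<eta> A x = \<theta> A x)"
proof
  assume "trans_arrow X F G \<eta> = trans_arrow X F G \<theta>"
  then have "restrict_family X F \<eta> = restrict_family X F \<theta>" by (simp add: trans_arrow_def)
  then have *: "restrict_family X F \<eta> A x = restrict_family X F \<theta> A x" for A x by simp
  show "\<forall>A\<in>X. \<forall>x\<in>carrier (On_obj F A). \<eta> A x = \<theta> A x" 
  proof (intro ballI)
    fix A x assume "A \<in> X" "x \<in> carrier (On_obj F A)"
    then show "\<eta> A x = \<theta> A x" using *[of A x] by (simp add: restrict_family_def)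
  qed
next
  assume "\<forall>A\<in>X. \<forall>x\<in>carrier (On_obj F A). \<eta> A x = \<theta> A x"
  then show "trans_arrow X F G \<eta> = trans_arrow X F G \<theta>"
    by (simp add: trans_arrow_def restrict_family_def restrict_def fun_eq_iff)
qed

lemma restrict_family_apply: "\<lbrakk>A \<in> X; x \<in> carrier (On_obj F A)\<rbrakk> \<Longrightarrow> restrict_family X F \<eta> A x = \<eta> A x"
  by (simp add: restrict_family_def)

lemma restrict_family_idem: "restrict_family X F (restrict_family X F \<eta>) = restrict_family X F \<eta>"
  by (simp add: restrict_family_def restrict_def fun_eq_iff)

lemma coherent_additive: "coherent C X F \<Longrightarrow> additive_functor C X F"
  unfolding coherent_def by blast

lemma Hom_mod_category:
  "\<phi> \<in> Hom (mod_category C X) F G \<longleftrightarrow> coherent C X F \<and> coherent C X G \<and> 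
     (\<exists>\<eta>. natural_transformation C X F G \<eta> \<and> \<phi> = trans_arrow X F G \<eta>)"
proof
  assume "\<phi> \<in> Hom (mod_category C X) F G"
  then show "coherent C X F \<and> coherent C X G \<and> 
     (\<exists>\<eta>. natural_transformation C X F G \<eta> \<and> \<phi> = trans_arrow X F G \<eta>)"
    by (auto simp: Hom_def mod_category_def trans_arrow_def)
next
  assume *: "coherent C X F \<and> coherent C X G \<and> 
     (\<exists>\<eta>. natural_transformation C X F G \<eta> \<and> \<phi> = trans_arrow X F G \<eta>)"
  then obtain \<eta> where \<eta>: "natural_transformation C X F G \<eta>" "\<phi> = trans_arrow X F G \<eta>" by blast
  have "natural_transformation C X F G (restrict_family X F \<eta>)"
  proof (rule natural_transformation_cong[OF coherent_additive \<eta>(1)])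
    show "coherent C X F" using * by (rule conjunct1)
  qed (rule restrict_family_apply)
  then show "\<phi> \<in> Hom (mod_category C X) F G"
    using * \<eta> by (simp add: Hom_def mod_category_def trans_arrow_def restrict_family_idem)
qed

lemma Hom_mod_categoryI:
  "\<lbrakk>coherent C X F; coherent C X G; natural_transformation C X F G \<eta>\<rbrakk> 
    \<Longrightarrow> trans_arrow X F G \<eta> \<in> Hom (mod_category C X) F G"
  unfolding Hom_mod_category by blast

lemma Hom_mod_categoryE:
  assumes "\<phi> \<in> Hom (mod_category C X) F G"
  obtains \<eta> where "coherent C X F" "coherent C X G" "natural_transformation C X F G \<eta>" 
    "\<phi> = trans_arrow X F G \<eta>"
  using assms unfolding Hom_mod_category by blast

text \<open>The values of \<eta> have to lie in the carriers on which the restriction of \<theta>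
  still agrees with \<theta>; naturality of \<eta> ensures this.\<close>

lemma Comp_trans_arrow:
  assumes "natural_transformation C X F G \<eta>"
  shows "trans_arrow X G H \<theta> \<cdot>\<^bsub>mod_category C X\<^esub> trans_arrow X F G \<eta> 
    = trans_arrow X F H (\<lambda>A x. \<theta> A (\<eta> A x))"
proof -
  have "restrict_family X F (\<lambda>A x. restrict_family X G \<theta> A (restrict_family X F \<eta> A x)) 
      = restrict_family X F (\<lambda>A x. \<theta> A (\<eta> A x))"
    by (simp add: restrict_family_def restrict_def fun_eq_iff natural_transformationD[OF assms])
  then show ?thesis by (simp add: mod_category_def trans_arrow_def)
qed

lemma Add_trans_arrow:
  "Add (mod_category C X) (trans_arrow X F G \<eta>) (trans_arrow X F G \<theta>) 
    = trans_arrow X F G (\<lambda>A x. \<eta> A x \<otimes>\<^bsub>On_obj G A\<^esub> \<theta> A x)"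
  by (simp add: mod_category_def trans_arrow_def restrict_family_def restrict_def fun_eq_iff)

lemma Zero_mod_category: "Zero (mod_category C X) F G = trans_arrow X F G (\<lambda>A x. \<one>\<^bsub>On_obj G A\<^esub>)"
  by (simp add: mod_category_def trans_arrow_def)

lemma Ident_mod_category: "Ident (mod_category C X) F = trans_arrow X F F (\<lambda>A x. x)"
  by (simp add: mod_category_def trans_arrow_def)

lemma Obj_mod_category: "F \<in> Obj (mod_category C X) \<longleftrightarrow> coherent C X F"
  by (simp add: mod_category_def)

lemma category_mod_category: 
  fixes C :: "('o, 'm, 'z) preadd_cat_scheme" 
  shows "category (mod_category C X :: (('o, 'm, 'g) ab_functor, ('o, 'm, 'g) ab_transformation) preadd_cat)"
proof
  fix \<phi> :: "('o, 'm, 'g) ab_transformation" assume "\<phi> \<in> Arr (mod_category C X)"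
  then show "Dom (mod_category C X) \<phi> \<in> Obj (mod_category C X)" 
    "Cod (mod_category C X) \<phi> \<in> Obj (mod_category C X)"
    by (auto simp: mod_category_def)
next
  fix F :: "('o, 'm, 'g) ab_functor" assume "F \<in> Obj (mod_category C X)"
  then show "Ident (mod_category C X) F \<in> Hom (mod_category C X) F F"
    unfolding Ident_mod_category Obj_mod_category 
    by (intro Hom_mod_categoryI natural_transformation_ident)
next
  fix \<phi> \<psi> :: "('o, 'm, 'g) ab_transformation" and F G H
  assume \<phi>: "\<phi> \<in> Hom (mod_category C X) F G" and \<psi>: "\<psi> \<in> Hom (mod_category C X) G H"
  show "\<psi> \<cdot>\<^bsub>mod_category C X\<^esub> \<phi> \<in> Hom (mod_category C X) F H"
  proof -
    obtain \<eta> where \<eta>: "coherent C X F" "natural_transformation C X F G \<eta>" "\<phi> = trans_arrow X F G \<eta>" 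
      using \<phi> by (elim Hom_mod_categoryE)
    obtain \<theta> where \<theta>: "coherent C X H" "natural_transformation C X G H \<theta>" "\<psi> = trans_arrow X G H \<theta>" 
      using \<psi> by (elim Hom_mod_categoryE)
    show ?thesis unfolding \<eta>(3) \<theta>(3) Comp_trans_arrow[OF \<eta>(2)]
      by (rule Hom_mod_categoryI[OF \<eta>(1) \<theta>(1) natural_transformation_comp[OF \<eta>(2) \<theta>(2)]])
  qed
next
  fix \<phi> :: "('o, 'm, 'g) ab_transformation" and F G
  assume "\<phi> \<in> Hom (mod_category C X) F G"
  then obtain \<eta> where \<eta>: "natural_transformation C X F G \<eta>" "\<phi> = trans_arrow X F G \<eta>"
    by (elim Hom_mod_categoryE)
  show "\<phi> \<cdot>\<^bsub>mod_category C X\<^esub> Ident (mod_category C X) F = \<phi>"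
    unfolding \<eta>(2) Ident_mod_category Comp_trans_arrow[OF natural_transformation_ident] ..
  show "Ident (mod_category C X) G \<cdot>\<^bsub>mod_category C X\<^esub> \<phi> = \<phi>"
    unfolding \<eta>(2) Ident_mod_category Comp_trans_arrow[OF \<eta>(1)] ..
next
  fix \<phi> \<psi> \<chi> :: "('o, 'm, 'g) ab_transformation" and F G H K
  assume "\<phi> \<in> Hom (mod_category C X) F G" "\<psi> \<in> Hom (mod_category C X) G H" 
    "\<chi> \<in> Hom (mod_category C X) H K"
  then obtain \<eta> \<theta> \<zeta> where n: "natural_transformation C X F G \<eta>" "natural_transformation C X G H \<theta>"
    and e: "\<phi> = trans_arrow X F G \<eta>" "\<psi> = trans_arrow X G H \<theta>" "\<chi> = trans_arrow X H K \<zeta>"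
    by (elim Hom_mod_categoryE)
  show "\<chi> \<cdot>\<^bsub>mod_category C X\<^esub> (\<psi> \<cdot>\<^bsub>mod_category C X\<^esub> \<phi>) = (\<chi> \<cdot>\<^bsub>mod_category C X\<^esub> \<psi>) \<cdot>\<^bsub>mod_category C X\<^esub> \<phi>"
    unfolding e Comp_trans_arrow[OF n(1)] Comp_trans_arrow[OF n(2)] 
      Comp_trans_arrow[OF natural_transformation_comp[OF n]] ..
qed

lemma preadditive_mod_category: 
  fixes C :: "('o, 'm, 'z) preadd_cat_scheme" 
  shows "preadditive_category (mod_category C X :: (('o, 'm, 'g) ab_functor, ('o, 'm, 'g) ab_transformation) preadd_cat)"
proof (rule preadditive_category.intro[OF category_mod_category preadditive_category_axioms.intro])
  let ?M = "mod_category C X :: (('o, 'm, 'g) ab_functor, ('o, 'm, 'g) ab_transformation) preadd_cat"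
  fix F G :: "('o, 'm, 'g) ab_functor" assume "F \<in> Obj ?M" "G \<in> Obj ?M"
  then have FG: "coherent C X F" "coherent C X G" by (auto simp: Obj_mod_category)
  note a = coherent_additive[OF FG(1)] coherent_additive[OF FG(2)]
  note G = comm_groupE[OF additive_functorD(1)[OF a(2)]]
  show "comm_group (hom_group ?M F G)"
  proof (rule comm_groupI, simp_all add: hom_group_def)
    show "Zero ?M F G \<in> Hom ?M F G"
      unfolding Zero_mod_category by (intro Hom_mod_categoryI FG natural_transformation_trivial a)
  next
    fix \<phi> \<psi> assume "\<phi> \<in> Hom ?M F G" "\<psi> \<in> Hom ?M F G"
    then obtain \<eta> \<theta> where n: "natural_transformation C X F G \<eta>" "natural_transformation C X F G \<theta>"
      and e: "\<phi> = trans_arrow X F G \<eta>" "\<psi> = trans_arrow X F G \<theta>"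
      by (elim Hom_mod_categoryE)
    show "Add ?M \<phi> \<psi> \<in> Hom ?M F G"
      unfolding e Add_trans_arrow by (intro Hom_mod_categoryI FG natural_transformation_mult a n)
    show "Add ?M \<phi> \<psi> = Add ?M \<psi> \<phi>"
      unfolding e Add_trans_arrow trans_arrow_eq_iff
      using G(4) natural_transformationD(2)[OF n(1)] natural_transformationD(2)[OF n(2)] by blast
  next
    fix \<phi> \<psi> \<chi> assume "\<phi> \<in> Hom ?M F G" "\<psi> \<in> Hom ?M F G" "\<chi> \<in> Hom ?M F G"
    then obtain \<eta> \<theta> \<zeta> where n: "natural_transformation C X F G \<eta>" "natural_transformation C X F G \<theta>"
       "natural_transformation C X F G \<zeta>"
      and e: "\<phi> = trans_arrow X F G \<eta>" "\<psi> = trans_arrow X F G \<theta>" "\<chi> = trans_arrow X F G \<zeta>"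
      by (elim Hom_mod_categoryE)
    show "Add ?M (Add ?M \<phi> \<psi>) \<chi> = Add ?M \<phi> (Add ?M \<psi> \<chi>)"
      unfolding e Add_trans_arrow trans_arrow_eq_iff
      using G(3) natural_transformationD(2)[OF n(1)] natural_transformationD(2)[OF n(2)] 
        natural_transformationD(2)[OF n(3)] by blast
  next
    fix \<phi> assume "\<phi> \<in> Hom ?M F G"
    then obtain \<eta> where n: "natural_transformation C X F G \<eta>" and e: "\<phi> = trans_arrow X F G \<eta>"
      by (elim Hom_mod_categoryE)
    show "Add ?M (Zero ?M F G) \<phi> = \<phi>"
      unfolding e Zero_mod_category Add_trans_arrow trans_arrow_eq_iff
      using G(5) natural_transformationD(2)[OF n(1)] by blast
    show "\<exists>\<psi>\<in>Hom ?M F G. Add ?M \<psi> \<phi> = Zero ?M F G"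
    proof (rule bexI)
      show "trans_arrow X F G (\<lambda>A x. inv\<^bsub>On_obj G A\<^esub> (\<eta> A x)) \<in> Hom ?M F G"
        by (intro Hom_mod_categoryI FG natural_transformation_inv a n)
      show "Add ?M (trans_arrow X F G (\<lambda>A x. inv\<^bsub>On_obj G A\<^esub> (\<eta> A x))) \<phi> = Zero ?M F G"
        unfolding e Zero_mod_category Add_trans_arrow trans_arrow_eq_iff
        using group.l_inv[OF additive_functorD(2)[OF a(2)]] natural_transformationD(2)[OF n(1)] by blast
    qed
  qed
next
  let ?M = "mod_category C X :: (('o, 'm, 'g) ab_functor, ('o, 'm, 'g) ab_transformation) preadd_cat"
  fix \<phi> \<psi> \<chi> F G H assume "\<phi> \<in> Hom ?M F G" "\<psi> \<in> Hom ?M F G" "\<chi> \<in> Hom ?M G H"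
  then obtain \<eta> \<theta> \<zeta> where n: "natural_transformation C X F G \<eta>" "natural_transformation C X F G \<theta>"
       "natural_transformation C X G H \<zeta>"
      and e: "\<phi> = trans_arrow X F G \<eta>" "\<psi> = trans_arrow X F G \<theta>" "\<chi> = trans_arrow X G H \<zeta>"
      and FG: "coherent C X F" "coherent C X G"
    by (elim Hom_mod_categoryE)
  note a = coherent_additive[OF FG(1)] coherent_additive[OF FG(2)]
  show "\<chi> \<cdot>\<^bsub>?M\<^esub> Add ?M \<phi> \<psi> = Add ?M (\<chi> \<cdot>\<^bsub>?M\<^esub> \<phi>) (\<chi> \<cdot>\<^bsub>?M\<^esub> \<psi>)"
    unfolding e Add_trans_arrow Comp_trans_arrow[OF n(1)] Comp_trans_arrow[OF n(2)]
      Comp_trans_arrow[OF natural_transformation_mult[OF a n(1,2)]] trans_arrow_eq_iff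
    using natural_transformationD(3)[OF n(3)] natural_transformationD(2)[OF n(1)] 
      natural_transformationD(2)[OF n(2)] by blast
next
  let ?M = "mod_category C X :: (('o, 'm, 'g) ab_functor, ('o, 'm, 'g) ab_transformation) preadd_cat"
  fix \<phi> \<psi> \<chi> F G H assume "\<phi> \<in> Hom ?M F G" "\<psi> \<in> Hom ?M G H" "\<chi> \<in> Hom ?M G H"
  then obtain \<eta> \<theta> \<zeta> where n: "natural_transformation C X F G \<eta>" "natural_transformation C X G H \<theta>"
       "natural_transformation C X G H \<zeta>"
      and e: "\<phi> = trans_arrow X F G \<eta>" "\<psi> = trans_arrow X G H \<theta>" "\<chi> = trans_arrow X G H \<zeta>"
    by (elim Hom_mod_categoryE)
  show "Add ?M \<psi> \<chi> \<cdot>\<^bsub>?M\<^esub> \<phi> = Add ?M (\<psi> \<cdot>\<^bsub>?M\<^esub> \<phi>) (\<chi> \<cdot>\<^bsub>?M\<^esub> \<phi>)"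
    unfolding e Add_trans_arrow Comp_trans_arrow[OF n(1)] trans_arrow_eq_iff by blast
qed

lemma group_hom_of_natural_transformation:
  assumes "additive_functor C X F" "additive_functor C X G" "natural_transformation C X F G \<eta>" "A \<in> X"
  shows "group_hom (On_obj F A) (On_obj G A) (\<eta> A)"
  using additive_functorD(2)[OF assms(1,4)] additive_functorD(2)[OF assms(2,4)] 
    natural_transformationD(1)[OF assms(3,4)]
  by (simp add: group_hom_def group_hom_axioms_def)

text \<open>Exactness is detected pointwise. A transformation killed by \<eta> takes values in the
  image of the injective \<kappa>, so its pointwise inverse images form a transformation by the
  lifting principle, and injectivity makes it unique.\<close>

lemma is_kernel_mod_category:
  assumes c: "coherent C X K" "coherent C X F" "coherent C X G"
    and n: "natural_transformation C X K F \<kappa>" "natural_transformation C X F G \<eta>"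
    and inj: "\<And>A. A \<in> X \<Longrightarrow> inj_on (\<kappa> A) (carrier (On_obj K A))"
    and im: "\<And>A. A \<in> X \<Longrightarrow> \<kappa> A ` carrier (On_obj K A) = kernel (On_obj F A) (On_obj G A) (\<eta> A)"
  shows "is_kernel (mod_category C X) (trans_arrow X K F \<kappa>) (trans_arrow X F G \<eta>)"
proof -
  let ?M = "mod_category C X" and ?k = "trans_arrow X K F \<kappa>" and ?e = "trans_arrow X F G \<eta>"
  interpret M: preadditive_category ?M by (rule preadditive_mod_category)
  note a = c[THEN coherent_additive]
  have k: "?k \<in> Hom ?M K F" and e: "?e \<in> Hom ?M F G" by (intro Hom_mod_categoryI c n)+
  note dc = Hom_DomD[OF k] Hom_CodD[OF k] Hom_DomD[OF e] Hom_CodD[OF e]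
  have z: "?e \<cdot>\<^bsub>?M\<^esub> ?k = Zero ?M K G"
    unfolding Comp_trans_arrow[OF n(1)] Zero_mod_category trans_arrow_eq_iff
    using im unfolding kernel_def by blast
  have *: "\<exists>!h. h \<in> Hom ?M H K \<and> ?k \<cdot>\<^bsub>?M\<^esub> h = \<phi>" if \<phi>: "\<phi> \<in> Hom ?M H F" "?e \<cdot>\<^bsub>?M\<^esub> \<phi> = Zero ?M H G" for H \<phi>
  proof -
    obtain \<theta> where H: "coherent C X H" and t: "natural_transformation C X H F \<theta>" "\<phi> = trans_arrow X H F \<theta>"
      using \<phi>(1) by (elim Hom_mod_categoryE)
    define \<xi> where "\<xi> A x = inv_into (carrier (On_obj K A)) (\<kappa> A) (\<theta> A x)" for A x
    have "\<theta> A x \<in> \<kappa> A ` carrier (On_obj K A)" if "A \<in> X" "x \<in> carrier (On_obj H A)" for A x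
    proof -
      have "\<eta> A (\<theta> A x) = \<one>\<^bsub>On_obj G A\<^esub>"
        using \<phi>(2) that unfolding t(2) Comp_trans_arrow[OF t(1)] Zero_mod_category trans_arrow_eq_iff by blast
      then show ?thesis using im natural_transformationD(2)[OF t(1)] that by (auto simp: kernel_def)
    qed
    then have \<xi>: "\<xi> A x \<in> carrier (On_obj K A) \<and> \<kappa> A (\<xi> A x) = \<theta> A x" 
      if "A \<in> X" "x \<in> carrier (On_obj H A)" for A x
      using that unfolding \<xi>_def by (simp add: inv_into_into f_inv_into_f)
    have n\<xi>: "natural_transformation C X H K \<xi>"
      using natural_transformation_lift[OF coherent_additive[OF H] a(1) n(1) t(1) inj \<xi>] by blast
    show ?thesis
    proof (rule ex1I[of _ "trans_arrow X H K \<xi>"], intro conjI)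
      show "trans_arrow X H K \<xi> \<in> Hom ?M H K" by (intro Hom_mod_categoryI H c(1) n\<xi>)
      show "?k \<cdot>\<^bsub>?M\<^esub> trans_arrow X H K \<xi> = \<phi>"
        unfolding t(2) Comp_trans_arrow[OF n\<xi>] trans_arrow_eq_iff using \<xi> by blast
      fix h assume h: "h \<in> Hom ?M H K \<and> ?k \<cdot>\<^bsub>?M\<^esub> h = \<phi>"
      then obtain \<zeta> where s: "natural_transformation C X H K \<zeta>" "h = trans_arrow X H K \<zeta>"
        by (elim conjE Hom_mod_categoryE)
      have e: "\<kappa> A (\<zeta> A x) = \<kappa> A (\<xi> A x)" if "A \<in> X" "x \<in> carrier (On_obj H A)" for A x
        using h \<xi> that unfolding s(2) t(2) Comp_trans_arrow[OF s(1)] trans_arrow_eq_iff by simp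
      show "h = trans_arrow X H K \<xi>"
        unfolding s(2) trans_arrow_eq_iff
        using e \<xi> natural_transformationD(2)[OF s(1)] inj by (meson inj_onD)
    qed
  qed
  then show ?thesis
    unfolding is_kernel_def dc using k[unfolded Hom_iff] e[unfolded Hom_iff]
    by (intro conjI ballI impI z *) blast+
qed

text \<open>The induced map is computed on an arbitrary \<gamma>-preimage. Two preimages differ by
  an element of the kernel of \<gamma>, which is the image of \<eta>, and \<theta> kills that image.
  So the value is well defined and the descent principle gives naturality.\<close>

lemma is_cokernel_mod_category:
  assumes c: "coherent C X F" "coherent C X G" "coherent C X E"
    and n: "natural_transformation C X F G \<eta>" "natural_transformation C X G E \<gamma>"
    and surj: "\<And>A. A \<in> X \<Longrightarrow> \<gamma> A ` carrier (On_obj G A) = carrier (On_obj E A)"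
    and im: "\<And>A. A \<in> X \<Longrightarrow> \<eta> A ` carrier (On_obj F A) = kernel (On_obj G A) (On_obj E A) (\<gamma> A)"
  shows "is_cokernel (mod_category C X) (trans_arrow X G E \<gamma>) (trans_arrow X F G \<eta>)"
proof -
  let ?M = "mod_category C X" and ?c = "trans_arrow X G E \<gamma>" and ?e = "trans_arrow X F G \<eta>"
  interpret M: preadditive_category ?M by (rule preadditive_mod_category)
  note a = c[THEN coherent_additive]
  have k: "?c \<in> Hom ?M G E" and e: "?e \<in> Hom ?M F G" by (intro Hom_mod_categoryI c n)+
  note dc = Hom_DomD[OF k] Hom_CodD[OF k] Hom_DomD[OF e] Hom_CodD[OF e]
  have z: "?c \<cdot>\<^bsub>?M\<^esub> ?e = Zero ?M F E"
    unfolding Comp_trans_arrow[OF n(1)] Zero_mod_category trans_arrow_eq_iff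
    using im unfolding kernel_def by blast
  have *: "\<exists>!h. h \<in> Hom ?M E H \<and> h \<cdot>\<^bsub>?M\<^esub> ?c = \<phi>" if \<phi>: "\<phi> \<in> Hom ?M G H" "\<phi> \<cdot>\<^bsub>?M\<^esub> ?e = Zero ?M F H" for H \<phi>
  proof -
    obtain \<theta> where H: "coherent C X H" and t: "natural_transformation C X G H \<theta>" "\<phi> = trans_arrow X G H \<theta>"
      using \<phi>(1) by (elim Hom_mod_categoryE)
    note aH = coherent_additive[OF H]
    have t1: "\<theta> A (\<eta> A x) = \<one>\<^bsub>On_obj H A\<^esub>" if "A \<in> X" "x \<in> carrier (On_obj F A)" for A x
      using \<phi>(2) that unfolding t(2) Comp_trans_arrow[OF n(1)] Zero_mod_category trans_arrow_eq_iff by blast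
    define \<xi> where "\<xi> A y = \<theta> A (inv_into (carrier (On_obj G A)) (\<gamma> A) y)" for A y
    have \<xi>: "\<xi> A (\<gamma> A x) = \<theta> A x" if A: "A \<in> X" and x: "x \<in> carrier (On_obj G A)" for A x
    proof -
      define x' where "x' = inv_into (carrier (On_obj G A)) (\<gamma> A) (\<gamma> A x)"
      have x': "x' \<in> carrier (On_obj G A)" "\<gamma> A x' = \<gamma> A x"
        using x unfolding x'_def by (simp_all add: inv_into_into f_inv_into_f)
      interpret g: group_hom "On_obj G A" "On_obj E A" "\<gamma> A"
        by (rule group_hom_of_natural_transformation[OF a(2,3) n(2) A])
      interpret t: group_hom "On_obj G A" "On_obj H A" "\<theta> A"
        by (rule group_hom_of_natural_transformation[OF a(2) aH t(1) A])
      let ?d = "x' \<otimes>\<^bsub>On_obj G A\<^esub> inv\<^bsub>On_obj G A\<^esub> x"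
      have "?d \<in> kernel (On_obj G A) (On_obj E A) (\<gamma> A)"
        using x x' by (simp add: kernel_def)
      then have "\<theta> A ?d = \<one>\<^bsub>On_obj H A\<^esub>" using im[OF A] t1[OF A] by force
      then have "\<theta> A x' \<otimes>\<^bsub>On_obj H A\<^esub> inv\<^bsub>On_obj H A\<^esub> (\<theta> A x) = \<one>\<^bsub>On_obj H A\<^esub>"
        using x x' by simp
      then have "\<theta> A x' = \<theta> A x" 
        using x x' t.H.inv_solve_right'[of "\<theta> A x'" "\<one>\<^bsub>On_obj H A\<^esub>" "\<theta> A x"] t.H.inv_equality by (metis t.hom_closed t.H.inv_closed t.H.inv_inv)
      then show ?thesis by (simp add: \<xi>_def x'_def)
    qed
    have n\<xi>: "natural_transformation C X E H \<xi>"
      using natural_transformation_descend[OF a(2) n(2) t(1) surj \<xi>] by blast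
    show ?thesis
    proof (rule ex1I[of _ "trans_arrow X E H \<xi>"], intro conjI)
      show "trans_arrow X E H \<xi> \<in> Hom ?M E H" by (intro Hom_mod_categoryI H c n\<xi>)
      show "trans_arrow X E H \<xi> \<cdot>\<^bsub>?M\<^esub> ?c = \<phi>"
        unfolding t(2) Comp_trans_arrow[OF n(2)] trans_arrow_eq_iff using \<xi> by blast
      fix h assume h: "h \<in> Hom ?M E H \<and> h \<cdot>\<^bsub>?M\<^esub> ?c = \<phi>"
      then obtain \<zeta> where s: "natural_transformation C X E H \<zeta>" "h = trans_arrow X E H \<zeta>"
        by (elim conjE Hom_mod_categoryE)
      have e: "\<zeta> A (\<gamma> A x) = \<xi> A (\<gamma> A x)" if "A \<in> X" "x \<in> carrier (On_obj G A)" for A x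
        using h \<xi> that unfolding s(2) t(2) Comp_trans_arrow[OF n(2)] trans_arrow_eq_iff by simp
      show "h = trans_arrow X E H \<xi>"
        unfolding s(2) trans_arrow_eq_iff
      proof (intro ballI)
        fix A x assume A: "A \<in> X" and "x \<in> carrier (On_obj E A)"
        then obtain y where "y \<in> carrier (On_obj G A)" "x = \<gamma> A y" using surj[OF A] by blast
        then show "\<zeta> A x = \<xi> A x" using e A by simp
      qed
    qed
  qed
  then show ?thesis
    unfolding is_cokernel_def dc using k[unfolded Hom_iff] e[unfolded Hom_iff]
    by (intro conjI ballI impI z *) blast+
qed

section \<open>Realizing coherent functors\<close>

lemma On_obj_representable [simp]: "On_obj (representable C A) Y = hom_group C Y A"
  and On_arr_representable [simp]: "On_arr (representable C A) f g = g \<cdot>\<^bsub>C\<^esub> f"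
  and carrier_hom_group [simp]: "carrier (hom_group C A B) = Hom C A B"
  and mult_hom_group [simp]: "mult (hom_group C A B) = Add C"
  and one_hom_group [simp]: "one (hom_group C A B) = Zero C A B"
  by (simp_all add: representable_def hom_group_def)

text \<open>\<open>F\<close> is a copy of \<open>H A\<close> with elements in \<open>'g\<close>, and
  \<rho> is the bijection from \<open>H A\<close> to it. The copy is needed because objects of
  \<open>mod_category\<close> take values in \<open>'g\<close>, not in the type of arrows.\<close>

definition realizes ::
  "('o, 'm, 'z) preadd_cat_scheme \<Rightarrow> 'o set \<Rightarrow> 'o \<Rightarrow> ('o, 'm, 'g) ab_functor \<Rightarrow> ('o \<Rightarrow> 'm \<Rightarrow> 'g) \<Rightarrow> bool" where
  "realizes C X A F \<rho> \<longleftrightarrow> natural_transformation C X (representable C A) F \<rho> \<and>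
     (\<forall>Y\<in>X. bij_betw (\<rho> Y) (Hom C Y A) (carrier (On_obj F Y)))"

text \<open>This is \<open>H f\<close>, composition with \<open>f\<close>, transported along the
  bijections \<rho> and \<sigma>.\<close>

definition realized_arrow ::
  "('o, 'm, 'z) preadd_cat_scheme \<Rightarrow> 'o set \<Rightarrow> 'o \<Rightarrow> ('o, 'm, 'g) ab_functor \<Rightarrow> ('o \<Rightarrow> 'm \<Rightarrow> 'g) 
     \<Rightarrow> ('o, 'm, 'g) ab_functor \<Rightarrow> ('o \<Rightarrow> 'm \<Rightarrow> 'g) \<Rightarrow> 'm \<Rightarrow> ('o, 'm, 'g) ab_transformation" where
  "realized_arrow C X A F \<rho> G \<sigma> f = 
     trans_arrow X F G (\<lambda>Y z. \<sigma> Y (f \<cdot>\<^bsub>C\<^esub> inv_into (Hom C Y A) (\<rho> Y) z))"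

lemma realizes_surj:
  assumes "realizes C X A F \<rho>" "Y \<in> X" "z \<in> carrier (On_obj F Y)"
  obtains x where "x \<in> Hom C Y A" "z = \<rho> Y x"
  using assms unfolding realizes_def bij_betw_def by blast

lemma realizes_inj:
  "\<lbrakk>realizes C X A F \<rho>; Y \<in> X; x \<in> Hom C Y A; x' \<in> Hom C Y A; \<rho> Y x = \<rho> Y x'\<rbrakk> \<Longrightarrow> x = x'"
  unfolding realizes_def bij_betw_def by (meson inj_onD)

lemma realizes_closed:
  "\<lbrakk>realizes C X A F \<rho>; Y \<in> X; x \<in> Hom C Y A\<rbrakk> \<Longrightarrow> \<rho> Y x \<in> carrier (On_obj F Y)"
  unfolding realizes_def bij_betw_def by blast

lemma realizes_inv:
  "\<lbrakk>realizes C X A F \<rho>; Y \<in> X; x \<in> Hom C Y A\<rbrakk> \<Longrightarrow> inv_into (Hom C Y A) (\<rho> Y) (\<rho> Y x) = x"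
  unfolding realizes_def bij_betw_def by (simp add: inv_into_f_f)

lemma realizes_Add:
  "\<lbrakk>realizes C X A F \<rho>; Y \<in> X; x \<in> Hom C Y A; x' \<in> Hom C Y A\<rbrakk> 
    \<Longrightarrow> \<rho> Y (Add C x x') = \<rho> Y x \<otimes>\<^bsub>On_obj F Y\<^esub> \<rho> Y x'"
  unfolding realizes_def using natural_transformationD(3)[of C X "representable C A" F \<rho>] by simp

lemma trans_arrow_realized_eq_iff:
  assumes "realizes C X A F \<rho>"
  shows "trans_arrow X F G \<eta> = trans_arrow X F G \<theta> \<longleftrightarrow> (\<forall>Y\<in>X. \<forall>x\<in>Hom C Y A. \<eta> Y (\<rho> Y x) = \<theta> Y (\<rho> Y x))"
  unfolding trans_arrow_eq_iff using realizes_closed[OF assms] realizes_surj[OF assms] by metis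

section \<open>The restricted Yoneda functor on realized functors, and presentations\<close>

context weak_cokernel_category
begin

lemma X_Obj': "Y \<in> X \<Longrightarrow> Y \<in> Obj C" using X_Obj by blast

lemma additive_representable:
  assumes A: "A \<in> Obj C"
  shows "additive_functor C X (representable C A)"
  unfolding additive_functor_def
proof (intro conjI ballI)
  fix Y assume "Y \<in> X"
  then show "comm_group (On_obj (representable C A) Y)" using hom_comm_group A X_Obj' by simp
next
  fix Y Z f assume "f \<in> Hom C Y Z"
  then show "On_arr (representable C A) f \<in> hom (On_obj (representable C A) Z) (On_obj (representable C A) Y)"
    by (auto intro!: homI simp: Comp_Add_left Comp_closed)
next
  fix Y x assume "x \<in> carrier (On_obj (representable C A) Y)"
  then show "On_arr (representable C A) (Ident C Y) x = x" by (simp add: Comp_Ident_right)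
next
  fix Y Z W f g x assume "f \<in> Hom C Y Z" "g \<in> Hom C Z W" "x \<in> carrier (On_obj (representable C A) W)"
  then show "On_arr (representable C A) (g \<cdot> f) x = 
    On_arr (representable C A) f (On_arr (representable C A) g x)" using Comp_assoc by simp
next
  fix Y Z f g x assume "f \<in> Hom C Y Z" "g \<in> Hom C Y Z" "x \<in> carrier (On_obj (representable C A) Z)"
  then show "On_arr (representable C A) (Add C f g) x = On_arr (representable C A) f x 
    \<otimes>\<^bsub>On_obj (representable C A) Y\<^esub> On_arr (representable C A) g x" using Comp_Add_right by simp
qed

lemma natural_postcomposition:
  assumes f: "f \<in> Hom C A B"
  shows "natural_transformation C X (representable C A) (representable C B) (\<lambda>Y x. f \<cdot> x)"
proof (rule natural_transformationI)
  fix Y x assume "x \<in> carrier (On_obj (representable C A) Y)"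
  then show "f \<cdot> x \<in> carrier (On_obj (representable C B) Y)" using Comp_closed f by simp
next
  fix Y x x' assume "x \<in> carrier (On_obj (representable C A) Y)" "x' \<in> carrier (On_obj (representable C A) Y)"
  then show "f \<cdot> (x \<otimes>\<^bsub>On_obj (representable C A) Y\<^esub> x') = 
    (f \<cdot> x) \<otimes>\<^bsub>On_obj (representable C B) Y\<^esub> (f \<cdot> x')" using Comp_Add_right f by simp
next
  fix Y Z g x assume "g \<in> Hom C Y Z" "x \<in> carrier (On_obj (representable C A) Z)"
  then show "f \<cdot> On_arr (representable C A) g x = On_arr (representable C B) g (f \<cdot> x)"
    using Comp_assoc[of g Y Z x A f B] f by simp
qed

lemma realizes_Zero:
  assumes r: "realizes C X A F \<rho>" and F: "additive_functor C X F" and A: "A \<in> Obj C" and Y: "Y \<in> X"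
  shows "\<rho> Y (Zero C Y A) = \<one>\<^bsub>On_obj F Y\<^esub>"
  using natural_transformation_one[of C X "representable C A" F \<rho> Y] r additive_representable[OF A] F Y
  unfolding realizes_def by simp

lemma realizes_eq_one_iff:
  assumes r: "realizes C X A F \<rho>" and F: "additive_functor C X F" and Y: "Y \<in> X" and x: "x \<in> Hom C Y A"
  shows "\<rho> Y x = \<one>\<^bsub>On_obj F Y\<^esub> \<longleftrightarrow> x = Zero C Y A"
  using realizes_Zero[OF r F Hom_objs(2)[OF x] Y] realizes_inj[OF r Y x Zero_closed[OF Hom_objs[OF x]]] 
  by auto

lemma realized_arrow_natural:
  assumes r: "realizes C X A F \<rho>" and s: "realizes C X B G \<sigma>" and f: "f \<in> Hom C A B"
  shows "natural_transformation C X F G (\<lambda>Y z. \<sigma> Y (f \<cdot> inv_into (Hom C Y A) (\<rho> Y) z))"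
proof (rule natural_transformation_descend[OF additive_representable[OF Hom_objs(1)[OF f]]])
  show "natural_transformation C X (representable C A) G (\<lambda>Y x. \<sigma> Y (f \<cdot> x))"
    using natural_transformation_comp[OF natural_postcomposition[OF f]] s unfolding realizes_def by blast
  show "natural_transformation C X (representable C A) F \<rho>" 
    using r unfolding realizes_def by blast
  show "\<rho> Y ` carrier (On_obj (representable C A) Y) = carrier (On_obj F Y)" if "Y \<in> X" for Y
    using r that unfolding realizes_def bij_betw_def by simp
  show "\<sigma> Y (f \<cdot> inv_into (Hom C Y A) (\<rho> Y) (\<rho> Y x)) = \<sigma> Y (f \<cdot> x)"
    if "Y \<in> X" "x \<in> carrier (On_obj (representable C A) Y)" for Y x
    using realizes_inv[OF r] that by simp
qed

lemma realized_arrow_Hom: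
  assumes "realizes C X A F \<rho>" "coherent C X F" "realizes C X B G \<sigma>" "coherent C X G" "f \<in> Hom C A B"
  shows "realized_arrow C X A F \<rho> G \<sigma> f \<in> Hom (mod_category C X) F G"
  unfolding realized_arrow_def
  using assms by (intro Hom_mod_categoryI realized_arrow_natural)

text \<open>The criterion on the right also describes equality in the factor category; this
  coincidence is the source of faithfulness.\<close>

lemma realized_arrow_eq_iff:
  assumes r: "realizes C X A F \<rho>" and s: "realizes C X B G \<sigma>" 
    and f: "f \<in> Hom C A B" and g: "g \<in> Hom C A B"
  shows "realized_arrow C X A F \<rho> G \<sigma> f = realized_arrow C X A F \<rho> G \<sigma> g \<longleftrightarrow>
     (\<forall>Y\<in>X. \<forall>x\<in>Hom C Y A. f \<cdot> x = g \<cdot> x)"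
  unfolding realized_arrow_def trans_arrow_realized_eq_iff[OF r]
  using realizes_inv[OF r] realizes_inj[OF s _ Comp_closed[OF _ f] Comp_closed[OF _ g]] by auto

lemma realized_arrow_Comp:
  assumes r: "realizes C X A F \<rho>" and s: "realizes C X B G \<sigma>"
    and f: "f \<in> Hom C A B" and g: "g \<in> Hom C B D"
  shows "realized_arrow C X B G \<sigma> H \<tau> g \<cdot>\<^bsub>mod_category C X\<^esub> realized_arrow C X A F \<rho> G \<sigma> f
    = realized_arrow C X A F \<rho> H \<tau> (g \<cdot> f)"
  unfolding realized_arrow_def Comp_trans_arrow[OF realized_arrow_natural[OF r s f]]
    trans_arrow_realized_eq_iff[OF r]
  using Comp_assoc[OF _ f g] Comp_closed[OF _ f] by (simp add: realizes_inv[OF r] realizes_inv[OF s])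

lemma realized_arrow_Ident:
  assumes r: "realizes C X A F \<rho>"
  shows "realized_arrow C X A F \<rho> F \<rho> (Ident C A) = Ident (mod_category C X) F"
  unfolding realized_arrow_def Ident_mod_category trans_arrow_realized_eq_iff[OF r]
  by (simp add: realizes_inv[OF r] Comp_Ident_left)

lemma realized_arrow_Zero:
  assumes r: "realizes C X A F \<rho>" and s: "realizes C X B G \<sigma>" and G: "additive_functor C X G"
    and B: "B \<in> Obj C"
  shows "realized_arrow C X A F \<rho> G \<sigma> (Zero C A B) = Zero (mod_category C X) F G"
  unfolding realized_arrow_def Zero_mod_category trans_arrow_realized_eq_iff[OF r]
  by (simp add: realizes_inv[OF r] Comp_Zero_left[OF _ B] realizes_Zero[OF s G B])

lemma realized_arrow_Add:
  assumes r: "realizes C X A F \<rho>" and s: "realizes C X B G \<sigma>"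
    and f: "f \<in> Hom C A B" and g: "g \<in> Hom C A B"
  shows "Add (mod_category C X) (realized_arrow C X A F \<rho> G \<sigma> f) (realized_arrow C X A F \<rho> G \<sigma> g)
    = realized_arrow C X A F \<rho> G \<sigma> (Add C f g)"
  unfolding realized_arrow_def Add_trans_arrow trans_arrow_realized_eq_iff[OF r]
  using f g by (simp add: realizes_inv[OF r] Comp_Add_left realizes_Add[OF s] Comp_closed)

text \<open>The inverse \<theta> is defined by choosing preimages. Since composition with
  \<open>f\<close> is injective, \<theta> is the lift of the identity of \<open>G\<close> along the
  transformation of \<open>f\<close>, hence natural.\<close>

lemma realized_arrow_isomorphism:
  assumes r: "realizes C X A F \<rho>" "coherent C X F" and s: "realizes C X B G \<sigma>" "coherent C X G" 
    and f: "f \<in> Hom C A B"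
    and inj: "\<And>Y x x'. \<lbrakk>Y \<in> X; x \<in> Hom C Y A; x' \<in> Hom C Y A; f \<cdot> x = f \<cdot> x'\<rbrakk> \<Longrightarrow> x = x'"
    and surj: "\<And>Y y. \<lbrakk>Y \<in> X; y \<in> Hom C Y B\<rbrakk> \<Longrightarrow> \<exists>x\<in>Hom C Y A. y = f \<cdot> x"
  shows "isomorphism (mod_category C X) (realized_arrow C X A F \<rho> G \<sigma> f)"
proof -
  interpret M: category "mod_category C X" by (rule category_mod_category)
  let ?M = "mod_category C X"
  note a = coherent_additive[OF r(2)] coherent_additive[OF s(2)]
  let ?\<eta> = "\<lambda>Y z. \<sigma> Y (f \<cdot> inv_into (Hom C Y A) (\<rho> Y) z)"
  note n = realized_arrow_natural[OF r(1) s(1) f]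
  have eq: "?\<eta> Y (\<rho> Y x) = \<sigma> Y (f \<cdot> x)" if "Y \<in> X" "x \<in> Hom C Y A" for Y x
    using realizes_inv[OF r(1) that] by simp
  define \<theta> where "\<theta> Y z = \<rho> Y (SOME x. x \<in> Hom C Y A \<and> \<sigma> Y (f \<cdot> x) = z)" for Y z
  have \<theta>: "\<theta> Y (\<sigma> Y (f \<cdot> x)) = \<rho> Y x" if Y: "Y \<in> X" and x: "x \<in> Hom C Y A" for Y x
  proof -
    have "\<exists>x'. x' \<in> Hom C Y A \<and> \<sigma> Y (f \<cdot> x') = \<sigma> Y (f \<cdot> x)" using x by blast
    from someI_ex[OF this] have "(SOME x'. x' \<in> Hom C Y A \<and> \<sigma> Y (f \<cdot> x') = \<sigma> Y (f \<cdot> x)) = x"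
      using realizes_inj[OF s(1) Y Comp_closed[OF _ f] Comp_closed[OF _ f]] inj[OF Y] x by blast
    then show ?thesis by (simp add: \<theta>_def)
  qed
  have Gel: "\<exists>x\<in>Hom C Y A. z = \<sigma> Y (f \<cdot> x)" if "Y \<in> X" "z \<in> carrier (On_obj G Y)" for Y z
    using realizes_surj[OF s(1) that] surj[OF that(1)] by metis
  have n\<theta>: "natural_transformation C X G F \<theta>"
  proof (rule natural_transformation_lift[OF a(2,1) n natural_transformation_ident])
    fix Y assume Y: "Y \<in> X"
    show "inj_on (?\<eta> Y) (carrier (On_obj F Y))"
    proof (rule inj_onI)
      fix z z' assume z: "z \<in> carrier (On_obj F Y)" and z': "z' \<in> carrier (On_obj F Y)" 
        and e: "?\<eta> Y z = ?\<eta> Y z'"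
      obtain x where x: "x \<in> Hom C Y A" "z = \<rho> Y x" using realizes_surj[OF r(1) Y z] .
      obtain x' where x': "x' \<in> Hom C Y A" "z' = \<rho> Y x'" using realizes_surj[OF r(1) Y z'] .
      have "\<sigma> Y (f \<cdot> x) = \<sigma> Y (f \<cdot> x')" using e eq[OF Y x(1)] eq[OF Y x'(1)] x(2) x'(2) by simp
      then have "f \<cdot> x = f \<cdot> x'" 
        using realizes_inj[OF s(1) Y Comp_closed[OF x(1) f] Comp_closed[OF x'(1) f]] by blast
      then show "z = z'" using inj[OF Y x(1) x'(1)] x(2) x'(2) by simp
    qed
    fix z assume "z \<in> carrier (On_obj G Y)"
    then obtain x where x: "x \<in> Hom C Y A" "z = \<sigma> Y (f \<cdot> x)" using Gel[OF Y] by blast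
    show "\<theta> Y z \<in> carrier (On_obj F Y) \<and> ?\<eta> Y (\<theta> Y z) = z"
      unfolding x(2) \<theta>[OF Y x(1)] eq[OF Y x(1)] using realizes_closed[OF r(1) Y x(1)] by simp
  qed
  show ?thesis
  proof (rule M.isomorphismI)
    show "realized_arrow C X A F \<rho> G \<sigma> f \<in> Hom ?M F G"
      by (rule realized_arrow_Hom[OF r s f])
    show "trans_arrow X G F \<theta> \<in> Hom ?M G F" by (rule Hom_mod_categoryI[OF s(2) r(2) n\<theta>])
    show "trans_arrow X G F \<theta> \<cdot>\<^bsub>?M\<^esub> realized_arrow C X A F \<rho> G \<sigma> f = Ident ?M F"
      unfolding realized_arrow_def Comp_trans_arrow[OF n] Ident_mod_category 
        trans_arrow_realized_eq_iff[OF r(1)]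
      using eq \<theta> by simp
    show "realized_arrow C X A F \<rho> G \<sigma> f \<cdot>\<^bsub>?M\<^esub> trans_arrow X G F \<theta> = Ident ?M G"
      unfolding realized_arrow_def Comp_trans_arrow[OF n\<theta>] Ident_mod_category trans_arrow_eq_iff
    proof (intro ballI)
      fix Y z assume Y: "Y \<in> X" and "z \<in> carrier (On_obj G Y)"
      then obtain x where x: "x \<in> Hom C Y A" "z = \<sigma> Y (f \<cdot> x)" using Gel by blast
      show "?\<eta> Y (\<theta> Y z) = z" unfolding x(2) \<theta>[OF Y x(1)] eq[OF Y x(1)] ..
    qed
  qed
qed

text \<open>
  For a rigid subcategory of a triangulated category the presented objects are the cones of maps
  in \<open>X\<close>. They behave like projectives for the restricted Yoneda functor.
\<close>

definition presented :: "'o \<Rightarrow> bool" where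
  "presented A \<longleftrightarrow> (\<exists>P\<in>X. \<exists>c\<in>Hom C P A. (\<exists>Q\<in>X. \<exists>a\<in>Hom C Q P. c \<cdot> a = Zero C Q A \<and> 
     (\<forall>D. \<forall>g\<in>Hom C P D. g \<cdot> a = Zero C Q D \<longrightarrow> (\<exists>h\<in>Hom C A D. g = h \<cdot> c))) \<and>
     (\<forall>Y\<in>X. \<forall>y\<in>Hom C Y A. \<exists>x\<in>Hom C Y P. y = c \<cdot> x))"

text \<open>Let \<open>a : Q -> P\<close> present \<open>A\<close> with cokernel map
  \<open>c\<close>. By naturality the element \<phi> P c satisfies \<phi> P c \<cdot> a = 0, so it
  factors as \<open>f \<cdot> c\<close>. Every map from \<open>X\<close> to \<open>A\<close> factors
  through \<open>c\<close>, and naturality makes \<phi> composition with \<open>f\<close>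
  everywhere.\<close>

lemma presented_full:
  assumes A: "presented A" and B: "B \<in> Obj C"
    and n: "natural_transformation C X (representable C A) (representable C B) \<phi>"
  shows "\<exists>f\<in>Hom C A B. \<forall>Y\<in>X. \<forall>x\<in>Hom C Y A. \<phi> Y x = f \<cdot> x"
proof -
  obtain P c Q a where P: "P \<in> X" and c: "c \<in> Hom C P A" and Q: "Q \<in> X" and a: "a \<in> Hom C Q P"
    and ca: "c \<cdot> a = Zero C Q A"
    and h: "\<And>D g. \<lbrakk>g\<in>Hom C P D; g \<cdot> a = Zero C Q D\<rbrakk> \<Longrightarrow> \<exists>h\<in>Hom C A D. g = h \<cdot> c"
    and s: "\<And>Y y. \<lbrakk>Y\<in>X; y\<in>Hom C Y A\<rbrakk> \<Longrightarrow> \<exists>x\<in>Hom C Y P. y = c \<cdot> x"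
    using A unfolding presented_def by blast
  have AO: "A \<in> Obj C" using Hom_objs(2)[OF c] .
  have g: "\<phi> P c \<in> Hom C P B" using natural_transformationD(2)[OF n P] c by simp
  have nat: "\<phi> Y (x \<cdot> y) = \<phi> Z x \<cdot> y" if "Y \<in> X" "Z \<in> X" "y \<in> Hom C Y Z" "x \<in> Hom C Z A" for Y Z x y
    using natural_transformationD(4)[OF n that(1-3)] that(4) by simp
  have "\<phi> Q (Zero C Q A) = Zero C Q B"
    using natural_transformation_one[OF n additive_representable[OF AO] additive_representable[OF B] Q] by simp
  then have "\<phi> P c \<cdot> a = Zero C Q B" using nat[OF Q P a c] ca by simp
  then obtain f where f: "f \<in> Hom C A B" "\<phi> P c = f \<cdot> c" using h[OF g] by blast
  have "\<phi> Y y = f \<cdot> y" if Y: "Y \<in> X" and y: "y \<in> Hom C Y A" for Y y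
  proof -
    obtain x where x: "x \<in> Hom C Y P" "y = c \<cdot> x" using s[OF Y y] by blast
    show ?thesis using nat[OF Y P x(1) c] Comp_assoc[OF x(1) c f(1)] f(2) x(2) by simp
  qed
  then show ?thesis using f(1) by blast
qed

text \<open>Fullness at presented objects, transported to copies: \<eta> conjugated by \<rho> and
  \<sigma> is a transformation of representables.\<close>

lemma realized_arrow_full:
  assumes A: "presented A" and AO: "A \<in> Obj C" and B: "B \<in> Obj C"
    and r: "realizes C X A F \<rho>" and F: "additive_functor C X F" and s: "realizes C X B G \<sigma>" 
    and n: "natural_transformation C X F G \<eta>"
  obtains f where "f \<in> Hom C A B" "\<And>Y x. \<lbrakk>Y \<in> X; x \<in> Hom C Y A\<rbrakk> \<Longrightarrow> \<eta> Y (\<rho> Y x) = \<sigma> Y (f \<cdot> x)"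
proof -
  let ?\<phi> = "\<lambda>Y x. inv_into (Hom C Y B) (\<sigma> Y) (\<eta> Y (\<rho> Y x))"
  have im: "\<eta> Y (\<rho> Y x) \<in> \<sigma> Y ` Hom C Y B" if "Y \<in> X" "x \<in> Hom C Y A" for Y x
    using natural_transformationD(2)[OF n that(1) realizes_closed[OF r that]] s that
    unfolding realizes_def bij_betw_def by blast
  have "natural_transformation C X (representable C A) (representable C B) ?\<phi>"
  proof (rule natural_transformation_lift[OF additive_representable[OF AO] additive_representable[OF B]])
    show "natural_transformation C X (representable C B) G \<sigma>" using s unfolding realizes_def by blast
    show "natural_transformation C X (representable C A) G (\<lambda>Y x. \<eta> Y (\<rho> Y x))"
      using natural_transformation_comp[OF _ n] r unfolding realizes_def by blast
  next
    fix Y assume "Y \<in> X"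
    then show "inj_on (\<sigma> Y) (carrier (On_obj (representable C B) Y))"
      using s unfolding realizes_def bij_betw_def by simp
  next
    fix Y x assume "Y \<in> X" "x \<in> carrier (On_obj (representable C A) Y)"
    then show "?\<phi> Y x \<in> carrier (On_obj (representable C B) Y) \<and> \<sigma> Y (?\<phi> Y x) = \<eta> Y (\<rho> Y x)"
      using im by (simp add: inv_into_into f_inv_into_f)
  qed
  then obtain f where f: "f \<in> Hom C A B" "\<And>Y x. \<lbrakk>Y \<in> X; x \<in> Hom C Y A\<rbrakk> \<Longrightarrow> ?\<phi> Y x = f \<cdot> x"
    using presented_full[OF A B] by blast
  have "\<eta> Y (\<rho> Y x) = \<sigma> Y (f \<cdot> x)" if "Y \<in> X" "x \<in> Hom C Y A" for Y x
    using f(2)[OF that] f_inv_into_f[OF im[OF that]] by simp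
  then show ?thesis using that f(1) by blast
qed

text \<open>Approximating the source of a weak kernel moves it into \<open>X\<close> without losing
  exactness on maps from \<open>X\<close>. This supplies the relations of a presentation.\<close>

lemma weak_kernel_in_X:
  assumes f: "f \<in> Hom C A B"
  obtains Q a where "Q \<in> X" "a \<in> Hom C Q A" "f \<cdot> a = Zero C Q B"
    "\<And>Y y. \<lbrakk>Y \<in> X; y \<in> Hom C Y A; f \<cdot> y = Zero C Y B\<rbrakk> \<Longrightarrow> \<exists>x\<in>Hom C Y Q. y = a \<cdot> x"
proof -
  obtain L l where l: "l \<in> Hom C L A" "f \<cdot> l = Zero C L B" 
    and lw: "\<And>Y y. \<lbrakk>Y\<in>X; y \<in> Hom C Y A; f \<cdot> y = Zero C Y B\<rbrakk> \<Longrightarrow> \<exists>x \<in> Hom C Y L. y = l \<cdot> x"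
    using weak_kernel[OF f] by blast
  obtain Q p where Q: "Q \<in> X" "p \<in> Hom C Q L" 
    and pw: "\<And>Y y. \<lbrakk>Y\<in>X; y \<in> Hom C Y L\<rbrakk> \<Longrightarrow> \<exists>x \<in> Hom C Y Q. y = p \<cdot> x"
    using approximation[OF Hom_objs(1)[OF l(1)]] by blast
  show ?thesis
  proof (rule that[OF Q(1) Comp_closed[OF Q(2) l(1)]])
    show "f \<cdot> (l \<cdot> p) = Zero C Q B"
      using Comp_assoc[OF Q(2) l(1) f] l(2) Comp_Zero_left[OF Q(2) Hom_objs(2)[OF f]] by simp
    fix Y y assume Y: "Y \<in> X" and y: "y \<in> Hom C Y A" "f \<cdot> y = Zero C Y B"
    obtain x where x: "x \<in> Hom C Y L" "y = l \<cdot> x" using lw[OF Y y] by blast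
    obtain x' where x': "x' \<in> Hom C Y Q" "x = p \<cdot> x'" using pw[OF Y x(1)] by blast
    show "\<exists>x\<in>Hom C Y Q. y = (l \<cdot> p) \<cdot> x"
      using Comp_assoc[OF x'(1) Q(2) l(1)] x(2) x' by blast
  qed
qed

lemma inj_if_kernel_trivial:
  assumes k: "k \<in> Hom C K A" and y: "y \<in> Hom C Y K" and y': "y' \<in> Hom C Y K" and e: "k \<cdot> y = k \<cdot> y'"
    and inj0: "\<And>z. \<lbrakk>z \<in> Hom C Y K; k \<cdot> z = Zero C Y A\<rbrakk> \<Longrightarrow> z = Zero C Y K"
  shows "y = y'"
proof -
  note ny = Neg_closed[OF y']
  have "k \<cdot> Add C y (Neg C y') = Zero C Y A"
    using Comp_Add_right[OF y ny k] Comp_Neg_right[OF y' k] e Add_Neg[OF Comp_closed[OF y' k]] by simp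
  then show ?thesis using inj0[OF Add_closed[OF y ny]] Add_Neg_eq_Zero[OF y y'] by blast
qed

text \<open>Let \<open>a : Q -> P\<close> cover the kernel of \<open>H h\<close> and let
  \<open>K\<close> be its weak cokernel. Then \<open>H K\<close> is the quotient of
  \<open>H P\<close> by that kernel, which is the image of \<open>H h\<close>; so the induced
  \<open>k\<close> is injective on maps from \<open>X\<close>. In particular the image is realized
  by a presented object.\<close>

lemma image_factorization:
  assumes h: "h \<in> Hom C P A" and P: "P \<in> X"
  obtains K c k where "presented K" "c \<in> Hom C P K" "k \<in> Hom C K A" "h = k \<cdot> c"
    "\<And>Y y. \<lbrakk>Y \<in> X; y \<in> Hom C Y K\<rbrakk> \<Longrightarrow> \<exists>x\<in>Hom C Y P. y = c \<cdot> x"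
    "\<And>Y y y'. \<lbrakk>Y \<in> X; y \<in> Hom C Y K; y' \<in> Hom C Y K; k \<cdot> y = k \<cdot> y'\<rbrakk> \<Longrightarrow> y = y'"
proof -
  obtain Q a where Q: "Q \<in> X" and a: "a \<in> Hom C Q P" "h \<cdot> a = Zero C Q A"
    and aw: "\<And>Y y. \<lbrakk>Y \<in> X; y \<in> Hom C Y P; h \<cdot> y = Zero C Y A\<rbrakk> \<Longrightarrow> \<exists>x\<in>Hom C Y Q. y = a \<cdot> x"
    using weak_kernel_in_X[OF h] by blast
  obtain K c where c: "c \<in> Hom C P K" "c \<cdot> a = Zero C Q K"
    and w: "\<And>D g. \<lbrakk>g \<in> Hom C P D; g \<cdot> a = Zero C Q D\<rbrakk> \<Longrightarrow> \<exists>h \<in> Hom C K D. g = h \<cdot> c"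
    and s: "\<And>Y y. \<lbrakk>Y\<in>X; y \<in> Hom C Y K\<rbrakk> \<Longrightarrow> \<exists>x \<in> Hom C Y P. y = c \<cdot> x"
    using weak_cokernel[OF a(1) Q] by blast
  obtain k where k: "k \<in> Hom C K A" "h = k \<cdot> c" using w[OF h a(2)] by blast
  note A = Hom_objs(2)[OF h] and K = Hom_objs(1)[OF k(1)]
  have pr: "presented K"
    unfolding presented_def
    by (intro bexI[OF _ P] bexI[OF _ c(1)] conjI bexI[OF _ Q] bexI[OF _ a(1)] allI ballI impI c(2))
      (auto intro: w s)
  have inj0: "y = Zero C Y K" if Y: "Y \<in> X" and y: "y \<in> Hom C Y K" "k \<cdot> y = Zero C Y A" for Y y
  proof -
    obtain x where x: "x \<in> Hom C Y P" "y = c \<cdot> x" using s[OF Y y(1)] by blast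
    have "h \<cdot> x = Zero C Y A" using Comp_assoc[OF x(1) c(1) k(1)] y(2) x(2) k(2) by simp
    then obtain z where z: "z \<in> Hom C Y Q" "x = a \<cdot> z" using aw[OF Y x(1)] by blast
    show ?thesis using x(2) z(2) Comp_assoc[OF z(1) a(1) c(1)] c(2) Comp_Zero_left[OF z(1) K] by simp
  qed
  have "y = y'" if Y: "Y \<in> X" and y: "y \<in> Hom C Y K" and y': "y' \<in> Hom C Y K" and e: "k \<cdot> y = k \<cdot> y'" 
    for Y y y'
    using inj_if_kernel_trivial[OF k(1) y y' e inj0[OF Y]] .
  then show ?thesis using that[OF pr c(1) k s] by blast
qed

text \<open>An approximation \<open>P -> A\<close> is onto under \<open>H\<close>, so the presented
  object realizing its image maps to \<open>A\<close> bijectively on maps from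
  \<open>X\<close>.\<close>

lemma presented_resolution:
  assumes A: "A \<in> Obj C"
  obtains K k where "presented K" "k \<in> Hom C K A" 
    "\<And>Y y. \<lbrakk>Y \<in> X; y \<in> Hom C Y A\<rbrakk> \<Longrightarrow> \<exists>x\<in>Hom C Y K. y = k \<cdot> x"
    "\<And>Y y y'. \<lbrakk>Y \<in> X; y \<in> Hom C Y K; y' \<in> Hom C Y K; k \<cdot> y = k \<cdot> y'\<rbrakk> \<Longrightarrow> y = y'"
proof -
  obtain P p where P: "P \<in> X" "p \<in> Hom C P A" 
    and pw: "\<And>Y y. \<lbrakk>Y\<in>X; y \<in> Hom C Y A\<rbrakk> \<Longrightarrow> \<exists>x \<in> Hom C Y P. y = p \<cdot> x"
    using approximation[OF A] by blast
  obtain K c k where k: "presented K" "c \<in> Hom C P K" "k \<in> Hom C K A" "p = k \<cdot> c"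
    "\<And>Y y. \<lbrakk>Y \<in> X; y \<in> Hom C Y K\<rbrakk> \<Longrightarrow> \<exists>x\<in>Hom C Y P. y = c \<cdot> x"
    "\<And>Y y y'. \<lbrakk>Y \<in> X; y \<in> Hom C Y K; y' \<in> Hom C Y K; k \<cdot> y = k \<cdot> y'\<rbrakk> \<Longrightarrow> y = y'"
    using image_factorization[OF P(2,1)] by blast
  have "\<exists>x\<in>Hom C Y K. y = k \<cdot> x" if Y: "Y \<in> X" and y: "y \<in> Hom C Y A" for Y y
  proof -
    obtain x where x: "x \<in> Hom C Y P" "y = p \<cdot> x" using pw[OF Y y] by blast
    have "y = k \<cdot> (c \<cdot> x)" using x(2) Comp_assoc[OF x(1) k(2,3)] unfolding k(4) by simp
    then show ?thesis using Comp_closed[OF x(1) k(2)] by blast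
  qed
  then show ?thesis using that[OF k(1,3)] k(6) by blast
qed

text \<open>A presentation of \<open>H A\<close> is obtained by approximating \<open>A\<close> by
  \<open>P\<close> and the kernel of \<open>H P -> H A\<close> by \<open>Q\<close>.\<close>

lemma coherent_if_realized:
  assumes F: "additive_functor C X F" and A: "A \<in> Obj C" and r: "realizes C X A F \<rho>"
  shows "coherent C X F"
proof -
  obtain P p where P: "P \<in> X" and p: "p \<in> Hom C P A" 
    and pw: "\<And>Y y. \<lbrakk>Y\<in>X; y \<in> Hom C Y A\<rbrakk> \<Longrightarrow> \<exists>x \<in> Hom C Y P. y = p \<cdot> x"
    using approximation[OF A] by blast
  obtain Q a where Q: "Q \<in> X" and a: "a \<in> Hom C Q P" "p \<cdot> a = Zero C Q A"
    and aw: "\<And>Y y. \<lbrakk>Y \<in> X; y \<in> Hom C Y P; p \<cdot> y = Zero C Y A\<rbrakk> \<Longrightarrow> \<exists>x\<in>Hom C Y Q. y = a \<cdot> x"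
    using weak_kernel_in_X[OF p] by blast
  have n: "natural_transformation C X (representable C P) F (\<lambda>Y x. \<rho> Y (p \<cdot> x))"
    using natural_transformation_comp[OF natural_postcomposition[OF p]] r unfolding realizes_def by blast
  show ?thesis
    unfolding coherent_def
  proof (rule conjI[OF F], rule bexI[OF _ Q], rule bexI[OF _ P], 
      rule exI[of _ "\<lambda>Y x. a \<cdot> x"], rule exI[of _ "\<lambda>Y x. \<rho> Y (p \<cdot> x)"],
      intro conjI ballI natural_postcomposition[OF a(1)] n)
    fix Y assume Y: "Y \<in> X"
    have "a \<cdot> z \<in> Hom C Y P \<and> p \<cdot> (a \<cdot> z) = Zero C Y A" if z: "z \<in> Hom C Y Q" for z
      using Comp_closed[OF z a(1)] Comp_assoc[OF z a(1) p] a(2) Comp_Zero_left[OF z A] by simp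
    then have "(\<cdot>) a ` Hom C Y Q = {x \<in> Hom C Y P. p \<cdot> x = Zero C Y A}"
      using aw[OF Y] by blast
    also have "\<dots> = kernel (hom_group C Y P) (On_obj F Y) (\<lambda>x. \<rho> Y (p \<cdot> x))"
      unfolding kernel_def using realizes_eq_one_iff[OF r F Y Comp_closed[OF _ p]] by auto
    finally show "(\<cdot>) a ` Hom C Y Q = kernel (hom_group C Y P) (On_obj F Y) (\<lambda>x. \<rho> Y (p \<cdot> x))" .
    show "(\<lambda>x. \<rho> Y (p \<cdot> x)) ` Hom C Y P = carrier (On_obj F Y)"
    proof
      show "(\<lambda>x. \<rho> Y (p \<cdot> x)) ` Hom C Y P \<subseteq> carrier (On_obj F Y)"
        using realizes_closed[OF r Y Comp_closed[OF _ p]] by blast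
      show "carrier (On_obj F Y) \<subseteq> (\<lambda>x. \<rho> Y (p \<cdot> x)) ` Hom C Y P"
      proof
        fix z assume "z \<in> carrier (On_obj F Y)"
        then obtain y where y: "y \<in> Hom C Y A" "z = \<rho> Y y" using realizes_surj[OF r Y] by blast
        then show "z \<in> (\<lambda>x. \<rho> Y (p \<cdot> x)) ` Hom C Y P" using pw[OF Y y(1)] by blast
      qed
    qed
  qed
qed

text \<open>The first map of a presentation of \<open>F\<close> is composition with some
  \<open>a : Q -> P\<close> by the Yoneda lemma. For the weak cokernel \<open>E\<close> of
  \<open>a\<close>, both \<open>H E\<close> and \<open>F\<close> are the cokernel of
  \<open>H Q -> H P\<close>.\<close>

lemma coherent_realized:
  assumes F: "coherent C X F"
  obtains A \<rho> where "presented A" "A \<in> Obj C" "realizes C X A F \<rho>"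
proof -
  note aF = coherent_additive[OF F]
  obtain Q P \<alpha> \<pi> where Q: "Q \<in> X" and P: "P \<in> X"
    and n\<alpha>: "natural_transformation C X (representable C Q) (representable C P) \<alpha>"
    and n\<pi>: "natural_transformation C X (representable C P) F \<pi>"
    and ker: "\<And>A. A \<in> X \<Longrightarrow> \<alpha> A ` Hom C A Q = kernel (hom_group C A P) (On_obj F A) (\<pi> A)"
    and sur: "\<And>A. A \<in> X \<Longrightarrow> \<pi> A ` Hom C A P = carrier (On_obj F A)"
    using F unfolding coherent_def by (elim conjE bexE exE) (rule that; blast)
  note QO = X_Obj'[OF Q] and PO = X_Obj'[OF P]
  \<comment> \<open>The Yoneda element: the transformation \<alpha> is recovered as composition with
    its value at the identity of \<open>Q\<close>.\<close>
  define a where "a = \<alpha> Q (Ident C Q)"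
  have a: "a \<in> Hom C Q P" 
    using natural_transformationD(2)[OF n\<alpha> Q, of "Ident C Q"] Ident_closed[OF QO] by (simp add: a_def)
  have \<alpha>: "\<alpha> Y y = a \<cdot> y" if "Y \<in> X" "y \<in> Hom C Y Q" for Y y
    using natural_transformationD(4)[OF n\<alpha> that(1) Q that(2), of "Ident C Q"] Ident_closed[OF QO] 
      Comp_Ident_left[OF that(2)] by (simp add: a_def)
  obtain E c where c: "c \<in> Hom C P E" "c \<cdot> a = Zero C Q E"
    and w: "\<And>D g. \<lbrakk>g \<in> Hom C P D; g \<cdot> a = Zero C Q D\<rbrakk> \<Longrightarrow> \<exists>h \<in> Hom C E D. g = h \<cdot> c"
    and s: "\<And>Y y. \<lbrakk>Y\<in>X; y \<in> Hom C Y E\<rbrakk> \<Longrightarrow> \<exists>x \<in> Hom C Y P. y = c \<cdot> x"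
    and k: "\<And>Y x. \<lbrakk>Y\<in>X; x \<in> Hom C Y P; c \<cdot> x = Zero C Y E\<rbrakk> \<Longrightarrow> \<exists>z \<in> Hom C Y Q. x = a \<cdot> z"
    using weak_cokernel[OF a Q] by blast
  note E = Hom_objs(2)[OF c(1)]
  have pr: "presented E"
    unfolding presented_def
    by (intro bexI[OF _ P] bexI[OF _ c(1)] conjI bexI[OF _ Q] bexI[OF _ a] allI ballI impI c(2))
      (auto intro: w s)
  have one_iff: "\<pi> Y x = \<one>\<^bsub>On_obj F Y\<^esub> \<longleftrightarrow> c \<cdot> x = Zero C Y E" if Y: "Y \<in> X" and x: "x \<in> Hom C Y P" for Y x
  proof -
    have "\<pi> Y x = \<one>\<^bsub>On_obj F Y\<^esub> \<longleftrightarrow> x \<in> \<alpha> Y ` Hom C Y Q" 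
      unfolding ker[OF Y] kernel_def using x by simp
    also have "\<dots> \<longleftrightarrow> (\<exists>z\<in>Hom C Y Q. x = a \<cdot> z)" using \<alpha>[OF Y] by auto
    also have "\<dots> \<longleftrightarrow> c \<cdot> x = Zero C Y E"
      using k[OF Y x] Comp_assoc[OF _ a c(1)] c(2) Comp_Zero_left[OF _ E] by auto
    finally show ?thesis .
  qed
  have eq_iff: "\<pi> Y x = \<pi> Y x' \<longleftrightarrow> c \<cdot> x = c \<cdot> x'" 
    if Y: "Y \<in> X" and x: "x \<in> Hom C Y P" and x': "x' \<in> Hom C Y P" for Y x x'
  proof -
    let ?d = "Add C x (Neg C x')"
    note nx = Neg_closed[OF x'] 
    interpret p: group_hom "hom_group C Y P" "On_obj F Y" "\<pi> Y"
      using group_hom_of_natural_transformation[OF additive_representable[OF PO] aF n\<pi> Y] by simp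
    have px: "\<pi> Y x \<in> carrier (On_obj F Y)" "\<pi> Y x' \<in> carrier (On_obj F Y)"
      using natural_transformationD(2)[OF n\<pi> Y] x x' by auto
    have "\<pi> Y ?d = \<pi> Y x \<otimes>\<^bsub>On_obj F Y\<^esub> inv\<^bsub>On_obj F Y\<^esub> \<pi> Y x'"
      using p.hom_mult[of x "Neg C x'"] p.hom_inv[of x'] x x' nx by (simp add: Neg_eq[OF x'])
    then have 1: "\<pi> Y ?d = \<one>\<^bsub>On_obj F Y\<^esub> \<longleftrightarrow> \<pi> Y x = \<pi> Y x'"
      using px p.H.inv_equality[of "\<pi> Y x" "inv\<^bsub>On_obj F Y\<^esub> \<pi> Y x'"] p.H.r_inv by auto
    have cd: "c \<cdot> ?d = Add C (c \<cdot> x) (Neg C (c \<cdot> x'))"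
      using Comp_Add_right[OF x nx c(1)] Comp_Neg_right[OF x' c(1)] by simp
    then have 2: "c \<cdot> ?d = Zero C Y E \<longleftrightarrow> c \<cdot> x = c \<cdot> x'"
      using Add_Neg_eq_Zero[OF Comp_closed[OF x c(1)] Comp_closed[OF x' c(1)]] 
        Add_Neg[OF Comp_closed[OF x' c(1)]] by auto
    show ?thesis using 1 2 one_iff[OF Y Add_closed[OF x nx]] by simp
  qed
  \<comment> \<open>Every element of \<open>H E\<close> has the form \<open>c \<cdot> x\<close> and
    is sent to \<pi> x. By \<open>eq_iff\<close> this is well defined and injective, since
    composition with \<open>c\<close> and \<pi> identify the same elements.\<close>
  define \<rho> where "\<rho> Y y = \<pi> Y (SOME x. x \<in> Hom C Y P \<and> c \<cdot> x = y)" for Y y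
  have \<rho>: "\<rho> Y (c \<cdot> x) = \<pi> Y x" if Y: "Y \<in> X" and x: "x \<in> Hom C Y P" for Y x
  proof -
    have "\<exists>x'. x' \<in> Hom C Y P \<and> c \<cdot> x' = c \<cdot> x" using x by blast
    from someI_ex[OF this] show ?thesis unfolding \<rho>_def using eq_iff[OF Y _ x] by blast
  qed
  have "natural_transformation C X (representable C E) F \<rho>"
  proof (rule natural_transformation_descend[OF additive_representable[OF PO] 
        natural_postcomposition[OF c(1)] n\<pi>])
    fix Y assume Y: "Y \<in> X"
    show "(\<cdot>) c ` carrier (On_obj (representable C P) Y) = carrier (On_obj (representable C E) Y)"
      using s[OF Y] Comp_closed[OF _ c(1)] by auto
  qed (use \<rho> in simp)
  moreover have "bij_betw (\<rho> Y) (Hom C Y E) (carrier (On_obj F Y))" if Y: "Y \<in> X" for Y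
    unfolding bij_betw_def
  proof
    show "inj_on (\<rho> Y) (Hom C Y E)"
    proof (rule inj_onI)
      fix y y' assume y: "y \<in> Hom C Y E" and y': "y' \<in> Hom C Y E" and e: "\<rho> Y y = \<rho> Y y'"
      obtain x where x: "x \<in> Hom C Y P" "y = c \<cdot> x" using s[OF Y y] by blast
      obtain x' where x': "x' \<in> Hom C Y P" "y' = c \<cdot> x'" using s[OF Y y'] by blast
      show "y = y'" using e eq_iff[OF Y x(1) x'(1)] \<rho>[OF Y x(1)] \<rho>[OF Y x'(1)] x(2) x'(2) by simp
    qed
    have "\<rho> Y ` Hom C Y E = (\<lambda>x. \<rho> Y (c \<cdot> x)) ` Hom C Y P"
    proof
      show "\<rho> Y ` Hom C Y E \<subseteq> (\<lambda>x. \<rho> Y (c \<cdot> x)) ` Hom C Y P" using s[OF Y] by fast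
      show "(\<lambda>x. \<rho> Y (c \<cdot> x)) ` Hom C Y P \<subseteq> \<rho> Y ` Hom C Y E" using Comp_closed[OF _ c(1), of _ Y] by fast
    qed
    also have "\<dots> = \<pi> Y ` Hom C Y P" using \<rho>[OF Y] by (intro image_cong) auto
    finally show "\<rho> Y ` Hom C Y E = carrier (On_obj F Y)" using sur[OF Y] by simp
  qed
  ultimately have "realizes C X E F \<rho>" unfolding realizes_def by blast
  then show ?thesis using that pr E by blast
qed

end

section \<open>The category of coherent functors is abelian\<close>

locale small_weak_cokernel_category = weak_cokernel_category C X
  for C :: "('o, 'm, 'z) preadd_cat_scheme" (structure) and X :: "'o set" +
  fixes elem_type :: "'g itself"
  assumes small: "locally_small C elem_type"

\<comment> \<open>Copies of restricted representables, and pointwise kernels and cokernels\<close>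
begin

abbreviation M :: "(('o, 'm, 'g) ab_functor, ('o, 'm, 'g) ab_transformation) preadd_cat" where
  "M \<equiv> mod_category C X"

text \<open>The group structure of each set of arrows \<open>Y -> A\<close> is carried along an
  injection into \<open>'g\<close>. The injections for different \<open>Y\<close> are unrelated;
  functoriality is restored by passing back through the inverse \<open>j\<close> before
  composing.\<close>

lemma ex_realization:
  assumes A: "A \<in> Obj C"
  obtains F :: "('o, 'm, 'g) ab_functor" and \<rho> where "coherent C X F" "realizes C X A F \<rho>"
proof -
  have "\<exists>\<iota> :: 'm \<Rightarrow> 'g. Y \<in> X \<longrightarrow> inj_on \<iota> (Hom C Y A)" for Y
    using small A X_Obj'[of Y] unfolding locally_small_def by blast
  then obtain \<iota> :: "'o \<Rightarrow> 'm \<Rightarrow> 'g" where \<iota>: "Y \<in> X \<Longrightarrow> inj_on (\<iota> Y) (Hom C Y A)" for Y by metis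
  define j where "j Y = inv_into (Hom C Y A) (\<iota> Y)" for Y
  have j: "j Y (\<iota> Y x) = x" if "Y \<in> X" "x \<in> Hom C Y A" for Y x
    using inv_into_f_f[OF \<iota>] that unfolding j_def by blast
  define F :: "('o, 'm, 'g) ab_functor" where "F =
    \<lparr>On_obj = (\<lambda>Y. \<lparr>carrier = \<iota> Y ` Hom C Y A, mult = (\<lambda>a b. \<iota> Y (Add C (j Y a) (j Y b))), 
                    one = \<iota> Y (Zero C Y A)\<rparr>),
     On_arr = (\<lambda>f a. \<iota> (Dom C f) (j (Cod C f) a \<cdot> f))\<rparr>"
  have car: "carrier (On_obj F Y) = \<iota> Y ` Hom C Y A" for Y by (simp add: F_def)
  have mult: "\<iota> Y x \<otimes>\<^bsub>On_obj F Y\<^esub> \<iota> Y x' = \<iota> Y (Add C x x')" 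
    if "Y \<in> X" "x \<in> Hom C Y A" "x' \<in> Hom C Y A" for Y x x'
    using that by (simp add: F_def j)
  have one: "\<one>\<^bsub>On_obj F Y\<^esub> = \<iota> Y (Zero C Y A)" for Y by (simp add: F_def)
  have arr: "On_arr F f (\<iota> Z x) = \<iota> Y (x \<cdot> f)" if "Z \<in> X" "f \<in> Hom C Y Z" "x \<in> Hom C Z A" for Y Z f x
    using that j[of Z x] Hom_DomD[OF that(2)] Hom_CodD[OF that(2)] by (simp add: F_def)
  have F: "additive_functor C X F"
    unfolding additive_functor_def
  proof (intro conjI ballI)
    fix Y assume Y: "Y \<in> X"
    note z = Zero_closed[OF X_Obj'[OF Y] A]
    show "comm_group (On_obj F Y)"
    proof (rule comm_groupI)
      show "\<one>\<^bsub>On_obj F Y\<^esub> \<in> carrier (On_obj F Y)" using z by (simp add: car one)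
    next
      fix a b assume "a \<in> carrier (On_obj F Y)" "b \<in> carrier (On_obj F Y)"
      then obtain x x' where x: "x \<in> Hom C Y A" "a = \<iota> Y x" "x' \<in> Hom C Y A" "b = \<iota> Y x'"
        unfolding car by blast
      show "a \<otimes>\<^bsub>On_obj F Y\<^esub> b \<in> carrier (On_obj F Y)" 
        unfolding x(2,4) mult[OF Y x(1,3)] car using Add_closed[OF x(1,3)] by blast
      show "a \<otimes>\<^bsub>On_obj F Y\<^esub> b = b \<otimes>\<^bsub>On_obj F Y\<^esub> a"
        unfolding x(2,4) mult[OF Y x(1,3)] mult[OF Y x(3,1)] using Add_commute[OF x(1,3)] by simp
    next
      fix a b c assume "a \<in> carrier (On_obj F Y)" "b \<in> carrier (On_obj F Y)" "c \<in> carrier (On_obj F Y)"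
      then obtain x x' x'' where x: "x \<in> Hom C Y A" "x' \<in> Hom C Y A" "x'' \<in> Hom C Y A"
        and e: "a = \<iota> Y x" "b = \<iota> Y x'" "c = \<iota> Y x''" unfolding car by blast
      show "(a \<otimes>\<^bsub>On_obj F Y\<^esub> b) \<otimes>\<^bsub>On_obj F Y\<^esub> c = a \<otimes>\<^bsub>On_obj F Y\<^esub> (b \<otimes>\<^bsub>On_obj F Y\<^esub> c)"
        unfolding e using Y x by (simp add: mult Add_closed Add_assoc)
    next
      fix a assume "a \<in> carrier (On_obj F Y)"
      then obtain x where x: "x \<in> Hom C Y A" "a = \<iota> Y x" unfolding car by blast
      show "\<one>\<^bsub>On_obj F Y\<^esub> \<otimes>\<^bsub>On_obj F Y\<^esub> a = a"
        unfolding x(2) one mult[OF Y z x(1)] Add_Zero_left[OF x(1)] ..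
      have "\<iota> Y (Neg C x) \<otimes>\<^bsub>On_obj F Y\<^esub> a = \<one>\<^bsub>On_obj F Y\<^esub>"
        unfolding x(2) one mult[OF Y Neg_closed[OF x(1)] x(1)] 
          Add_commute[OF Neg_closed[OF x(1)] x(1)] Add_Neg[OF x(1)] ..
      then show "\<exists>b\<in>carrier (On_obj F Y). b \<otimes>\<^bsub>On_obj F Y\<^esub> a = \<one>\<^bsub>On_obj F Y\<^esub>"
        unfolding car using Neg_closed[OF x(1)] by blast
    qed
  next
    fix Y Z f assume Y: "Y \<in> X" and Z: "Z \<in> X" and f: "f \<in> Hom C Y Z"
    show "On_arr F f \<in> hom (On_obj F Z) (On_obj F Y)"
    proof (rule homI)
      fix a assume "a \<in> carrier (On_obj F Z)"
      then obtain x where x: "x \<in> Hom C Z A" "a = \<iota> Z x" unfolding car by blast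
      show "On_arr F f a \<in> carrier (On_obj F Y)"
        unfolding x(2) arr[OF Z f x(1)] car using Comp_closed[OF f x(1)] by blast
    next
      fix a b assume "a \<in> carrier (On_obj F Z)" "b \<in> carrier (On_obj F Z)"
      then obtain x x' where x: "x \<in> Hom C Z A" "a = \<iota> Z x" "x' \<in> Hom C Z A" "b = \<iota> Z x'"
        unfolding car by blast
      show "On_arr F f (a \<otimes>\<^bsub>On_obj F Z\<^esub> b) = On_arr F f a \<otimes>\<^bsub>On_obj F Y\<^esub> On_arr F f b"
        unfolding x(2,4) mult[OF Z x(1,3)] arr[OF Z f x(1)] arr[OF Z f x(3)] 
          arr[OF Z f Add_closed[OF x(1,3)]] mult[OF Y Comp_closed[OF f x(1)] Comp_closed[OF f x(3)]]
          Comp_Add_left[OF f x(1,3)] ..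
    qed
  next
    fix Y a assume Y: "Y \<in> X" and "a \<in> carrier (On_obj F Y)"
    then obtain x where x: "x \<in> Hom C Y A" "a = \<iota> Y x" unfolding car by blast
    show "On_arr F (Ident C Y) a = a"
      unfolding x(2) arr[OF Y Ident_closed[OF X_Obj'[OF Y]] x(1)] Comp_Ident_right[OF x(1)] ..
  next
    fix Y Z W f g a assume Z: "Z \<in> X" and W: "W \<in> X" and f: "f \<in> Hom C Y Z" and g: "g \<in> Hom C Z W" 
      and "a \<in> carrier (On_obj F W)"
    then obtain x where x: "x \<in> Hom C W A" "a = \<iota> W x" unfolding car by blast
    show "On_arr F (g \<cdot> f) a = On_arr F f (On_arr F g a)"
      unfolding x(2) arr[OF W g x(1)] arr[OF Z f Comp_closed[OF g x(1)]] 
        arr[OF W Comp_closed[OF f g] x(1)] Comp_assoc[OF f g x(1)] ..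
  next
    fix Y Z f g a assume Y: "Y \<in> X" and Z: "Z \<in> X" and f: "f \<in> Hom C Y Z" and g: "g \<in> Hom C Y Z" 
      and "a \<in> carrier (On_obj F Z)"
    then obtain x where x: "x \<in> Hom C Z A" "a = \<iota> Z x" unfolding car by blast
    show "On_arr F (Add C f g) a = On_arr F f a \<otimes>\<^bsub>On_obj F Y\<^esub> On_arr F g a"
      unfolding x(2) arr[OF Z f x(1)] arr[OF Z g x(1)] arr[OF Z Add_closed[OF f g] x(1)]
        mult[OF Y Comp_closed[OF f x(1)] Comp_closed[OF g x(1)]] Comp_Add_right[OF f g x(1)] ..
  qed
  have r: "realizes C X A F \<iota>"
    unfolding realizes_def
  proof (intro conjI ballI natural_transformationI)
    fix Y assume "Y \<in> X"
    then show "bij_betw (\<iota> Y) (Hom C Y A) (carrier (On_obj F Y))"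
      using \<iota> unfolding bij_betw_def car by blast
  next
    fix Y x assume "x \<in> carrier (On_obj (representable C A) Y)"
    then show "\<iota> Y x \<in> carrier (On_obj F Y)" by (simp add: car)
  next
    fix Y x x' assume "Y \<in> X" "x \<in> carrier (On_obj (representable C A) Y)" 
      "x' \<in> carrier (On_obj (representable C A) Y)"
    then show "\<iota> Y (x \<otimes>\<^bsub>On_obj (representable C A) Y\<^esub> x') = \<iota> Y x \<otimes>\<^bsub>On_obj F Y\<^esub> \<iota> Y x'"
      by (simp add: mult)
  next
    fix Y Z f x assume "Z \<in> X" "f \<in> Hom C Y Z" "x \<in> carrier (On_obj (representable C A) Z)"
    then show "\<iota> Y (On_arr (representable C A) f x) = On_arr F f (\<iota> Z x)"
      using arr by simp
  qed
  show ?thesis using that[OF coherent_if_realized[OF F A r] r] .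
qed

text \<open>Realize \<open>F\<close> by a presented \<open>A\<close>, so that \<eta> becomes
  \<open>H f\<close>. Its kernel is the image of \<open>H h\<close> for a weak kernel
  \<open>h : Q -> A\<close> with \<open>Q\<close> in \<open>X\<close>, and
  \<open>image_factorization\<close> realizes this image.\<close>

lemma ex_pointwise_kernel:
  fixes F G :: "('o, 'm, 'g) ab_functor"
  assumes F: "coherent C X F" and G: "coherent C X G" and n: "natural_transformation C X F G \<eta>"
  obtains K :: "('o, 'm, 'g) ab_functor" and \<kappa> where "coherent C X K" "natural_transformation C X K F \<kappa>"
    "\<And>Y. Y \<in> X \<Longrightarrow> inj_on (\<kappa> Y) (carrier (On_obj K Y))"
    "\<And>Y. Y \<in> X \<Longrightarrow> \<kappa> Y ` carrier (On_obj K Y) = kernel (On_obj F Y) (On_obj G Y) (\<eta> Y)"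
proof -
  obtain A \<rho> where A: "presented A" "A \<in> Obj C" and r: "realizes C X A F \<rho>"
    using coherent_realized[OF F] .
  obtain B \<sigma> where B: "B \<in> Obj C" and s: "realizes C X B G \<sigma>" using coherent_realized[OF G] .
  note aF = coherent_additive[OF F] and aG = coherent_additive[OF G]
  obtain f where f: "f \<in> Hom C A B" "\<And>Y x. \<lbrakk>Y \<in> X; x \<in> Hom C Y A\<rbrakk> \<Longrightarrow> \<eta> Y (\<rho> Y x) = \<sigma> Y (f \<cdot> x)"
    using realized_arrow_full[OF A B r aF s n] by blast
  obtain Q h where Q: "Q \<in> X" and h: "h \<in> Hom C Q A" "f \<cdot> h = Zero C Q B"
    and hw: "\<And>Y y. \<lbrakk>Y \<in> X; y \<in> Hom C Y A; f \<cdot> y = Zero C Y B\<rbrakk> \<Longrightarrow> \<exists>x\<in>Hom C Y Q. y = h \<cdot> x"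
    using weak_kernel_in_X[OF f(1)] by blast
  obtain K' c k where "presented K'" and c: "c \<in> Hom C Q K'" and k: "k \<in> Hom C K' A" "h = k \<cdot> c"
    and cs: "\<And>Y y. \<lbrakk>Y \<in> X; y \<in> Hom C Y K'\<rbrakk> \<Longrightarrow> \<exists>x\<in>Hom C Y Q. y = c \<cdot> x"
    and ki: "\<And>Y y y'. \<lbrakk>Y \<in> X; y \<in> Hom C Y K'; y' \<in> Hom C Y K'; k \<cdot> y = k \<cdot> y'\<rbrakk> \<Longrightarrow> y = y'"
    by (rule image_factorization[OF h(1) Q]) (rule that)
  obtain K :: "('o, 'm, 'g) ab_functor" and \<tau> where K: "coherent C X K" and t: "realizes C X K' K \<tau>" 
    using ex_realization[OF Hom_objs(1)[OF k(1)]] .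
  let ?\<kappa> = "\<lambda>Y z. \<rho> Y (k \<cdot> inv_into (Hom C Y K') (\<tau> Y) z)"
  have \<kappa>: "?\<kappa> Y (\<tau> Y x) = \<rho> Y (k \<cdot> x)" if "Y \<in> X" "x \<in> Hom C Y K'" for Y x
    using realizes_inv[OF t that] by simp
  show ?thesis
  proof (rule that[OF K realized_arrow_natural[OF t r k(1)]])
    fix Y assume Y: "Y \<in> X"
    show "inj_on (?\<kappa> Y) (carrier (On_obj K Y))"
    proof (rule inj_onI)
      fix z z' assume z: "z \<in> carrier (On_obj K Y)" and z': "z' \<in> carrier (On_obj K Y)" 
        and e: "?\<kappa> Y z = ?\<kappa> Y z'"
      obtain x where x: "x \<in> Hom C Y K'" "z = \<tau> Y x" using realizes_surj[OF t Y z] .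
      obtain x' where x': "x' \<in> Hom C Y K'" "z' = \<tau> Y x'" using realizes_surj[OF t Y z'] .
      have "\<rho> Y (k \<cdot> x) = \<rho> Y (k \<cdot> x')" using e \<kappa>[OF Y x(1)] \<kappa>[OF Y x'(1)] x(2) x'(2) by simp
      then have "k \<cdot> x = k \<cdot> x'"
        using realizes_inj[OF r Y Comp_closed[OF x(1) k(1)] Comp_closed[OF x'(1) k(1)]] by blast
      then show "z = z'" using ki[OF Y x(1) x'(1)] x(2) x'(2) by simp
    qed
    show "?\<kappa> Y ` carrier (On_obj K Y) = kernel (On_obj F Y) (On_obj G Y) (\<eta> Y)"
    proof (intro equalityI subsetI)
      fix w assume "w \<in> ?\<kappa> Y ` carrier (On_obj K Y)"
      then obtain z where z: "z \<in> carrier (On_obj K Y)" "w = ?\<kappa> Y z" by blast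
      obtain y where y: "y \<in> Hom C Y K'" "z = \<tau> Y y" using realizes_surj[OF t Y z(1)] .
      obtain x where x: "x \<in> Hom C Y Q" "y = c \<cdot> x" using cs[OF Y y(1)] by blast
      have w: "w = \<rho> Y (k \<cdot> y)" using \<kappa>[OF Y y(1)] z(2) y(2) by simp
      have "k \<cdot> y = h \<cdot> x" using Comp_assoc[OF x(1) c k(1)] x(2) k(2) by simp
      then have "f \<cdot> (k \<cdot> y) = Zero C Y B"
        using Comp_assoc[OF x(1) h(1) f(1)] h(2) Comp_Zero_left[OF x(1) B] by simp
      then have "\<eta> Y w = \<one>\<^bsub>On_obj G Y\<^esub>"
        using f(2)[OF Y Comp_closed[OF y(1) k(1)]] realizes_Zero[OF s aG B Y] w by simp
      then show "w \<in> kernel (On_obj F Y) (On_obj G Y) (\<eta> Y)"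
        unfolding kernel_def w using realizes_closed[OF r Y Comp_closed[OF y(1) k(1)]] by simp
    next
      fix w assume "w \<in> kernel (On_obj F Y) (On_obj G Y) (\<eta> Y)"
      then have w: "w \<in> carrier (On_obj F Y)" "\<eta> Y w = \<one>\<^bsub>On_obj G Y\<^esub>" unfolding kernel_def by auto
      obtain x where x: "x \<in> Hom C Y A" "w = \<rho> Y x" using realizes_surj[OF r Y w(1)] .
      have "f \<cdot> x = Zero C Y B"
        using w(2) f(2)[OF Y x(1)] x(2) realizes_eq_one_iff[OF s aG Y Comp_closed[OF x(1) f(1)]] by simp
      then obtain y where y: "y \<in> Hom C Y Q" "x = h \<cdot> y" using hw[OF Y x(1)] by blast
      have cy: "c \<cdot> y \<in> Hom C Y K'" using Comp_closed[OF y(1) c] .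
      have "w = ?\<kappa> Y (\<tau> Y (c \<cdot> y))"
        using \<kappa>[OF Y cy] x(2) y(2) k(2) Comp_assoc[OF y(1) c k(1)] by simp
      then show "w \<in> ?\<kappa> Y ` carrier (On_obj K Y)" using realizes_closed[OF t Y cy] by blast
    qed
  qed
qed

text \<open>Again \<eta> becomes \<open>H f\<close>, but exact weak cokernels exist only for maps
  out of \<open>X\<close>. An approximation \<open>p : P -> A\<close> is onto under
  \<open>H\<close>, so \<open>f \<cdot> p\<close> has the same image as \<open>f\<close>, and its
  weak cokernel realizes the quotient.\<close>

lemma ex_pointwise_cokernel:
  fixes F G :: "('o, 'm, 'g) ab_functor"
  assumes F: "coherent C X F" and G: "coherent C X G" and n: "natural_transformation C X F G \<eta>"
  obtains E :: "('o, 'm, 'g) ab_functor" and \<gamma> where "coherent C X E" "natural_transformation C X G E \<gamma>"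
    "\<And>Y. Y \<in> X \<Longrightarrow> \<gamma> Y ` carrier (On_obj G Y) = carrier (On_obj E Y)"
    "\<And>Y. Y \<in> X \<Longrightarrow> \<eta> Y ` carrier (On_obj F Y) = kernel (On_obj G Y) (On_obj E Y) (\<gamma> Y)"
proof -
  obtain A \<rho> where A: "presented A" "A \<in> Obj C" and r: "realizes C X A F \<rho>"
    using coherent_realized[OF F] .
  obtain B \<sigma> where B: "B \<in> Obj C" and s: "realizes C X B G \<sigma>" using coherent_realized[OF G] .
  note aF = coherent_additive[OF F] and aG = coherent_additive[OF G]
  obtain f where f: "f \<in> Hom C A B" "\<And>Y x. \<lbrakk>Y \<in> X; x \<in> Hom C Y A\<rbrakk> \<Longrightarrow> \<eta> Y (\<rho> Y x) = \<sigma> Y (f \<cdot> x)"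
    using realized_arrow_full[OF A B r aF s n] by blast
  obtain P p where P: "P \<in> X" and p: "p \<in> Hom C P A" 
    and pw: "\<And>Y y. \<lbrakk>Y\<in>X; y \<in> Hom C Y A\<rbrakk> \<Longrightarrow> \<exists>x \<in> Hom C Y P. y = p \<cdot> x"
    using approximation[OF A(2)] by blast
  note fp = Comp_closed[OF p f(1)]
  obtain E' c where c: "c \<in> Hom C B E'" "c \<cdot> (f \<cdot> p) = Zero C P E'"
    and cs: "\<And>Y y. \<lbrakk>Y\<in>X; y \<in> Hom C Y E'\<rbrakk> \<Longrightarrow> \<exists>x \<in> Hom C Y B. y = c \<cdot> x"
    and ck: "\<And>Y x. \<lbrakk>Y\<in>X; x \<in> Hom C Y B; c \<cdot> x = Zero C Y E'\<rbrakk> \<Longrightarrow> \<exists>z \<in> Hom C Y P. x = (f \<cdot> p) \<cdot> z"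
    using weak_cokernel[OF fp P] by blast
  note E' = Hom_objs(2)[OF c(1)]
  obtain E :: "('o, 'm, 'g) ab_functor" and \<tau> where E: "coherent C X E" and t: "realizes C X E' E \<tau>" 
    using ex_realization[OF E'] .
  note aE = coherent_additive[OF E]
  let ?\<gamma> = "\<lambda>Y z. \<tau> Y (c \<cdot> inv_into (Hom C Y B) (\<sigma> Y) z)"
  have \<gamma>: "?\<gamma> Y (\<sigma> Y x) = \<tau> Y (c \<cdot> x)" if "Y \<in> X" "x \<in> Hom C Y B" for Y x
    using realizes_inv[OF s that] by simp
  note n\<gamma> = realized_arrow_natural[OF s t c(1)]
  show ?thesis
  proof (rule that[OF E n\<gamma>])
    fix Y assume Y: "Y \<in> X"
    show "?\<gamma> Y ` carrier (On_obj G Y) = carrier (On_obj E Y)"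
    proof (intro equalityI subsetI)
      fix w assume "w \<in> ?\<gamma> Y ` carrier (On_obj G Y)"
      then show "w \<in> carrier (On_obj E Y)" using natural_transformationD(2)[OF n\<gamma> Y] by blast
    next
      fix w assume "w \<in> carrier (On_obj E Y)"
      then obtain y where y: "y \<in> Hom C Y E'" "w = \<tau> Y y" using realizes_surj[OF t Y] by blast
      obtain x where x: "x \<in> Hom C Y B" "y = c \<cdot> x" using cs[OF Y y(1)] by blast
      have "w = ?\<gamma> Y (\<sigma> Y x)" using \<gamma>[OF Y x(1)] x(2) y(2) by simp
      then show "w \<in> ?\<gamma> Y ` carrier (On_obj G Y)" using realizes_closed[OF s Y x(1)] by blast
    qed
    show "\<eta> Y ` carrier (On_obj F Y) = kernel (On_obj G Y) (On_obj E Y) (?\<gamma> Y)"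
    proof (intro equalityI subsetI)
      fix w assume "w \<in> \<eta> Y ` carrier (On_obj F Y)"
      then obtain z where z: "z \<in> carrier (On_obj F Y)" "w = \<eta> Y z" by blast
      obtain x where x: "x \<in> Hom C Y A" "z = \<rho> Y x" using realizes_surj[OF r Y z(1)] .
      have fx: "f \<cdot> x \<in> Hom C Y B" using Comp_closed[OF x(1) f(1)] .
      have w: "w = \<sigma> Y (f \<cdot> x)" using f(2)[OF Y x(1)] z(2) x(2) by simp
      obtain y where y: "y \<in> Hom C Y P" "x = p \<cdot> y" using pw[OF Y x(1)] by blast
      have "c \<cdot> (f \<cdot> x) = Zero C Y E'"
        using y(2) Comp_assoc[OF y(1) p f(1)] Comp_assoc[OF y(1) fp c(1)] c(2) 
          Comp_Zero_left[OF y(1) E'] by simp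
      then have "?\<gamma> Y w = \<one>\<^bsub>On_obj E Y\<^esub>"
        using \<gamma>[OF Y fx] realizes_Zero[OF t aE E' Y] w by simp
      then show "w \<in> kernel (On_obj G Y) (On_obj E Y) (?\<gamma> Y)"
        unfolding kernel_def using realizes_closed[OF s Y fx] w by simp
    next
      fix w assume "w \<in> kernel (On_obj G Y) (On_obj E Y) (?\<gamma> Y)"
      then have w: "w \<in> carrier (On_obj G Y)" "?\<gamma> Y w = \<one>\<^bsub>On_obj E Y\<^esub>" unfolding kernel_def by auto
      obtain x where x: "x \<in> Hom C Y B" "w = \<sigma> Y x" using realizes_surj[OF s Y w(1)] .
      have "c \<cdot> x = Zero C Y E'"
        using w(2) \<gamma>[OF Y x(1)] x(2) realizes_eq_one_iff[OF t aE Y Comp_closed[OF x(1) c(1)]] by simp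
      then obtain y where y: "y \<in> Hom C Y P" "x = (f \<cdot> p) \<cdot> y" using ck[OF Y x(1)] by blast
      note py = Comp_closed[OF y(1) p]
      have "w = \<eta> Y (\<rho> Y (p \<cdot> y))"
        using f(2)[OF Y py] Comp_assoc[OF y(1) p f(1)] x(2) y(2) by simp
      then show "w \<in> \<eta> Y ` carrier (On_obj F Y)" using realizes_closed[OF r Y py] by blast
    qed
  qed
qed

interpretation M: preadditive_category M by (rule preadditive_mod_category)

text \<open>The inclusion of the pointwise kernel and the zero map have the same composite with a
  monic arrow, so this kernel is trivial. It is essential here that the pointwise kernel is itself a
  coherent functor.\<close>

lemma pointwise_inj_if_monic:
  fixes F G :: "('o, 'm, 'g) ab_functor"
  assumes F: "coherent C X F" and G: "coherent C X G" and n: "natural_transformation C X F G \<eta>"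
    and m: "monic M (trans_arrow X F G \<eta>)" and Y: "Y \<in> X"
  shows "inj_on (\<eta> Y) (carrier (On_obj F Y))"
proof -
  obtain K :: "('o, 'm, 'g) ab_functor" and \<kappa> where K: "coherent C X K" "natural_transformation C X K F \<kappa>"
    "\<And>Y. Y \<in> X \<Longrightarrow> \<kappa> Y ` carrier (On_obj K Y) = kernel (On_obj F Y) (On_obj G Y) (\<eta> Y)"
    using ex_pointwise_kernel[OF F G n] by metis
  let ?k = "trans_arrow X K F \<kappa>" and ?e = "trans_arrow X F G \<eta>"
  have k: "?k \<in> Hom M K F" and e: "?e \<in> Hom M F G" by (intro Hom_mod_categoryI F G K n)+
  have KO: "K \<in> Obj M" "F \<in> Obj M" "G \<in> Obj M" using K F G by (simp_all add: Obj_mod_category)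
  have "?e \<cdot>\<^bsub>M\<^esub> ?k = Zero M K G"
    unfolding Comp_trans_arrow[OF K(2)] Zero_mod_category trans_arrow_eq_iff
    using K(3) unfolding kernel_def by blast
  then have "?e \<cdot>\<^bsub>M\<^esub> ?k = ?e \<cdot>\<^bsub>M\<^esub> Zero M K F" using M.Comp_Zero_right[OF e KO(1)] by metis
  then have "?k = Zero M K F"
    by (rule M.monicD[OF m e k M.Zero_closed[OF KO(1,2)]])
  then have "\<kappa> Y z = \<one>\<^bsub>On_obj F Y\<^esub>" if "z \<in> carrier (On_obj K Y)" for z
    unfolding Zero_mod_category trans_arrow_eq_iff using that Y by simp
  then have "kernel (On_obj F Y) (On_obj G Y) (\<eta> Y) \<subseteq> {\<one>\<^bsub>On_obj F Y\<^esub>}" 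
    unfolding K(3)[OF Y, symmetric] by auto
  then show ?thesis
    using group_hom.inj_on_one_iff[OF group_hom_of_natural_transformation[OF 
          coherent_additive[OF F] coherent_additive[OF G] n Y]] unfolding kernel_def by blast
qed

lemma pointwise_surj_if_epic:
  fixes F G :: "('o, 'm, 'g) ab_functor"
  assumes F: "coherent C X F" and G: "coherent C X G" and n: "natural_transformation C X F G \<eta>"
    and m: "epic M (trans_arrow X F G \<eta>)" and Y: "Y \<in> X"
  shows "\<eta> Y ` carrier (On_obj F Y) = carrier (On_obj G Y)"
proof -
  obtain E :: "('o, 'm, 'g) ab_functor" and \<gamma> where E: "coherent C X E" "natural_transformation C X G E \<gamma>"
    "\<And>Y. Y \<in> X \<Longrightarrow> \<eta> Y ` carrier (On_obj F Y) = kernel (On_obj G Y) (On_obj E Y) (\<gamma> Y)"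
    using ex_pointwise_cokernel[OF F G n] by metis
  let ?c = "trans_arrow X G E \<gamma>" and ?e = "trans_arrow X F G \<eta>"
  have c: "?c \<in> Hom M G E" and e: "?e \<in> Hom M F G" by (intro Hom_mod_categoryI F G E n)+
  have EO: "E \<in> Obj M" "G \<in> Obj M" using E G by (simp_all add: Obj_mod_category)
  have "?c \<cdot>\<^bsub>M\<^esub> ?e = Zero M F E"
    unfolding Comp_trans_arrow[OF n] Zero_mod_category trans_arrow_eq_iff
    using E(3) unfolding kernel_def by blast
  then have "?c \<cdot>\<^bsub>M\<^esub> ?e = Zero M G E \<cdot>\<^bsub>M\<^esub> ?e" using M.Comp_Zero_left[OF e EO(1)] by metis
  then have "?c = Zero M G E"
    by (rule M.epicD[OF m e c M.Zero_closed[OF EO(2,1)]])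
  then have "\<gamma> Y z = \<one>\<^bsub>On_obj E Y\<^esub>" if "z \<in> carrier (On_obj G Y)" for z
    unfolding Zero_mod_category trans_arrow_eq_iff using that Y by simp
  then show ?thesis unfolding E(3)[OF Y] kernel_def by auto
qed

text \<open>The equations of a direct sum in \<open>C\<close> involve only identities, zeros, sums
  and composites, all of which \<open>realized_arrow\<close> respects. A copy of \<open>H S\<close>
  is therefore a direct sum of \<open>F\<close> and \<open>G\<close>.\<close>

lemma direct_sum_mod_category:
  fixes F G :: "('o, 'm, 'g) ab_functor"
  assumes F: "coherent C X F" and G: "coherent C X G"
  shows "\<exists>H. direct_sum M F G H"
proof -
  obtain A \<rho> where A: "A \<in> Obj C" and r: "realizes C X A F \<rho>" using coherent_realized[OF F] .
  obtain B \<sigma> where B: "B \<in> Obj C" and s: "realizes C X B G \<sigma>" using coherent_realized[OF G] .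
  obtain S where "direct_sum C A B S" using ex_direct_sum[OF A B] by blast
  then obtain i j p q where S: "S \<in> Obj C" and 
    i: "i \<in> Hom C A S" and j: "j \<in> Hom C B S" and p: "p \<in> Hom C S A" and q: "q \<in> Hom C S B" and
    e: "p \<cdot> i = Ident C A" "q \<cdot> j = Ident C B" "p \<cdot> j = Zero C B A" "q \<cdot> i = Zero C A B"
       "Add C (i \<cdot> p) (j \<cdot> q) = Ident C S"
    unfolding direct_sum_def by blast
  obtain H :: "('o, 'm, 'g) ab_functor" and \<tau> where H: "coherent C X H" and t: "realizes C X S H \<tau>"
    using ex_realization[OF S] .
  have O: "F \<in> Obj M" "G \<in> Obj M" "H \<in> Obj M" using F G H by (simp_all add: Obj_mod_category)
  note a = coherent_additive[OF F] coherent_additive[OF G] coherent_additive[OF H]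
  let ?i = "realized_arrow C X A F \<rho> H \<tau> i" and ?j = "realized_arrow C X B G \<sigma> H \<tau> j"
  let ?p = "realized_arrow C X S H \<tau> F \<rho> p" and ?q = "realized_arrow C X S H \<tau> G \<sigma> q"
  have "direct_sum M F G H"
    unfolding direct_sum_def
  proof (intro conjI O, rule bexI[of _ ?i], rule bexI[of _ ?j], rule bexI[of _ ?p], rule bexI[of _ ?q],
      intro conjI)
    show "?p \<cdot>\<^bsub>M\<^esub> ?i = Ident M F"
      unfolding realized_arrow_Comp[OF r t i p] e realized_arrow_Ident[OF r] ..
    show "?q \<cdot>\<^bsub>M\<^esub> ?j = Ident M G"
      unfolding realized_arrow_Comp[OF s t j q] e realized_arrow_Ident[OF s] ..
    show "?p \<cdot>\<^bsub>M\<^esub> ?j = Zero M G F"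
      unfolding realized_arrow_Comp[OF s t j p] e realized_arrow_Zero[OF s r a(1) A] ..
    show "?q \<cdot>\<^bsub>M\<^esub> ?i = Zero M F G"
      unfolding realized_arrow_Comp[OF r t i q] e realized_arrow_Zero[OF r s a(2) B] ..
    show "Add M (?i \<cdot>\<^bsub>M\<^esub> ?p) (?j \<cdot>\<^bsub>M\<^esub> ?q) = Ident M H"
      unfolding realized_arrow_Comp[OF t r p i] realized_arrow_Comp[OF t s q j] 
        realized_arrow_Add[OF t t Comp_closed[OF p i] Comp_closed[OF q j]] e realized_arrow_Ident[OF t] ..
    show "?i \<in> Hom M F H" by (rule realized_arrow_Hom[OF r F t H i])
    show "?j \<in> Hom M G H" by (rule realized_arrow_Hom[OF s G t H j])
    show "?p \<in> Hom M H F" by (rule realized_arrow_Hom[OF t H r F p])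
    show "?q \<in> Hom M H G" by (rule realized_arrow_Hom[OF t H s G q])
  qed
  then show ?thesis ..
qed

lemma zero_object_mod_category: "\<exists>Z. zero_object M Z"
proof -
  obtain Z where Z: "zero_object C Z" using ex_zero_object by blast
  then have ZO: "Z \<in> Obj C" unfolding zero_object_def by blast
  obtain F :: "('o, 'm, 'g) ab_functor" and \<rho> where F: "coherent C X F" and r: "realizes C X Z F \<rho>"
    using ex_realization[OF ZO] .
  have "Ident M F = Zero M F F"
    using realized_arrow_Ident[OF r] realized_arrow_Zero[OF r r coherent_additive[OF F] ZO]
      zero_objectD(1)[OF Z Ident_closed[OF ZO]] by simp
  then show ?thesis using M.zero_object_if_Ident_Zero F by (auto simp: Obj_mod_category)
qed

text \<open>A monic transformation is pointwise injective, so the exactness of its pointwise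
  cokernel exhibits it as the kernel of that cokernel. Dually, an epic transformation is the
  cokernel of its pointwise kernel.\<close>

theorem abelian_mod_category: "abelian_category M"
proof (intro abelian_category.intro additive_category.intro preadditive_mod_category
    additive_category_axioms.intro abelian_category_axioms.intro)
  show "\<exists>Z. zero_object M Z" by (rule zero_object_mod_category)
  show "\<exists>S. direct_sum M F G S" if "F \<in> Obj M" "G \<in> Obj M" for F G
    using that direct_sum_mod_category by (simp add: Obj_mod_category)
next
  fix \<phi> assume "\<phi> \<in> Arr M"
  then have "\<phi> \<in> Hom M (Dom M \<phi>) (Cod M \<phi>)" by (simp add: Hom_iff)
  then obtain F G \<eta> where F: "coherent C X F" and G: "coherent C X G" 
    and n: "natural_transformation C X F G \<eta>" and \<phi>: "\<phi> = trans_arrow X F G \<eta>"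
    by (elim Hom_mod_categoryE)
  show "\<exists>k. is_kernel M k \<phi>"
  proof -
    obtain K :: "('o, 'm, 'g) ab_functor" and \<kappa> where K: "coherent C X K" "natural_transformation C X K F \<kappa>"
      "\<And>Y. Y \<in> X \<Longrightarrow> inj_on (\<kappa> Y) (carrier (On_obj K Y))"
      "\<And>Y. Y \<in> X \<Longrightarrow> \<kappa> Y ` carrier (On_obj K Y) = kernel (On_obj F Y) (On_obj G Y) (\<eta> Y)"
      using ex_pointwise_kernel[OF F G n] by metis
    show ?thesis unfolding \<phi> using is_kernel_mod_category[OF K(1) F G K(2) n K(3,4)] by blast
  qed
  obtain E :: "('o, 'm, 'g) ab_functor" and \<gamma> where E: "coherent C X E" "natural_transformation C X G E \<gamma>"
      "\<And>Y. Y \<in> X \<Longrightarrow> \<gamma> Y ` carrier (On_obj G Y) = carrier (On_obj E Y)"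
      "\<And>Y. Y \<in> X \<Longrightarrow> \<eta> Y ` carrier (On_obj F Y) = kernel (On_obj G Y) (On_obj E Y) (\<gamma> Y)"
    using ex_pointwise_cokernel[OF F G n] by metis
  show "\<exists>c. is_cokernel M c \<phi>"
    unfolding \<phi> using is_cokernel_mod_category[OF F G E(1) n E(2-4)] by blast
next
  fix \<phi> assume m: "monic M \<phi>"
  then have "\<phi> \<in> Hom M (Dom M \<phi>) (Cod M \<phi>)" by (simp add: Hom_iff monic_def)
  then obtain F G \<eta> where F: "coherent C X F" and G: "coherent C X G" 
    and n: "natural_transformation C X F G \<eta>" and \<phi>: "\<phi> = trans_arrow X F G \<eta>"
    by (elim Hom_mod_categoryE)
  obtain E :: "('o, 'm, 'g) ab_functor" and \<gamma> where E: "coherent C X E" "natural_transformation C X G E \<gamma>"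
      "\<And>Y. Y \<in> X \<Longrightarrow> \<eta> Y ` carrier (On_obj F Y) = kernel (On_obj G Y) (On_obj E Y) (\<gamma> Y)"
    using ex_pointwise_cokernel[OF F G n] by metis
  show "\<exists>g. is_kernel M \<phi> g"
    unfolding \<phi> using is_kernel_mod_category[OF F G E(1) n E(2) pointwise_inj_if_monic[OF F G n] E(3)] 
      m \<phi> by blast
next
  fix \<phi> assume m: "epic M \<phi>"
  then have "\<phi> \<in> Hom M (Dom M \<phi>) (Cod M \<phi>)" by (simp add: Hom_iff epic_def)
  then obtain F G \<eta> where F: "coherent C X F" and G: "coherent C X G" 
    and n: "natural_transformation C X F G \<eta>" and \<phi>: "\<phi> = trans_arrow X F G \<eta>"
    by (elim Hom_mod_categoryE)
  obtain K :: "('o, 'm, 'g) ab_functor" and \<kappa> where K: "coherent C X K" "natural_transformation C X K F \<kappa>"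
      "\<And>Y. Y \<in> X \<Longrightarrow> \<kappa> Y ` carrier (On_obj K Y) = kernel (On_obj F Y) (On_obj G Y) (\<eta> Y)"
    using ex_pointwise_kernel[OF F G n] by metis
  show "\<exists>g. is_cokernel M \<phi> g"
    unfolding \<phi> using is_cokernel_mod_category[OF K(1) F G K(2) n pointwise_surj_if_epic[OF F G n] K(3)] 
      m \<phi> by blast
qed

end

section \<open>The factor category\<close>

context category
begin

text \<open>These parts of a calculus of fractions hold for regular arrows of any category, and
  cancellation is part of being monic and epic. What remains specific to the factor category are the
  Ore conditions.\<close>

lemma regular_arrows_calculus_basics:
  shows "regular_arrows C \<subseteq> Arr C" "A \<in> Obj C \<Longrightarrow> Ident C A \<in> regular_arrows C"
    and "\<lbrakk>s \<in> regular_arrows C; t \<in> regular_arrows C; Dom C t = Cod C s\<rbrakk> \<Longrightarrow> t \<cdot> s \<in> regular_arrows C"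
proof -
  show "regular_arrows C \<subseteq> Arr C" unfolding regular_arrows_def monic_def by blast
  show "Ident C A \<in> regular_arrows C" if A: "A \<in> Obj C"
    using monic_iff[OF Ident_closed[OF A]] epic_iff[OF Ident_closed[OF A]] Comp_Ident_left Comp_Ident_right
    unfolding regular_arrows_def by simp
  assume st: "s \<in> regular_arrows C" "t \<in> regular_arrows C" "Dom C t = Cod C s"
  define A B D where "A = Dom C s" and "B = Cod C s" and "D = Cod C t"
  have s: "s \<in> Hom C A B" and t: "t \<in> Hom C B D"
    using st unfolding A_def B_def D_def regular_arrows_def monic_def Hom_iff by simp_all
  note ts = Comp_closed[OF s t]
  have m: "monic C s" "monic C t" "epic C s" "epic C t" using st unfolding regular_arrows_def by auto
  have "monic C (t \<cdot> s)"
    unfolding monic_iff[OF ts]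
  proof (intro allI ballI impI)
    fix E g h assume g: "g \<in> Hom C E A" and h: "h \<in> Hom C E A" and e: "(t \<cdot> s) \<cdot> g = (t \<cdot> s) \<cdot> h"
    have "t \<cdot> (s \<cdot> g) = t \<cdot> (s \<cdot> h)" using e Comp_assoc[OF g s t] Comp_assoc[OF h s t] by simp
    then have "s \<cdot> g = s \<cdot> h"
      using m(2)[unfolded monic_iff[OF t]] Comp_closed[OF g s] Comp_closed[OF h s] by blast
    then show "g = h" using m(1)[unfolded monic_iff[OF s]] g h by blast
  qed
  moreover have "epic C (t \<cdot> s)"
    unfolding epic_iff[OF ts]
  proof (intro allI ballI impI)
    fix E g h assume g: "g \<in> Hom C D E" and h: "h \<in> Hom C D E" and e: "g \<cdot> (t \<cdot> s) = h \<cdot> (t \<cdot> s)"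
    have "(g \<cdot> t) \<cdot> s = (h \<cdot> t) \<cdot> s" using e Comp_assoc[OF s t g] Comp_assoc[OF s t h] by simp
    then have "g \<cdot> t = h \<cdot> t"
      using m(3)[unfolded epic_iff[OF s]] Comp_closed[OF t g] Comp_closed[OF t h] by blast
    then show "g = h" using m(4)[unfolded epic_iff[OF t]] g h by blast
  qed
  ultimately show "t \<cdot> s \<in> regular_arrows C" unfolding regular_arrows_def by blast
qed

end

section \<open>The factor category seen through maps from \<open>X\<close>\<close>

context weak_cokernel_category
begin

abbreviation Q :: "('o, 'o \<times> 'o \<times> 'm set) cat" where
  "Q \<equiv> factor_category C (right_perp C X)"

abbreviation R :: "('o \<times> 'o \<times> 'm set) set" where
  "R \<equiv> regular_arrows Q"

text \<open>The class of \<open>f\<close> under the congruence induced by \<open>H\<close>. It turns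
  out to be the coset of \<open>f\<close> in the factor category, and it replaces factorizations by
  equations between composites.\<close>

definition agreeing :: "'o \<Rightarrow> 'o \<Rightarrow> 'm \<Rightarrow> 'm set" where
  "agreeing A B f = {g \<in> Hom C A B. \<forall>Y\<in>X. \<forall>y\<in>Hom C Y A. g \<cdot> y = f \<cdot> y}"

text \<open>
  A map that vanishes on \<open>X\<close> factors through the weak cokernel of an approximation \<open>P \<rightarrow> A\<close>, which
  lies in \<open>X\<bottom>\<close>.
\<close>

lemma factoring_right_perp:
  assumes A: "A \<in> Obj C" and B: "B \<in> Obj C"
  shows "factoring C (right_perp C X) A B = agreeing A B (Zero C A B)"
proof (intro equalityI subsetI)
  fix f assume "f \<in> factoring C (right_perp C X) A B"
  then obtain D g h where D: "D \<in> right_perp C X" and g: "g \<in> Hom C A D" and h: "h \<in> Hom C D B" 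
    and f: "f = h \<cdot> g"
    unfolding factoring_def by blast
  have "f \<cdot> y = Zero C A B \<cdot> y" if Y: "Y \<in> X" and y: "y \<in> Hom C Y A" for Y y
  proof -
    have "g \<cdot> y = Zero C Y D" using D Comp_closed[OF y g] Y unfolding right_perp_def by blast
    then show ?thesis 
      using f Comp_assoc[OF y g h] Comp_Zero_right[OF h X_Obj'[OF Y]] Comp_Zero_left[OF y B] by simp
  qed
  then show "f \<in> agreeing A B (Zero C A B)" 
    unfolding agreeing_def using Comp_closed[OF g h] f by simp
next
  fix f assume "f \<in> agreeing A B (Zero C A B)"
  then have f: "f \<in> Hom C A B" and fz: "\<And>Y y. \<lbrakk>Y \<in> X; y \<in> Hom C Y A\<rbrakk> \<Longrightarrow> f \<cdot> y = Zero C Y B"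
    unfolding agreeing_def using Comp_Zero_left[OF _ B] by auto
  obtain P p where P: "P \<in> X" and p: "p \<in> Hom C P A" 
    and pw: "\<And>Y y. \<lbrakk>Y\<in>X; y \<in> Hom C Y A\<rbrakk> \<Longrightarrow> \<exists>x \<in> Hom C Y P. y = p \<cdot> x"
    using approximation[OF A] by blast
  obtain E c where c: "c \<in> Hom C A E" "c \<cdot> p = Zero C P E"
    and w: "\<And>D g. \<lbrakk>g \<in> Hom C A D; g \<cdot> p = Zero C P D\<rbrakk> \<Longrightarrow> \<exists>h \<in> Hom C E D. g = h \<cdot> c"
    and cs: "\<And>Y y. \<lbrakk>Y\<in>X; y \<in> Hom C Y E\<rbrakk> \<Longrightarrow> \<exists>x \<in> Hom C Y A. y = c \<cdot> x"
    using weak_cokernel[OF p P] by blast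
  note E = Hom_objs(2)[OF c(1)]
  have "y = Zero C Y E" if Y: "Y \<in> X" and y: "y \<in> Hom C Y E" for Y y
  proof -
    obtain x where x: "x \<in> Hom C Y A" "y = c \<cdot> x" using cs[OF Y y] by blast
    obtain z where z: "z \<in> Hom C Y P" "x = p \<cdot> z" using pw[OF Y x(1)] by blast
    show ?thesis using x(2) z(2) Comp_assoc[OF z(1) p c(1)] c(2) Comp_Zero_left[OF z(1) E] by simp
  qed
  then have "E \<in> right_perp C X"
    unfolding right_perp_def using E Zero_closed[OF X_Obj' E] by blast
  moreover obtain h where "h \<in> Hom C E B" "f = h \<cdot> c" using w[OF f fz[OF P p]] by blast
  ultimately show "f \<in> factoring C (right_perp C X) A B"
    unfolding factoring_def using c(1) by blast
qed

text \<open>Two maps lie in the same coset when their difference vanishes on \<open>X\<close>, which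
  by additivity means that they have the same composites with all maps from
  \<open>X\<close>.\<close>

lemma factoring_coset:
  assumes f: "f \<in> Hom C A B"
  shows "factoring C (right_perp C X) A B #>\<^bsub>hom_group C A B\<^esub> f = agreeing A B f"
proof -
  note A = Hom_objs(1)[OF f] and B = Hom_objs(2)[OF f]
  have "(\<exists>n\<in>agreeing A B (Zero C A B). g = Add C n f) \<longleftrightarrow> g \<in> agreeing A B f" for g
  proof
    assume "\<exists>n\<in>agreeing A B (Zero C A B). g = Add C n f"
    then obtain n where n: "n \<in> Hom C A B" and nz: "\<And>Y y. \<lbrakk>Y \<in> X; y \<in> Hom C Y A\<rbrakk> \<Longrightarrow> n \<cdot> y = Zero C Y B"
      and g: "g = Add C n f"
      unfolding agreeing_def using Comp_Zero_left[OF _ B] by auto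
    have "g \<cdot> y = f \<cdot> y" if "Y \<in> X" "y \<in> Hom C Y A" for Y y
      using Comp_Add_left[OF that(2) n f] nz[OF that] Add_Zero_left[OF Comp_closed[OF that(2) f]] g by simp
    then show "g \<in> agreeing A B f" unfolding agreeing_def using g Add_closed[OF n f] by simp
  next
    assume "g \<in> agreeing A B f"
    then have g: "g \<in> Hom C A B" and gf: "\<And>Y y. \<lbrakk>Y \<in> X; y \<in> Hom C Y A\<rbrakk> \<Longrightarrow> g \<cdot> y = f \<cdot> y"
      unfolding agreeing_def by auto
    let ?n = "Add C g (Neg C f)"
    note nf = Neg_closed[OF f]
    have "?n \<cdot> y = Zero C A B \<cdot> y" if "Y \<in> X" "y \<in> Hom C Y A" for Y y
      using Comp_Add_left[OF that(2) g nf] Comp_Neg_left[OF that(2) f] gf[OF that] 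
        Add_Neg[OF Comp_closed[OF that(2) f]] Comp_Zero_left[OF that(2) B] by simp
    then have "?n \<in> agreeing A B (Zero C A B)" unfolding agreeing_def using Add_closed[OF g nf] by simp
    then show "\<exists>n\<in>agreeing A B (Zero C A B). g = Add C n f" 
      using Add_Neg_cancel[OF g f] by (intro bexI[of _ ?n]) simp_all
  qed
  then show ?thesis unfolding factoring_right_perp[OF A B] r_coset_def by auto
qed

definition quot_arrow :: "'o \<Rightarrow> 'o \<Rightarrow> 'm \<Rightarrow> 'o \<times> 'o \<times> 'm set" where
  "quot_arrow A B f = (A, B, agreeing A B f)"

lemma quot_arrow_eq_iff:
  assumes "f \<in> Hom C A B" "g \<in> Hom C A B"
  shows "quot_arrow A B f = quot_arrow A B g \<longleftrightarrow> (\<forall>Y\<in>X. \<forall>y\<in>Hom C Y A. f \<cdot> y = g \<cdot> y)"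
proof
  assume "quot_arrow A B f = quot_arrow A B g"
  moreover have "f \<in> agreeing A B f" using assms unfolding agreeing_def by simp
  ultimately show "\<forall>Y\<in>X. \<forall>y\<in>Hom C Y A. f \<cdot> y = g \<cdot> y" unfolding quot_arrow_def agreeing_def by simp
next
  assume "\<forall>Y\<in>X. \<forall>y\<in>Hom C Y A. f \<cdot> y = g \<cdot> y"
  then show "quot_arrow A B f = quot_arrow A B g"
    unfolding quot_arrow_def agreeing_def by auto
qed

lemma Obj_Q: "Obj Q = Obj C"
  by (simp add: factor_category_def)

lemma Hom_Q: "\<phi> \<in> Hom Q A B \<longleftrightarrow> (\<exists>f\<in>Hom C A B. \<phi> = quot_arrow A B f)"
proof -
  have "c \<in> carrier (hom_group C A B Mod factoring C (right_perp C X) A B) \<longleftrightarrow>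
      (\<exists>f\<in>Hom C A B. c = agreeing A B f)" for c
    unfolding FactGroup_def RCOSETS_def using factoring_coset by auto
  then show ?thesis
    unfolding quot_arrow_def using Hom_objs[of _ A B] by (auto simp: Hom_def factor_category_def)
qed

lemma quot_arrow_Hom: "f \<in> Hom C A B \<Longrightarrow> quot_arrow A B f \<in> Hom Q A B"
  unfolding Hom_Q by blast

lemma Comp_quot_arrow:
  assumes f: "f \<in> Hom C A B" and g: "g \<in> Hom C B D"
  shows "quot_arrow B D g \<cdot>\<^bsub>Q\<^esub> quot_arrow A B f = quot_arrow A D (g \<cdot> f)"
proof -
  note gf = Comp_closed[OF f g]
  have coset: "factoring C (right_perp C X) A D #>\<^bsub>hom_group C A D\<^esub> (g' \<cdot> f') = agreeing A D (g \<cdot> f)"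
    if g': "g' \<in> agreeing B D g" and f': "f' \<in> agreeing A B f" for g' f'
  proof -
    have f'h: "f' \<in> Hom C A B" and g'h: "g' \<in> Hom C B D" using f' g' unfolding agreeing_def by auto
    have "(g' \<cdot> f') \<cdot> y = (g \<cdot> f) \<cdot> y" if "Y \<in> X" "y \<in> Hom C Y A" for Y y
      using f' g' that Comp_closed[OF that(2) f] Comp_assoc[OF that(2) f'h g'h] Comp_assoc[OF that(2) f g]
      unfolding agreeing_def by auto
    then have "agreeing A D (g' \<cdot> f') = agreeing A D (g \<cdot> f)" unfolding agreeing_def by auto
    then show ?thesis using factoring_coset[OF Comp_closed[OF f'h g'h]] by simp
  qed
  have "f \<in> agreeing A B f" "g \<in> agreeing B D g" using f g unfolding agreeing_def by auto
  then have "(\<Union>g'\<in>agreeing B D g. \<Union>f'\<in>agreeing A B f. 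
      factoring C (right_perp C X) A D #>\<^bsub>hom_group C A D\<^esub> (g' \<cdot> f')) = agreeing A D (g \<cdot> f)"
    using coset by blast
  then show ?thesis unfolding quot_arrow_def by (simp add: factor_category_def)
qed

lemma Ident_Q: "A \<in> Obj C \<Longrightarrow> Ident Q A = quot_arrow A A (Ident C A)"
  unfolding quot_arrow_def using factoring_coset[OF Ident_closed] by (simp add: factor_category_def)

lemma category_Q: "category Q"
proof
  fix \<phi> assume "\<phi> \<in> Arr Q"
  then have "\<phi> \<in> Hom Q (Dom Q \<phi>) (Cod Q \<phi>)" by (simp add: Hom_iff)
  then show "Dom Q \<phi> \<in> Obj Q" "Cod Q \<phi> \<in> Obj Q" unfolding Hom_Q Obj_Q using Hom_objs by blast+
next
  fix A assume "A \<in> Obj Q"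
  then show "Ident Q A \<in> Hom Q A A"
    using quot_arrow_Hom[OF Ident_closed] by (simp add: Obj_Q Ident_Q)
next
  fix \<phi> \<psi> A B D assume "\<phi> \<in> Hom Q A B" "\<psi> \<in> Hom Q B D"
  then obtain f g where fg: "f \<in> Hom C A B" "\<phi> = quot_arrow A B f" "g \<in> Hom C B D" "\<psi> = quot_arrow B D g"
    unfolding Hom_Q by blast
  show "\<psi> \<cdot>\<^bsub>Q\<^esub> \<phi> \<in> Hom Q A D"
    unfolding fg(2,4) Comp_quot_arrow[OF fg(1,3)] by (rule quot_arrow_Hom[OF Comp_closed[OF fg(1,3)]])
next
  fix \<phi> A B assume "\<phi> \<in> Hom Q A B"
  then obtain f where f: "f \<in> Hom C A B" "\<phi> = quot_arrow A B f" unfolding Hom_Q by blast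
  note o = Hom_objs[OF f(1)]
  show "\<phi> \<cdot>\<^bsub>Q\<^esub> Ident Q A = \<phi>"
    unfolding f(2) Ident_Q[OF o(1)] Comp_quot_arrow[OF Ident_closed[OF o(1)] f(1)] Comp_Ident_right[OF f(1)] ..
  show "Ident Q B \<cdot>\<^bsub>Q\<^esub> \<phi> = \<phi>"
    unfolding f(2) Ident_Q[OF o(2)] Comp_quot_arrow[OF f(1) Ident_closed[OF o(2)]] Comp_Ident_left[OF f(1)] ..
next
  fix \<phi> \<psi> \<chi> A B D E assume "\<phi> \<in> Hom Q A B" "\<psi> \<in> Hom Q B D" "\<chi> \<in> Hom Q D E"
  then obtain f g h where f: "f \<in> Hom C A B" "\<phi> = quot_arrow A B f" and g: "g \<in> Hom C B D" "\<psi> = quot_arrow B D g"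
    and h: "h \<in> Hom C D E" "\<chi> = quot_arrow D E h"
    unfolding Hom_Q by blast
  show "\<chi> \<cdot>\<^bsub>Q\<^esub> (\<psi> \<cdot>\<^bsub>Q\<^esub> \<phi>) = (\<chi> \<cdot>\<^bsub>Q\<^esub> \<psi>) \<cdot>\<^bsub>Q\<^esub> \<phi>"
    unfolding f(2) g(2) h(2) Comp_quot_arrow[OF f(1) g(1)] Comp_quot_arrow[OF g(1) h(1)]
      Comp_quot_arrow[OF Comp_closed[OF f(1) g(1)] h(1)] Comp_quot_arrow[OF f(1) Comp_closed[OF g(1) h(1)]]
      Comp_assoc[OF f(1) g(1) h(1)] ..
qed

interpretation Q: category Q by (rule category_Q)

section \<open>Regular morphisms and the calculus of fractions\<close>

text \<open>Objects \<open>Y\<close> of \<open>X\<close> detect monomorphisms. Maps out of such a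
  \<open>Y\<close> are not identified by the factor category, so cancellation in the quotient is
  cancellation in \<open>C\<close>.\<close>

lemma monic_quot_arrow_iff:
  assumes f: "f \<in> Hom C A B"
  shows "monic Q (quot_arrow A B f) \<longleftrightarrow> 
    (\<forall>Y\<in>X. \<forall>x\<in>Hom C Y A. \<forall>x'\<in>Hom C Y A. f \<cdot> x = f \<cdot> x' \<longrightarrow> x = x')"
proof
  assume m: "monic Q (quot_arrow A B f)"
  show "\<forall>Y\<in>X. \<forall>x\<in>Hom C Y A. \<forall>x'\<in>Hom C Y A. f \<cdot> x = f \<cdot> x' \<longrightarrow> x = x'"
  proof (intro ballI impI)
    fix Y x x' assume Y: "Y \<in> X" and x: "x \<in> Hom C Y A" and x': "x' \<in> Hom C Y A" and e: "f \<cdot> x = f \<cdot> x'"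
    have "quot_arrow A B f \<cdot>\<^bsub>Q\<^esub> quot_arrow Y A x = quot_arrow A B f \<cdot>\<^bsub>Q\<^esub> quot_arrow Y A x'"
      unfolding Comp_quot_arrow[OF x f] Comp_quot_arrow[OF x' f] e ..
    then have "quot_arrow Y A x = quot_arrow Y A x'"
      using m[unfolded Q.monic_iff[OF quot_arrow_Hom[OF f]]] quot_arrow_Hom[OF x] quot_arrow_Hom[OF x'] 
      by blast
    \<comment> \<open>Two maps out of \<open>Y\<close> with equal classes agree on all maps from
      \<open>X\<close> to \<open>Y\<close>, among them the identity of \<open>Y\<close>.\<close>
    then have "x \<cdot> Ident C Y = x' \<cdot> Ident C Y"
      unfolding quot_arrow_eq_iff[OF x x'] using Y Ident_closed[OF X_Obj'[OF Y]] by blast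
    then show "x = x'" using Comp_Ident_right[OF x] Comp_Ident_right[OF x'] by simp
  qed
next
  assume m: "\<forall>Y\<in>X. \<forall>x\<in>Hom C Y A. \<forall>x'\<in>Hom C Y A. f \<cdot> x = f \<cdot> x' \<longrightarrow> x = x'"
  show "monic Q (quot_arrow A B f)"
    unfolding Q.monic_iff[OF quot_arrow_Hom[OF f]]
  proof (intro allI ballI impI)
    fix D \<phi> \<psi> assume \<phi>\<psi>: "\<phi> \<in> Hom Q D A" "\<psi> \<in> Hom Q D A" "quot_arrow A B f \<cdot>\<^bsub>Q\<^esub> \<phi> = quot_arrow A B f \<cdot>\<^bsub>Q\<^esub> \<psi>"
    obtain g where g: "g \<in> Hom C D A" "\<phi> = quot_arrow D A g" using \<phi>\<psi>(1) unfolding Hom_Q by blast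
    obtain h where h: "h \<in> Hom C D A" "\<psi> = quot_arrow D A h" using \<phi>\<psi>(2) unfolding Hom_Q by blast
    have e: "(f \<cdot> g) \<cdot> y = (f \<cdot> h) \<cdot> y" if "Y \<in> X" "y \<in> Hom C Y D" for Y y
      using \<phi>\<psi>(3) that unfolding g(2) h(2) Comp_quot_arrow[OF g(1) f] Comp_quot_arrow[OF h(1) f]
        quot_arrow_eq_iff[OF Comp_closed[OF g(1) f] Comp_closed[OF h(1) f]] by blast
    have "g \<cdot> y = h \<cdot> y" if Y: "Y \<in> X" and y: "y \<in> Hom C Y D" for Y y
      using m Y Comp_closed[OF y g(1)] Comp_closed[OF y h(1)] e[OF Y y] 
        Comp_assoc[OF y g(1) f] Comp_assoc[OF y h(1) f] by simp
    then show "\<phi> = \<psi>" unfolding g(2) h(2) quot_arrow_eq_iff[OF g(1) h(1)] by blast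
  qed
qed

text \<open>Let \<open>p : P -> A\<close> be an approximation and \<open>c\<close> the weak cokernel
  of \<open>f \<cdot> p\<close>. Then \<open>c \<cdot> f\<close> vanishes on \<open>X\<close>, hence
  is zero in the quotient; if \<open>f\<close> is epic there, so is \<open>c\<close>. Exactness then
  lifts every map from \<open>X\<close> to \<open>B\<close> along
  \<open>f \<cdot> p\<close>.\<close>

lemma epic_quot_arrow_iff:
  assumes f: "f \<in> Hom C A B"
  shows "epic Q (quot_arrow A B f) \<longleftrightarrow> (\<forall>Y\<in>X. \<forall>y\<in>Hom C Y B. \<exists>x\<in>Hom C Y A. y = f \<cdot> x)"
proof
  note A = Hom_objs(1)[OF f]
  assume m: "epic Q (quot_arrow A B f)"
  obtain P p where P: "P \<in> X" and p: "p \<in> Hom C P A" 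
    and pw: "\<And>Y y. \<lbrakk>Y\<in>X; y \<in> Hom C Y A\<rbrakk> \<Longrightarrow> \<exists>x \<in> Hom C Y P. y = p \<cdot> x"
    using approximation[OF A] by blast
  note fp = Comp_closed[OF p f]
  obtain E c where c: "c \<in> Hom C B E" "c \<cdot> (f \<cdot> p) = Zero C P E"
    and ck: "\<And>Y x. \<lbrakk>Y\<in>X; x \<in> Hom C Y B; c \<cdot> x = Zero C Y E\<rbrakk> \<Longrightarrow> \<exists>z \<in> Hom C Y P. x = (f \<cdot> p) \<cdot> z"
    using weak_cokernel[OF fp P] by blast
  note E = Hom_objs(2)[OF c(1)]
  have z: "Zero C B E \<in> Hom C B E" using Zero_closed[OF Hom_objs[OF c(1)]] .
  have "(c \<cdot> f) \<cdot> y = (Zero C B E \<cdot> f) \<cdot> y" if Y: "Y \<in> X" and y: "y \<in> Hom C Y A" for Y y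
  proof -
    obtain x where x: "x \<in> Hom C Y P" "y = p \<cdot> x" using pw[OF Y y] by blast
    have "(c \<cdot> f) \<cdot> y = c \<cdot> ((f \<cdot> p) \<cdot> x)"
      using Comp_assoc[OF y f c(1)] Comp_assoc[OF x(1) p f] x(2) by simp
    also have "\<dots> = Zero C Y E"
      using Comp_assoc[OF x(1) fp c(1)] c(2) Comp_Zero_left[OF x(1) E] by simp
    also have "\<dots> = (Zero C B E \<cdot> f) \<cdot> y"
      using Comp_Zero_left[OF f E] Comp_Zero_left[OF y E] by simp
    finally show ?thesis .
  qed
  then have "quot_arrow B E c \<cdot>\<^bsub>Q\<^esub> quot_arrow A B f = quot_arrow B E (Zero C B E) \<cdot>\<^bsub>Q\<^esub> quot_arrow A B f"
    unfolding Comp_quot_arrow[OF f c(1)] Comp_quot_arrow[OF f z] 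
      quot_arrow_eq_iff[OF Comp_closed[OF f c(1)] Comp_closed[OF f z]] by blast
  then have "quot_arrow B E c = quot_arrow B E (Zero C B E)"
    using m[unfolded Q.epic_iff[OF quot_arrow_Hom[OF f]]] quot_arrow_Hom[OF c(1)] quot_arrow_Hom[OF z] 
    by blast
  then have cz: "c \<cdot> y = Zero C Y E" if "Y \<in> X" "y \<in> Hom C Y B" for Y y
    using that Comp_Zero_left[OF that(2) E] unfolding quot_arrow_eq_iff[OF c(1) z] by simp
  show "\<forall>Y\<in>X. \<forall>y\<in>Hom C Y B. \<exists>x\<in>Hom C Y A. y = f \<cdot> x"
  proof (intro ballI)
    fix Y y assume Y: "Y \<in> X" and y: "y \<in> Hom C Y B"
    obtain x where x: "x \<in> Hom C Y P" "y = (f \<cdot> p) \<cdot> x" using ck[OF Y y cz[OF Y y]] by blast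
    then show "\<exists>x\<in>Hom C Y A. y = f \<cdot> x"
      using Comp_assoc[OF x(1) p f] Comp_closed[OF x(1) p] by metis
  qed
next
  assume s: "\<forall>Y\<in>X. \<forall>y\<in>Hom C Y B. \<exists>x\<in>Hom C Y A. y = f \<cdot> x"
  show "epic Q (quot_arrow A B f)"
    unfolding Q.epic_iff[OF quot_arrow_Hom[OF f]]
  proof (intro allI ballI impI)
    fix D \<phi> \<psi> assume \<phi>\<psi>: "\<phi> \<in> Hom Q B D" "\<psi> \<in> Hom Q B D" "\<phi> \<cdot>\<^bsub>Q\<^esub> quot_arrow A B f = \<psi> \<cdot>\<^bsub>Q\<^esub> quot_arrow A B f"
    obtain g where g: "g \<in> Hom C B D" "\<phi> = quot_arrow B D g" using \<phi>\<psi>(1) unfolding Hom_Q by blast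
    obtain h where h: "h \<in> Hom C B D" "\<psi> = quot_arrow B D h" using \<phi>\<psi>(2) unfolding Hom_Q by blast
    have e: "(g \<cdot> f) \<cdot> y = (h \<cdot> f) \<cdot> y" if "Y \<in> X" "y \<in> Hom C Y A" for Y y
      using \<phi>\<psi>(3) that unfolding g(2) h(2) Comp_quot_arrow[OF f g(1)] Comp_quot_arrow[OF f h(1)]
        quot_arrow_eq_iff[OF Comp_closed[OF f g(1)] Comp_closed[OF f h(1)]] by blast
    have "g \<cdot> y = h \<cdot> y" if Y: "Y \<in> X" and y: "y \<in> Hom C Y B" for Y y
    proof -
      obtain x where x: "x \<in> Hom C Y A" "y = f \<cdot> x" using s Y y by blast
      show ?thesis using e[OF Y x(1)] Comp_assoc[OF x(1) f g(1)] Comp_assoc[OF x(1) f h(1)] x(2) by simp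
    qed
    then show "\<phi> = \<psi>" unfolding g(2) h(2) quot_arrow_eq_iff[OF g(1) h(1)] by blast
  qed
qed

lemma regular_quot_arrow_iff:
  assumes f: "f \<in> Hom C A B"
  shows "quot_arrow A B f \<in> R \<longleftrightarrow> 
    (\<forall>Y\<in>X. \<forall>x\<in>Hom C Y A. \<forall>x'\<in>Hom C Y A. f \<cdot> x = f \<cdot> x' \<longrightarrow> x = x') \<and> 
    (\<forall>Y\<in>X. \<forall>y\<in>Hom C Y B. \<exists>x\<in>Hom C Y A. y = f \<cdot> x)"
  unfolding regular_arrows_def using monic_quot_arrow_iff[OF f] epic_quot_arrow_iff[OF f] by blast

lemma regular_resolution:
  assumes "A \<in> Obj C"
  obtains P q where "presented P" "P \<in> Obj C" "q \<in> Hom C P A" "quot_arrow P A q \<in> R"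
proof -
  obtain P q where q: "presented P" "q \<in> Hom C P A" 
    "\<And>Y y. \<lbrakk>Y \<in> X; y \<in> Hom C Y A\<rbrakk> \<Longrightarrow> \<exists>x\<in>Hom C Y P. y = q \<cdot> x"
    "\<And>Y y y'. \<lbrakk>Y \<in> X; y \<in> Hom C Y P; y' \<in> Hom C Y P; q \<cdot> y = q \<cdot> y'\<rbrakk> \<Longrightarrow> y = y'"
    using presented_resolution[OF assms] by blast
  then have "quot_arrow P A q \<in> R" unfolding regular_quot_arrow_iff[OF q(2)] by blast
  then show ?thesis using that[OF q(1) Hom_objs(1)[OF q(2)] q(2)] by blast
qed

text \<open>Under \<open>H\<close> the map \<open>s\<close> is invertible, so its inverse composed
  with \<open>H g\<close> is a transformation \<open>H P -> H D\<close>. As \<open>P\<close> is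
  presented, it comes from a map \<open>f\<close>, which lifts \<open>g\<close> up to the
  congruence.\<close>

lemma regular_lift:
  assumes P: "presented P" and g: "g \<in> Hom C P B" and s: "s \<in> Hom C D B" "quot_arrow D B s \<in> R"
  obtains f where "f \<in> Hom C P D" "quot_arrow P B (s \<cdot> f) = quot_arrow P B g"
proof -
  note PO = Hom_objs(1)[OF g] and D = Hom_objs(1)[OF s(1)]
  have inj: "\<And>Y x x'. \<lbrakk>Y \<in> X; x \<in> Hom C Y D; x' \<in> Hom C Y D; s \<cdot> x = s \<cdot> x'\<rbrakk> \<Longrightarrow> x = x'"
    and surj: "\<And>Y y. \<lbrakk>Y \<in> X; y \<in> Hom C Y B\<rbrakk> \<Longrightarrow> \<exists>x\<in>Hom C Y D. y = s \<cdot> x"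
    using s(2) unfolding regular_quot_arrow_iff[OF s(1)] by blast+
  define \<phi> where "\<phi> Y x = (SOME d. d \<in> Hom C Y D \<and> g \<cdot> x = s \<cdot> d)" for Y x
  have \<phi>: "\<phi> Y x \<in> Hom C Y D \<and> s \<cdot> \<phi> Y x = g \<cdot> x" if "Y \<in> X" "x \<in> Hom C Y P" for Y x
  proof -
    have "\<exists>d. d \<in> Hom C Y D \<and> g \<cdot> x = s \<cdot> d" using surj[OF that(1) Comp_closed[OF that(2) g]] by blast
    from someI_ex[OF this] show ?thesis unfolding \<phi>_def by simp
  qed
  have "natural_transformation C X (representable C P) (representable C D) \<phi>"
  proof (rule natural_transformation_lift[OF additive_representable[OF PO] additive_representable[OF D]
        natural_postcomposition[OF s(1)] natural_postcomposition[OF g]])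
    show "inj_on ((\<cdot>) s) (carrier (On_obj (representable C D) Y))" if "Y \<in> X" for Y
      using inj[OF that] by (auto intro: inj_onI)
  qed (use \<phi> in simp)
  then obtain f where f: "f \<in> Hom C P D" "\<And>Y x. \<lbrakk>Y \<in> X; x \<in> Hom C Y P\<rbrakk> \<Longrightarrow> \<phi> Y x = f \<cdot> x"
    using presented_full[OF P D] by blast
  have "(s \<cdot> f) \<cdot> x = g \<cdot> x" if "Y \<in> X" "x \<in> Hom C Y P" for Y x
    using \<phi>[OF that] f(2)[OF that] Comp_assoc[OF that(2) f(1) s(1)] by simp
  then have "quot_arrow P B (s \<cdot> f) = quot_arrow P B g"
    unfolding quot_arrow_eq_iff[OF Comp_closed[OF f(1) s(1)] g] by blast
  then show ?thesis using that[OF f(1)] by blast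
qed

section \<open>The Ore conditions and the two calculi of fractions\<close>

lemma Arr_Q_E:
  assumes "\<phi> \<in> Arr Q"
  obtains A B f where "f \<in> Hom C A B" "\<phi> = quot_arrow A B f" "Dom Q \<phi> = A" "Cod Q \<phi> = B"
proof -
  have "\<phi> \<in> Hom Q (Dom Q \<phi>) (Cod Q \<phi>)" using assms by (simp add: Hom_iff)
  then show ?thesis unfolding Hom_Q using that by blast
qed

text \<open>
  For the Ore condition of \<open>s\<close> and \<open>u\<close> take an approximation \<open>P \<rightarrow> A\<close> of the common source and the weak
  cokernel of \<open>P \<rightarrow> A \<rightarrow> B \<oplus> D\<close>. Its restriction to \<open>X\<close> is the pushout of the restrictions of \<open>s\<close> and \<open>u\<close>.
\<close>

lemma left_Ore:
  assumes s: "s \<in> Hom C A B" "quot_arrow A B s \<in> R" and u: "u \<in> Hom C A D"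
  obtains E v t where "v \<in> Hom C B E" "t \<in> Hom C D E" "quot_arrow D E t \<in> R"
    "quot_arrow A E (v \<cdot> s) = quot_arrow A E (t \<cdot> u)"
proof -
  note A = Hom_objs(1)[OF u] and B = Hom_objs(2)[OF s(1)] and D = Hom_objs(2)[OF u]
  have inj: "\<And>Y x x'. \<lbrakk>Y \<in> X; x \<in> Hom C Y A; x' \<in> Hom C Y A; s \<cdot> x = s \<cdot> x'\<rbrakk> \<Longrightarrow> x = x'"
    and surj: "\<And>Y y. \<lbrakk>Y \<in> X; y \<in> Hom C Y B\<rbrakk> \<Longrightarrow> \<exists>x\<in>Hom C Y A. y = s \<cdot> x"
    using s(2) unfolding regular_quot_arrow_iff[OF s(1)] by blast+
  obtain S where "direct_sum C B D S" using ex_direct_sum[OF B D] by blast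
  then obtain i j k l where S: "S \<in> Obj C" and 
    i: "i \<in> Hom C B S" and j: "j \<in> Hom C D S" and k: "k \<in> Hom C S B" and l: "l \<in> Hom C S D" and
    e: "k \<cdot> i = Ident C B" "l \<cdot> j = Ident C D" "k \<cdot> j = Zero C D B" "l \<cdot> i = Zero C B D"
       "Add C (i \<cdot> k) (j \<cdot> l) = Ident C S"
    unfolding direct_sum_def by blast
  obtain P p where P: "P \<in> X" and p: "p \<in> Hom C P A" 
    and pw: "\<And>Y y. \<lbrakk>Y\<in>X; y \<in> Hom C Y A\<rbrakk> \<Longrightarrow> \<exists>x \<in> Hom C Y P. y = p \<cdot> x"
    using approximation[OF A] by blast
  note sp = Comp_closed[OF p s(1)] and up = Comp_closed[OF p u]
  note isp = Comp_closed[OF sp i] and jup = Comp_closed[OF up j]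
  \<comment> \<open>The column with entries \<open>s \<cdot> p\<close> and the negative of
    \<open>u \<cdot> p\<close>, from \<open>P\<close> to the direct sum; annihilating it makes the
    square commute. The source is \<open>P\<close> because exact weak cokernels are available for
    maps out of \<open>X\<close>.\<close>
  define m where "m = Add C (i \<cdot> (s \<cdot> p)) (Neg C (j \<cdot> (u \<cdot> p)))"
  have m: "m \<in> Hom C P S" unfolding m_def using Add_closed[OF isp Neg_closed[OF jup]] .
  obtain E c where c: "c \<in> Hom C S E" "c \<cdot> m = Zero C P E"
    and cs: "\<And>Y y. \<lbrakk>Y\<in>X; y \<in> Hom C Y E\<rbrakk> \<Longrightarrow> \<exists>x \<in> Hom C Y S. y = c \<cdot> x"
    and ck: "\<And>Y x. \<lbrakk>Y\<in>X; x \<in> Hom C Y S; c \<cdot> x = Zero C Y E\<rbrakk> \<Longrightarrow> \<exists>z \<in> Hom C Y P. x = m \<cdot> z"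
    using weak_cokernel[OF m P] by blast
  note E = Hom_objs(2)[OF c(1)]
  define v t where "v = c \<cdot> i" and "t = c \<cdot> j"
  have v: "v \<in> Hom C B E" and t: "t \<in> Hom C D E" unfolding v_def t_def using Comp_closed i j c(1) by blast+
  have "Add C (c \<cdot> (i \<cdot> (s \<cdot> p))) (Neg C (c \<cdot> (j \<cdot> (u \<cdot> p)))) = Zero C P E"
    using c(2) Comp_Add_right[OF isp Neg_closed[OF jup] c(1)] Comp_Neg_right[OF jup c(1)]
    unfolding m_def by simp
  then have "c \<cdot> (i \<cdot> (s \<cdot> p)) = c \<cdot> (j \<cdot> (u \<cdot> p))"
    using Add_Neg_eq_Zero[OF Comp_closed[OF isp c(1)] Comp_closed[OF jup c(1)]] by blast
  then have vt: "v \<cdot> (s \<cdot> p) = t \<cdot> (u \<cdot> p)"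
    unfolding v_def t_def using Comp_assoc[OF sp i c(1)] Comp_assoc[OF up j c(1)] by simp
  have vst: "v \<cdot> (s \<cdot> x) = t \<cdot> (u \<cdot> x)" if Y: "Y \<in> X" and x: "x \<in> Hom C Y A" for Y x
  proof -
    obtain z where z: "z \<in> Hom C Y P" "x = p \<cdot> z" using pw[OF Y x] by blast
    have "v \<cdot> (s \<cdot> x) = (v \<cdot> (s \<cdot> p)) \<cdot> z"
      using z(2) Comp_assoc[OF z(1) p s(1)] Comp_assoc[OF z(1) sp v] by simp
    also have "\<dots> = t \<cdot> (u \<cdot> x)"
      using vt z(2) Comp_assoc[OF z(1) p u] Comp_assoc[OF z(1) up t] by simp
    finally show ?thesis .
  qed
  have "(v \<cdot> s) \<cdot> x = (t \<cdot> u) \<cdot> x" if "Y \<in> X" "x \<in> Hom C Y A" for Y x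
    using vst[OF that] Comp_assoc[OF that(2) s(1) v] Comp_assoc[OF that(2) u t] by simp
  then have comm: "quot_arrow A E (v \<cdot> s) = quot_arrow A E (t \<cdot> u)"
    unfolding quot_arrow_eq_iff[OF Comp_closed[OF s(1) v] Comp_closed[OF u t]] by blast
  \<comment> \<open>Lift \<open>y\<close> to \<open>z\<close> in the direct sum. The component of
    \<open>z\<close> in \<open>B\<close> has the form \<open>s \<cdot> x\<close>, and
    \<open>v \<cdot> (s \<cdot> x) = t \<cdot> (u \<cdot> x)\<close> moves its contribution into the
    image of \<open>t\<close>.\<close>
  have t_surj: "\<exists>d\<in>Hom C Y D. y = t \<cdot> d" if Y: "Y \<in> X" and y: "y \<in> Hom C Y E" for Y y
  proof -
    obtain z where z: "z \<in> Hom C Y S" "y = c \<cdot> z" using cs[OF Y y] by blast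
    have kz: "k \<cdot> z \<in> Hom C Y B" and lz: "l \<cdot> z \<in> Hom C Y D" using Comp_closed[OF z(1)] k l by auto
    obtain x where x: "x \<in> Hom C Y A" "k \<cdot> z = s \<cdot> x" using surj[OF Y kz] by blast
    have "z = Add C (i \<cdot> k) (j \<cdot> l) \<cdot> z" using e(5) Comp_Ident_left[OF z(1)] by simp
    also have "\<dots> = Add C (i \<cdot> (k \<cdot> z)) (j \<cdot> (l \<cdot> z))"
      using Comp_Add_left[OF z(1) Comp_closed[OF k i] Comp_closed[OF l j]] 
        Comp_assoc[OF z(1) k i] Comp_assoc[OF z(1) l j] by simp
    finally have "c \<cdot> z = c \<cdot> Add C (i \<cdot> (k \<cdot> z)) (j \<cdot> (l \<cdot> z))" by simp
    also have "\<dots> = Add C (v \<cdot> (k \<cdot> z)) (t \<cdot> (l \<cdot> z))"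
      unfolding v_def t_def using Comp_Add_right[OF Comp_closed[OF kz i] Comp_closed[OF lz j] c(1)]
        Comp_assoc[OF kz i c(1)] Comp_assoc[OF lz j c(1)] by simp
    also have "v \<cdot> (k \<cdot> z) = t \<cdot> (u \<cdot> x)" using x(2) vst[OF Y x(1)] by simp
    also have "Add C (t \<cdot> (u \<cdot> x)) (t \<cdot> (l \<cdot> z)) = t \<cdot> Add C (u \<cdot> x) (l \<cdot> z)"
      using Comp_Add_right[OF Comp_closed[OF x(1) u] lz t] by simp
    finally show ?thesis using z(2) Add_closed[OF Comp_closed[OF x(1) u] lz] by blast
  qed
  \<comment> \<open>If \<open>t\<close> kills \<open>y\<close>, then
    \<open>j \<cdot> y = m \<cdot> w\<close> for some \<open>w\<close>. The component in
    \<open>B\<close> says that \<open>s\<close> kills \<open>p \<cdot> w\<close>, so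
    \<open>p \<cdot> w = 0\<close> by injectivity, and the component in \<open>D\<close> then says
    that \<open>y = 0\<close>.\<close>
  have t_inj0: "y = Zero C Y D" if Y: "Y \<in> X" and y: "y \<in> Hom C Y D" "t \<cdot> y = Zero C Y E" for Y y
  proof -
    note YO = X_Obj'[OF Y]
    note jy = Comp_closed[OF y(1) j]
    have "c \<cdot> (j \<cdot> y) = Zero C Y E" using y(2) Comp_assoc[OF y(1) j c(1)] unfolding t_def by simp
    then obtain w where w: "w \<in> Hom C Y P" "j \<cdot> y = m \<cdot> w" using ck[OF Y jy] by blast
    note pw' = Comp_closed[OF w(1) p]
    note spw = Comp_closed[OF pw' s(1)] and upw = Comp_closed[OF pw' u]
    note ispw = Comp_closed[OF spw i] and jupw = Comp_closed[OF upw j]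
    have mw: "j \<cdot> y = Add C (i \<cdot> (s \<cdot> (p \<cdot> w))) (Neg C (j \<cdot> (u \<cdot> (p \<cdot> w))))"
      using w(2) Comp_Add_left[OF w(1) isp Neg_closed[OF jup]] Comp_Neg_left[OF w(1) jup]
        Comp_assoc[OF w(1) sp i] Comp_assoc[OF w(1) up j] Comp_assoc[OF w(1) p s(1)] Comp_assoc[OF w(1) p u]
      unfolding m_def by simp
    have kj: "k \<cdot> (j \<cdot> d) = Zero C Y B" if "d \<in> Hom C Y D" for d
      using Comp_assoc[OF that j k] e(3) Comp_Zero_left[OF that B] by simp
    have "Zero C Y B = k \<cdot> Add C (i \<cdot> (s \<cdot> (p \<cdot> w))) (Neg C (j \<cdot> (u \<cdot> (p \<cdot> w))))"
      using kj[OF y(1)] mw by simp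
    also have "\<dots> = Add C (k \<cdot> (i \<cdot> (s \<cdot> (p \<cdot> w)))) (Neg C (k \<cdot> (j \<cdot> (u \<cdot> (p \<cdot> w)))))"
      using Comp_Add_right[OF ispw Neg_closed[OF jupw] k] Comp_Neg_right[OF jupw k] by simp
    also have "\<dots> = s \<cdot> (p \<cdot> w)"
      unfolding kj[OF upw] Neg_Zero[OF YO B]
      using Comp_assoc[OF spw i k] e(1) Comp_Ident_left[OF spw] Add_Zero_right[OF spw] by simp
    \<comment> \<open>This rewrites the left-hand side of the chain, so that both ends become
      composites with \<open>s\<close>.\<close>
    also have "Zero C Y B = s \<cdot> Zero C Y A" using Comp_Zero_right[OF s(1) YO] by simp
    finally have "p \<cdot> w = Zero C Y A"
      using inj[OF Y Zero_closed[OF YO A] pw'] by simp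
    then have upw0: "u \<cdot> (p \<cdot> w) = Zero C Y D" and spw0: "s \<cdot> (p \<cdot> w) = Zero C Y B"
      using Comp_Zero_right[OF u YO] Comp_Zero_right[OF s(1) YO] by simp_all
    have "j \<cdot> y = Zero C Y S"
      using mw unfolding upw0 spw0 Comp_Zero_right[OF i YO] Comp_Zero_right[OF j YO] Neg_Zero[OF YO S]
        Add_Zero_right[OF Zero_closed[OF YO S]] .
    then have "l \<cdot> (j \<cdot> y) = Zero C Y D" using Comp_Zero_right[OF l YO] by simp
    then show ?thesis using Comp_assoc[OF y(1) j l] e(2) Comp_Ident_left[OF y(1)] by simp
  qed
  have t_inj: "y = y'" if Y: "Y \<in> X" and y: "y \<in> Hom C Y D" and y': "y' \<in> Hom C Y D" and eq: "t \<cdot> y = t \<cdot> y'"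
    for Y y y'
    using inj_if_kernel_trivial[OF t y y' eq t_inj0[OF Y]] .
  have "quot_arrow D E t \<in> R" unfolding regular_quot_arrow_iff[OF t] using t_inj t_surj by blast
  then show ?thesis using that[OF v t _ comm] by blast
qed

theorem left_calculus: "left_calculus_of_fractions Q R"
  unfolding left_calculus_of_fractions_def
proof (intro conjI ballI impI)
  show "R \<subseteq> Arr Q" by (rule Q.regular_arrows_calculus_basics(1))
  show "Ident Q A \<in> R" if "A \<in> Obj Q" for A by (rule Q.regular_arrows_calculus_basics(2)[OF that])
  show "t \<cdot>\<^bsub>Q\<^esub> s \<in> R" if "s \<in> R" "t \<in> R" "Dom Q t = Cod Q s" for s t
    by (rule Q.regular_arrows_calculus_basics(3)[OF that])
next
  fix \<sigma> \<upsilon> assume \<sigma>: "\<sigma> \<in> R" and \<upsilon>: "\<upsilon> \<in> Arr Q" and d: "Dom Q \<upsilon> = Dom Q \<sigma>"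
  have "\<sigma> \<in> Arr Q" using \<sigma> Q.regular_arrows_calculus_basics(1) by blast
  then obtain A B s where s: "s \<in> Hom C A B" "\<sigma> = quot_arrow A B s" "Dom Q \<sigma> = A" "Cod Q \<sigma> = B"
    using Arr_Q_E by blast
  obtain A' D u where u: "u \<in> Hom C A' D" "\<upsilon> = quot_arrow A' D u" "Dom Q \<upsilon> = A'" "Cod Q \<upsilon> = D"
    using Arr_Q_E[OF \<upsilon>] by blast
  have "A' = A" using d s u by simp
  then have u': "u \<in> Hom C A D" "\<upsilon> = quot_arrow A D u" using u by simp_all
  obtain E v t where vt: "v \<in> Hom C B E" "t \<in> Hom C D E" "quot_arrow D E t \<in> R"
    "quot_arrow A E (v \<cdot> s) = quot_arrow A E (t \<cdot> u)"
    by (rule left_Ore[OF s(1) \<sigma>[unfolded s(2)] u'(1)]) (rule that)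
  note v' = quot_arrow_Hom[OF vt(1)] and t' = quot_arrow_Hom[OF vt(2)]
  show "\<exists>\<tau>\<in>R. \<exists>\<nu>\<in>Arr Q. Dom Q \<tau> = Cod Q \<upsilon> \<and> Dom Q \<nu> = Cod Q \<sigma> \<and> Cod Q \<tau> = Cod Q \<nu> \<and> \<nu> \<cdot>\<^bsub>Q\<^esub> \<sigma> = \<tau> \<cdot>\<^bsub>Q\<^esub> \<upsilon>"
  proof (rule bexI[OF _ vt(3)], rule bexI, intro conjI)
    show "quot_arrow B E v \<in> Arr Q" using v' by (simp add: Hom_iff)
    show "Dom Q (quot_arrow D E t) = Cod Q \<upsilon>" using Hom_DomD[OF t'] u(4) by simp
    show "Dom Q (quot_arrow B E v) = Cod Q \<sigma>" using Hom_DomD[OF v'] s(4) by simp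
    show "Cod Q (quot_arrow D E t) = Cod Q (quot_arrow B E v)" using Hom_CodD[OF v'] Hom_CodD[OF t'] by simp
    show "quot_arrow B E v \<cdot>\<^bsub>Q\<^esub> \<sigma> = quot_arrow D E t \<cdot>\<^bsub>Q\<^esub> \<upsilon>"
      unfolding s(2) u'(2) Comp_quot_arrow[OF s(1) vt(1)] Comp_quot_arrow[OF u'(1) vt(2)] by (rule vt(4))
  qed
next
  fix A B f g s assume A: "A \<in> Obj Q" and B: "B \<in> Obj Q" and f: "f \<in> Hom Q A B" and g: "g \<in> Hom Q A B" 
    and s: "s \<in> R" and e: "Cod Q s = A \<and> f \<cdot>\<^bsub>Q\<^esub> s = g \<cdot>\<^bsub>Q\<^esub> s"
  \<comment> \<open>Elements of \<open>R\<close> are epic in the factor category, so the two arrows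
    are already equal and an identity can serve as \<open>t\<close>.\<close>
  have "f = g" using s e f g A B unfolding regular_arrows_def epic_def by blast
  then show "\<exists>t\<in>R. Dom Q t = B \<and> t \<cdot>\<^bsub>Q\<^esub> f = t \<cdot>\<^bsub>Q\<^esub> g"
    using Q.regular_arrows_calculus_basics(2)[OF B] Hom_DomD[OF Q.Ident_closed[OF B]] by blast
qed

text \<open>For the Ore condition of \<open>s\<close> and \<open>u\<close>, resolve the source of
  \<open>u\<close> by a regular \<open>q\<close> from a presented object and lift
  \<open>u \<cdot> q\<close> along \<open>s\<close>. Cancellation is immediate since elements of
  \<open>R\<close> are monic.\<close>

theorem right_calculus: "right_calculus_of_fractions Q R"
  unfolding right_calculus_of_fractions_def
proof (intro conjI ballI impI)
  show "R \<subseteq> Arr Q" by (rule Q.regular_arrows_calculus_basics(1))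
  show "Ident Q A \<in> R" if "A \<in> Obj Q" for A by (rule Q.regular_arrows_calculus_basics(2)[OF that])
  show "t \<cdot>\<^bsub>Q\<^esub> s \<in> R" if "s \<in> R" "t \<in> R" "Dom Q t = Cod Q s" for s t
    by (rule Q.regular_arrows_calculus_basics(3)[OF that])
next
  fix \<sigma> \<upsilon> assume \<sigma>: "\<sigma> \<in> R" and \<upsilon>: "\<upsilon> \<in> Arr Q" and d: "Cod Q \<upsilon> = Cod Q \<sigma>"
  have "\<sigma> \<in> Arr Q" using \<sigma> Q.regular_arrows_calculus_basics(1) by blast
  then obtain D B s where s: "s \<in> Hom C D B" "\<sigma> = quot_arrow D B s" "Dom Q \<sigma> = D" "Cod Q \<sigma> = B"
    using Arr_Q_E by blast
  obtain A B' u where u: "u \<in> Hom C A B'" "\<upsilon> = quot_arrow A B' u" "Dom Q \<upsilon> = A" "Cod Q \<upsilon> = B'"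
    using Arr_Q_E[OF \<upsilon>] by blast
  have "B' = B" using d s u by simp
  then have u': "u \<in> Hom C A B" "\<upsilon> = quot_arrow A B u" using u by simp_all
  obtain P q where q: "presented P" "q \<in> Hom C P A" "quot_arrow P A q \<in> R"
    using regular_resolution[OF Hom_objs(1)[OF u'(1)]] by blast
  obtain v where v: "v \<in> Hom C P D" "quot_arrow P B (s \<cdot> v) = quot_arrow P B (u \<cdot> q)"
    using regular_lift[OF q(1) Comp_closed[OF q(2) u'(1)] s(1)] \<sigma> s(2) by blast
  note v' = quot_arrow_Hom[OF v(1)] and q' = quot_arrow_Hom[OF q(2)]
  show "\<exists>\<tau>\<in>R. \<exists>\<nu>\<in>Arr Q. Cod Q \<tau> = Dom Q \<upsilon> \<and> Cod Q \<nu> = Dom Q \<sigma> \<and> Dom Q \<tau> = Dom Q \<nu> \<and> \<sigma> \<cdot>\<^bsub>Q\<^esub> \<nu> = \<upsilon> \<cdot>\<^bsub>Q\<^esub> \<tau>"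
  proof (rule bexI[OF _ q(3)], rule bexI, intro conjI)
    show "quot_arrow P D v \<in> Arr Q" using v' by (simp add: Hom_iff)
    show "Cod Q (quot_arrow P A q) = Dom Q \<upsilon>" using Hom_CodD[OF q'] u(3) by simp
    show "Cod Q (quot_arrow P D v) = Dom Q \<sigma>" using Hom_CodD[OF v'] s(3) by simp
    show "Dom Q (quot_arrow P A q) = Dom Q (quot_arrow P D v)" using Hom_DomD[OF v'] Hom_DomD[OF q'] by simp
    show "\<sigma> \<cdot>\<^bsub>Q\<^esub> quot_arrow P D v = \<upsilon> \<cdot>\<^bsub>Q\<^esub> quot_arrow P A q"
      unfolding s(2) u'(2) Comp_quot_arrow[OF v(1) s(1)] Comp_quot_arrow[OF q(2) u'(1)] by (rule v(2))
  qed
next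
  fix A B f g s assume A: "A \<in> Obj Q" and B: "B \<in> Obj Q" and f: "f \<in> Hom Q A B" and g: "g \<in> Hom Q A B" 
    and s: "s \<in> R" and e: "Dom Q s = B \<and> s \<cdot>\<^bsub>Q\<^esub> f = s \<cdot>\<^bsub>Q\<^esub> g"
  have "f = g" using s e f g A B unfolding regular_arrows_def monic_def by blast
  then show "\<exists>t\<in>R. Cod Q t = A \<and> f \<cdot>\<^bsub>Q\<^esub> t = g \<cdot>\<^bsub>Q\<^esub> t"
    using Q.regular_arrows_calculus_basics(2)[OF A] Hom_CodD[OF Q.Ident_closed[OF A]] by blast
qed

end

section \<open>The restricted Yoneda functor\<close>

context small_weak_cokernel_category
begin

interpretation Q: category Q by (rule category_Q)
interpretation M: category M by (rule category_mod_category)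

text \<open>One copy of \<open>H A\<close> is fixed for each object, together with its bijection, so
  that the restricted Yoneda construction becomes a function on objects.\<close>

definition realization :: "'o \<Rightarrow> ('o, 'm, 'g) ab_functor \<times> ('o \<Rightarrow> 'm \<Rightarrow> 'g)" where
  "realization A = (SOME r. coherent C X (fst r) \<and> realizes C X A (fst r) (snd r))"

definition yoneda_obj :: "'o \<Rightarrow> ('o, 'm, 'g) ab_functor" where
  "yoneda_obj A = fst (realization A)"

definition yoneda_map :: "'o \<Rightarrow> 'o \<Rightarrow> 'm \<Rightarrow> ('o, 'm, 'g) ab_transformation" where
  "yoneda_map A B f = realized_arrow C X A (yoneda_obj A) (snd (realization A)) 
     (yoneda_obj B) (snd (realization B)) f"

text \<open>An arbitrary representative of the coset may be taken: all of them have the same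
  composites with maps from \<open>X\<close>.\<close>

definition yoneda_arr :: "'o \<times> 'o \<times> 'm set \<Rightarrow> ('o, 'm, 'g) ab_transformation" where
  "yoneda_arr = (\<lambda>(A, B, c). yoneda_map A B (SOME f. f \<in> c))"

lemma yoneda_obj:
  assumes "A \<in> Obj C"
  shows "coherent C X (yoneda_obj A)" "realizes C X A (yoneda_obj A) (snd (realization A))"
proof -
  obtain F :: "('o, 'm, 'g) ab_functor" and \<rho> where "coherent C X F" "realizes C X A F \<rho>"
    using ex_realization[OF assms] .
  then have "\<exists>r :: ('o, 'm, 'g) ab_functor \<times> ('o \<Rightarrow> 'm \<Rightarrow> 'g). 
      coherent C X (fst r) \<and> realizes C X A (fst r) (snd r)"
    by (intro exI[of _ "(F, \<rho>)"]) simp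
  from someI_ex[OF this] show "coherent C X (yoneda_obj A)" 
    "realizes C X A (yoneda_obj A) (snd (realization A))"
    unfolding yoneda_obj_def realization_def by blast+
qed

text \<open>Both sides express that \<open>f\<close> and \<open>g\<close> have the same composites
  with all maps from \<open>X\<close>. One direction makes the functor on the quotient well defined,
  the other makes it faithful.\<close>

lemma yoneda_map_eq_iff:
  assumes "f \<in> Hom C A B" "g \<in> Hom C A B"
  shows "yoneda_map A B f = yoneda_map A B g \<longleftrightarrow> quot_arrow A B f = quot_arrow A B g"
  unfolding yoneda_map_def quot_arrow_eq_iff[OF assms]
  using realized_arrow_eq_iff[OF yoneda_obj(2) yoneda_obj(2) assms] Hom_objs[OF assms(1)] by blast

lemma yoneda_arr:
  assumes f: "f \<in> Hom C A B"
  shows "yoneda_arr (quot_arrow A B f) = yoneda_map A B f"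
proof -
  have "f \<in> agreeing A B f" using f unfolding agreeing_def by simp
  then have "(SOME g. g \<in> agreeing A B f) \<in> agreeing A B f" by (rule someI)
  then have g: "(SOME g. g \<in> agreeing A B f) \<in> Hom C A B"
    "\<forall>Y\<in>X. \<forall>y\<in>Hom C Y A. (SOME g. g \<in> agreeing A B f) \<cdot> y = f \<cdot> y"
    unfolding agreeing_def by blast+
  then have "yoneda_map A B (SOME g. g \<in> agreeing A B f) = yoneda_map A B f"
    unfolding yoneda_map_eq_iff[OF g(1) f] quot_arrow_eq_iff[OF g(1) f] by blast
  then show ?thesis unfolding yoneda_arr_def quot_arrow_def by simp
qed

lemma yoneda_map_Hom:
  assumes f: "f \<in> Hom C A B"
  shows "yoneda_map A B f \<in> Hom M (yoneda_obj A) (yoneda_obj B)"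
  unfolding yoneda_map_def using realized_arrow_Hom yoneda_obj Hom_objs[OF f] f by blast

lemma yoneda_functor: "is_functor Q M yoneda_obj yoneda_arr"
proof (rule is_functorI[OF category_Q category_mod_category])
  show "yoneda_obj A \<in> Obj M" if "A \<in> Obj Q" for A
    using that yoneda_obj(1) by (simp add: Obj_Q Obj_mod_category)
  show "yoneda_arr \<phi> \<in> Hom M (yoneda_obj A) (yoneda_obj B)" if "\<phi> \<in> Hom Q A B" for \<phi> A B
    using that yoneda_map_Hom unfolding Hom_Q by (auto simp: yoneda_arr)
  show "yoneda_arr (Ident Q A) = Ident M (yoneda_obj A)" if "A \<in> Obj Q" for A
  proof -
    have A: "A \<in> Obj C" using that by (simp add: Obj_Q)
    show ?thesis
      unfolding Ident_Q[OF A] yoneda_arr[OF Ident_closed[OF A]] yoneda_map_def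
      by (rule realized_arrow_Ident[OF yoneda_obj(2)[OF A]])
  qed
  fix \<phi> \<psi> A B D assume "\<phi> \<in> Hom Q A B" "\<psi> \<in> Hom Q B D"
  then obtain f g where f: "f \<in> Hom C A B" "\<phi> = quot_arrow A B f" and g: "g \<in> Hom C B D" "\<psi> = quot_arrow B D g"
    unfolding Hom_Q by blast
  show "yoneda_arr (\<psi> \<cdot>\<^bsub>Q\<^esub> \<phi>) = yoneda_arr \<psi> \<cdot>\<^bsub>M\<^esub> yoneda_arr \<phi>"
    unfolding f(2) g(2) Comp_quot_arrow[OF f(1) g(1)] yoneda_arr[OF f(1)] yoneda_arr[OF g(1)]
      yoneda_arr[OF Comp_closed[OF f(1) g(1)]] yoneda_map_def
    using realized_arrow_Comp[OF yoneda_obj(2) yoneda_obj(2) f(1) g(1)] Hom_objs[OF f(1)] by simp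
qed

lemma yoneda_faithful: "faithful_functor Q yoneda_arr"
  unfolding faithful_functor_def inj_on_def
proof (intro allI ballI impI)
  fix A B \<phi> \<psi> assume "\<phi> \<in> Hom Q A B" "\<psi> \<in> Hom Q A B" and e: "yoneda_arr \<phi> = yoneda_arr \<psi>"
  then obtain f g where f: "f \<in> Hom C A B" "\<phi> = quot_arrow A B f" and g: "g \<in> Hom C A B" "\<psi> = quot_arrow A B g"
    unfolding Hom_Q by blast
  show "\<phi> = \<psi>"
    using e unfolding f(2) g(2) yoneda_arr[OF f(1)] yoneda_arr[OF g(1)] yoneda_map_eq_iff[OF f(1) g(1)] .
qed

lemma yoneda_inverts:
  assumes "\<phi> \<in> R"
  shows "isomorphism M (yoneda_arr \<phi>)"
proof -
  have "\<phi> \<in> Arr Q" using assms Q.regular_arrows_calculus_basics(1) by blast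
  then obtain A B f where f: "f \<in> Hom C A B" "\<phi> = quot_arrow A B f" using Arr_Q_E by blast
  note o = Hom_objs[OF f(1)]
  have "\<forall>Y\<in>X. \<forall>x\<in>Hom C Y A. \<forall>x'\<in>Hom C Y A. f \<cdot> x = f \<cdot> x' \<longrightarrow> x = x'"
    "\<forall>Y\<in>X. \<forall>y\<in>Hom C Y B. \<exists>x\<in>Hom C Y A. y = f \<cdot> x"
    using assms unfolding f(2) regular_quot_arrow_iff[OF f(1)] by blast+
  then show ?thesis
    unfolding f(2) yoneda_arr[OF f(1)] yoneda_map_def
    by (intro realized_arrow_isomorphism[OF yoneda_obj(2)[OF o(1)] yoneda_obj(1)[OF o(1)] 
          yoneda_obj(2)[OF o(2)] yoneda_obj(1)[OF o(2)] f(1)]) blast+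
qed

lemma yoneda_full_from_presented:
  assumes P: "presented P" "P \<in> Obj C" and B: "B \<in> Obj C" and g: "g \<in> Hom M (yoneda_obj P) (yoneda_obj B)"
  shows "\<exists>f \<in> Hom Q P B. yoneda_arr f = g"
proof -
  obtain \<eta> where n: "natural_transformation C X (yoneda_obj P) (yoneda_obj B) \<eta>" 
    and e: "g = trans_arrow X (yoneda_obj P) (yoneda_obj B) \<eta>"
    using g by (elim Hom_mod_categoryE)
  note r = yoneda_obj(2)[OF P(2)]
  obtain f where f: "f \<in> Hom C P B" "\<And>Y x. \<lbrakk>Y \<in> X; x \<in> Hom C Y P\<rbrakk> \<Longrightarrow> 
      \<eta> Y (snd (realization P) Y x) = snd (realization B) Y (f \<cdot> x)"
    using realized_arrow_full[OF P B r coherent_additive[OF yoneda_obj(1)[OF P(2)]] yoneda_obj(2)[OF B] n]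
    by blast
  have "yoneda_map P B f = g"
    unfolding yoneda_map_def realized_arrow_def e trans_arrow_realized_eq_iff[OF r]
    using f(2) by (simp add: realizes_inv[OF r])
  then show ?thesis using quot_arrow_Hom[OF f(1)] yoneda_arr[OF f(1)] by blast
qed

text \<open>A coherent \<open>F\<close> is a copy of some \<open>H A\<close>, and so is the chosen
  functor of \<open>A\<close>. The isomorphism between the two copies is induced by the identity of
  \<open>A\<close>.\<close>

lemma yoneda_essentially_surjective: "essentially_surjective Q M yoneda_obj"
  unfolding essentially_surjective_def
proof (intro ballI)
  fix F assume "F \<in> Obj M"
  then have F: "coherent C X F" by (simp add: Obj_mod_category)
  obtain A \<rho> where A: "A \<in> Obj C" and r: "realizes C X A F \<rho>" using coherent_realized[OF F] .
  note y = yoneda_obj[OF A] and I = Ident_closed[OF A]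
  let ?e = "realized_arrow C X A (yoneda_obj A) (snd (realization A)) F \<rho> (Ident C A)"
  have "?e \<in> Hom M (yoneda_obj A) F" by (rule realized_arrow_Hom[OF y(2,1) r F I])
  moreover have "isomorphism M ?e"
    by (rule realized_arrow_isomorphism[OF y(2,1) r F I]) (auto simp: Comp_Ident_left)
  ultimately show "\<exists>A\<in>Obj Q. \<exists>e\<in>Hom M (yoneda_obj A) F. isomorphism M e"
    using A unfolding Obj_Q by blast
qed

text \<open>The denominators required by \<open>localization_equivalence\<close> are the regular
  resolutions by presented objects, at which the restricted Yoneda functor is full.\<close>

theorem localization_equivalent_mod_category: "equivalent_categories (localization Q R) M"
proof -
  interpret inverting_functor Q R M yoneda_obj yoneda_arr
    by unfold_locales (simp_all add: Q.regular_arrows_calculus_basics(1) yoneda_functor yoneda_inverts)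
  have "\<exists>P q. q \<in> R \<and> q \<in> Hom Q P A \<and> (\<forall>B. \<forall>g \<in> Hom M (yoneda_obj P) (yoneda_obj B). 
      B \<in> Obj Q \<longrightarrow> (\<exists>f \<in> Hom Q P B. yoneda_arr f = g))" if "A \<in> Obj Q" for A
  proof -
    have "A \<in> Obj C" using that unfolding Obj_Q .
    then obtain P q where P: "presented P" "P \<in> Obj C" and q: "q \<in> Hom C P A" "quot_arrow P A q \<in> R"
      by (rule regular_resolution)
    then show ?thesis using quot_arrow_Hom[OF q(1)] yoneda_full_from_presented[OF P] unfolding Obj_Q by blast
  qed
  then show ?thesis
    using localization_equivalence[OF yoneda_faithful _ yoneda_essentially_surjective]
    unfolding equivalent_categories_def by blast
qed

end

section \<open>Specialization to a contravariantly finite rigid subcategory of a triangulated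
  category\<close>

theorem theoremA:
  fixes T :: "('o, 'm) tri_cat" and X :: "'o set"
  assumes "triangulated_category T"
    and "split_idempotents T"
    and "locally_small T TYPE('g)"
    and "additive_subcategory T X"
    and "contravariantly_finite T X"
    and "rigid T X"
  defines "Q \<equiv> factor_category T (right_perp T X)"
    and "R \<equiv> regular_arrows (factor_category T (right_perp T X))"
    and "M \<equiv> (mod_category T X
           :: (('o, 'm, 'g) ab_functor, ('o, 'm, 'g) ab_transformation) preadd_cat)"
  shows "left_calculus_of_fractions Q R \<and> right_calculus_of_fractions Q R \<and>
         abelian_category M \<and> equivalent_categories (localization Q R) M"
proof -
  have "X \<subseteq> Obj T" using assms(4) unfolding additive_subcategory_def by blast
  then have "weak_cokernel_category T X"
    using triangulated_category.weak_cokernel_category_of_rigid[OF assms(1)] assms(5,6) by blast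
  then interpret small_weak_cokernel_category T X "TYPE('g)"
    using assms(3) by (simp add: small_weak_cokernel_category_def small_weak_cokernel_category_axioms_def)
  show ?thesis
    unfolding Q_def R_def M_def
    using left_calculus right_calculus abelian_mod_category localization_equivalent_mod_category by blast
qed

end
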